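(* Let $\mathcal{G}=(X,Y,A,B,\lambda)$ be a mirror game and let $p\in\mathcal{C}_{\rm ns}(\lambda)$. The following are equivalent: (i) $p\in\mathcal{C}_{\rm qc}(\lambda)$; (ii) there exist a trace $\tau:\mathcal{A}(X,A)\to\mathbb{C}$ and a unital *-homomorphism $\rho:\mathcal{A}(Y,B)\to\mathcal{A}(X,A)$ with $\rho(\mathcal{S}_{Y,B})\subseteq\mathcal{S}_{X,A}$ such that $$p(a,b|x,y)=\tau(e_{x,a}\rho(f_{y,b})),\quad x\in X,\ y\in Y,\ a\in A,\ b\in B.$$
   Context: $X,Y,A,B$ are finite non-empty sets. A non-signalling game is a tuple $(X,Y,A,B,\lambda)$ with $\lambda:X\times Y\times A\times B\to\{0,1\}$. It is a mirror game if there exist functions $\xi:X\to Y$ and $\eta:Y\to X$ such that $\lambda(x,\xi(x),a,b)\lambda(x,\xi(x),a',b)=0$ for all $x\in X$, $b\in B$, $a,a'\in A$ with $a\ne a'$, and $\lambda(\eta(y),y,a,b)\lambda(\eta(y),y,a,b')=0$ for all $y\in Y$, $a\in A$, $b,b'\in B$ with $b\neq b'$. $\mathcal{A}(X,A)$ is the unital C*-algebra free product, amalgamated over the unit, of $|X|$ copies of $\ell^\infty(A)$, indexed by $X$; $(e_{x,a})_{a\in A}$ is the canonical basis of the $x$-th copy; $\mathcal{S}_{X,A}={\rm span}\{e_{x,a}:x\in X,a\in A\}\subseteq\mathcal{A}(X,A)$. The corresponding generators of $\mathcal{A}(Y,B)$ are denoted $f_{y,b}$, with span $\mathcal{S}_{Y,B}$.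 A trace on a C*-algebra is a positive linear functional $\tau$ with $\tau(zw)=\tau(wz)$ for all $z,w$. $\mathcal{C}_{\rm ns}$ is the set of non-signalling correlations, i.e. families $p=\{p(a,b|x,y)\}$ such that each $p(\cdot,\cdot|x,y)$ is a probability distribution on $A\times B$, $\sum_{b}p(a,b|x,y)=\sum_b p(a,b|x,y')$ for all $x,y,y',a$, and $\sum_a p(a,b|x,y)=\sum_a p(a,b|x',y)$ for all $x,x',y,b$. A PVM is a finite tuple of projections on a Hilbert space summing to the identity. $\mathcal{C}_{\rm qc}$ is the set of correlations $p(a,b|x,y)=\langle\zeta|P_{x,a}Q_{y,b}|\zeta\rangle$ with $\zeta$ a unit vector in a Hilbert space $\mathcal{H}$, $(P_{x,a})_{a\in A}$, $(Q_{y,b})_{b\in B}$ PVMs on $\mathcal{H}$ for all $x,y$, with $P_{x,a}Q_{y,b}=Q_{y,b}P_{x,a}$ for all $x,y,a,b$. For ${\rm x}\in\{{\rm ns},{\rm qc}\}$, $\mathcal{C}_{\rm x}(\lambda)=\{p\in\mathcal{C}_{\rm x}:\lambda(x,y,a,b)=0\Rightarrow p(a,b|x,y)=0\}$. *)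

theory Defs
  imports
    Complex_Main
    "HOL-Library.FuncSet"
    "HOL-Library.Equipollence"
    "HOL-Library.Nonpos_Ints"
    "HOL-Algebra.Module"
begin

text \<open>
  Hilbert spaces are structures on a subset of a type \<open>'h\<close>, so that one can quantify over them
  inside a formula. The type \<open>'h\<close> is the universe of vectors. It is an arbitrary type, of which
  only a cardinality of at least \<open>2\<^bsup>\<aleph>\<^sub>0\<^esup>\<close> is required. A smaller universe would contain too few Hilbert
  spaces; in one of this size every separable Hilbert space has an isomorphic copy, and neither
  the correlations nor the C*-algebras below change if it is enlarged, because every cyclic
  representation of a separable C*-algebra lives on a separable space.
\<close>

definition complex_field :: "complex ring" where
  "complex_field = \<lparr>carrier = UNIV, mult = (*), one = 1, zero = 0, add = (+)\<rparr>"

section \<open>Hilbert spaces\<close>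

text \<open>
  The library's record for modules also has a multiplication and a unit;
  they are not used for Hilbert spaces.
\<close>

record 'h hilbert = "(complex, 'h) module" +
  hinner :: "'h \<Rightarrow> 'h \<Rightarrow> complex"

definition hnorm :: "'h hilbert \<Rightarrow> 'h \<Rightarrow> real" where
  "hnorm H v = sqrt (Re (hinner H v v))"

text \<open>The inner product is linear in its second argument.\<close>

locale hilbert_space = Module.module complex_field H for H :: "'h hilbert" (structure) +
  assumes hinner_add: "\<lbrakk>u \<in> carrier H; v \<in> carrier H; w \<in> carrier H\<rbrakk> \<Longrightarrow>
      hinner H u (v \<oplus> w) = hinner H u v + hinner H u w"
    and hinner_smult: "\<lbrakk>u \<in> carrier H; v \<in> carrier H\<rbrakk> \<Longrightarrow>
      hinner H u (c \<odot> v) = c * hinner H u v"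
    and hinner_cnj: "\<lbrakk>u \<in> carrier H; v \<in> carrier H\<rbrakk> \<Longrightarrow> hinner H v u = cnj (hinner H u v)"
    and hinner_pos: "\<lbrakk>v \<in> carrier H; v \<noteq> \<zero>\<rbrakk> \<Longrightarrow> 0 < Re (hinner H v v)"
    and complete: "\<lbrakk>\<forall>n. s n \<in> carrier H;
        \<forall>\<epsilon>>0. \<exists>N. \<forall>m\<ge>N. \<forall>n\<ge>N. hnorm H (s m \<ominus> s n) < \<epsilon>\<rbrakk> \<Longrightarrow>
      \<exists>l\<in>carrier H. (\<lambda>n::nat. hnorm H (s n \<ominus> l)) \<longlonglongrightarrow> 0"

section \<open>C*-algebras\<close>

record 'c star_alg = "(complex, 'c) module" +
  alg_star :: "'c \<Rightarrow> 'c"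
  alg_norm :: "'c \<Rightarrow> real"

text \<open>Operators are functions that take the value \<open>undefined\<close> outside the carrier.\<close>

definition bounded_op :: "'h hilbert \<Rightarrow> ('h \<Rightarrow> 'h) \<Rightarrow> bool" where
  "bounded_op H T \<longleftrightarrow>
     T \<in> carrier H \<rightarrow>\<^sub>E carrier H \<and>
     (\<forall>u\<in>carrier H. \<forall>v\<in>carrier H. T (u \<oplus>\<^bsub>H\<^esub> v) = T u \<oplus>\<^bsub>H\<^esub> T v) \<and>
     (\<forall>c. \<forall>v\<in>carrier H. T (c \<odot>\<^bsub>H\<^esub> v) = c \<odot>\<^bsub>H\<^esub> T v) \<and>
     (\<exists>K. \<forall>v\<in>carrier H. hnorm H (T v) \<le> K * hnorm H v)"

definition op_alg :: "'h hilbert \<Rightarrow> ('h \<Rightarrow> 'h) star_alg" where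
  "op_alg H = \<lparr>
     carrier = {T. bounded_op H T},
     mult = (\<lambda>S T. \<lambda>v\<in>carrier H. S (T v)),
     one = (\<lambda>v\<in>carrier H. v),
     zero = (\<lambda>v\<in>carrier H. \<zero>\<^bsub>H\<^esub>),
     add = (\<lambda>S T. \<lambda>v\<in>carrier H. S v \<oplus>\<^bsub>H\<^esub> T v),
     smult = (\<lambda>c T. \<lambda>v\<in>carrier H. c \<odot>\<^bsub>H\<^esub> T v),
     alg_star = (\<lambda>T. THE S. bounded_op H S \<and>
       (\<forall>u\<in>carrier H. \<forall>v\<in>carrier H. hinner H (S u) v = hinner H u (T v))),
     alg_norm = (\<lambda>T. SUP v\<in>{v \<in> carrier H. hnorm H v \<le> 1}. hnorm H (T v))\<rparr>"

text \<open>\<open>\<ell>\<^sup>\<infinity>(A)\<close> for a finite set \<open>A\<close>.\<close>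

definition linf :: "('a::finite \<Rightarrow> complex) star_alg" where
  "linf = \<lparr>
     carrier = UNIV,
     mult = (\<lambda>f g a. f a * g a),
     one = (\<lambda>a. 1),
     zero = (\<lambda>a. 0),
     add = (\<lambda>f g a. f a + g a),
     smult = (\<lambda>c f a. c * f a),
     alg_star = (\<lambda>f a. cnj (f a)),
     alg_norm = (\<lambda>f. SUP a. cmod (f a))\<rparr>"

definition prod_alg :: "'i set \<Rightarrow> ('i \<Rightarrow> 'c star_alg) \<Rightarrow> ('i \<Rightarrow> 'c) star_alg" where
  "prod_alg I M = \<lparr>
     carrier = {F \<in> (\<Pi>\<^sub>E i\<in>I. carrier (M i)). bdd_above ((\<lambda>i. alg_norm (M i) (F i)) ` I)},
     mult = (\<lambda>F G. \<lambda>i\<in>I. F i \<otimes>\<^bsub>M i\<^esub> G i),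
     one = (\<lambda>i\<in>I. \<one>\<^bsub>M i\<^esub>),
     zero = (\<lambda>i\<in>I. \<zero>\<^bsub>M i\<^esub>),
     add = (\<lambda>F G. \<lambda>i\<in>I. F i \<oplus>\<^bsub>M i\<^esub> G i),
     smult = (\<lambda>c F. \<lambda>i\<in>I. c \<odot>\<^bsub>M i\<^esub> F i),
     alg_star = (\<lambda>F. \<lambda>i\<in>I. alg_star (M i) (F i)),
     alg_norm = (\<lambda>F. Sup (insert 0 ((\<lambda>i. alg_norm (M i) (F i)) ` I)))\<rparr>"

definition closed_star_subalg :: "'c star_alg \<Rightarrow> 'c set \<Rightarrow> bool" where
  "closed_star_subalg M B \<longleftrightarrow>
     B \<subseteq> carrier M \<and> \<one>\<^bsub>M\<^esub> \<in> B \<and>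
     (\<forall>u\<in>B. \<forall>v\<in>B. u \<oplus>\<^bsub>M\<^esub> v \<in> B \<and> u \<otimes>\<^bsub>M\<^esub> v \<in> B) \<and>
     (\<forall>c. \<forall>u\<in>B. c \<odot>\<^bsub>M\<^esub> u \<in> B) \<and>
     (\<forall>u\<in>B. alg_star M u \<in> B) \<and>
     (\<forall>s. \<forall>l\<in>carrier M.
        (\<forall>n. s n \<in> B) \<and> (\<lambda>n::nat. alg_norm M (s n \<ominus>\<^bsub>M\<^esub> l)) \<longlonglongrightarrow> 0 \<longrightarrow> l \<in> B)"

definition generated_alg :: "'c star_alg \<Rightarrow> 'c set \<Rightarrow> 'c star_alg" where
  "generated_alg M S = M\<lparr>carrier := \<Inter>{B. closed_star_subalg M B \<and> S \<subseteq> B}\<rparr>"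

definition unital_star_hom :: "'c star_alg \<Rightarrow> 'd star_alg \<Rightarrow> ('c \<Rightarrow> 'd) \<Rightarrow> bool" where
  "unital_star_hom M N \<phi> \<longleftrightarrow>
     \<phi> \<in> carrier M \<rightarrow> carrier N \<and> \<phi> \<one>\<^bsub>M\<^esub> = \<one>\<^bsub>N\<^esub> \<and>
     (\<forall>u\<in>carrier M. \<forall>v\<in>carrier M.
        \<phi> (u \<oplus>\<^bsub>M\<^esub> v) = \<phi> u \<oplus>\<^bsub>N\<^esub> \<phi> v \<and> \<phi> (u \<otimes>\<^bsub>M\<^esub> v) = \<phi> u \<otimes>\<^bsub>N\<^esub> \<phi> v) \<and>
     (\<forall>c. \<forall>u\<in>carrier M. \<phi> (c \<odot>\<^bsub>M\<^esub> u) = c \<odot>\<^bsub>N\<^esub> \<phi> u) \<and>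
     (\<forall>u\<in>carrier M. \<phi> (alg_star M u) = alg_star N (\<phi> u))"

definition trace :: "'c star_alg \<Rightarrow> ('c \<Rightarrow> complex) \<Rightarrow> bool" where
  "trace M \<tau> \<longleftrightarrow>
     (\<forall>z\<in>carrier M. \<forall>w\<in>carrier M. \<tau> (z \<oplus>\<^bsub>M\<^esub> w) = \<tau> z + \<tau> w) \<and>
     (\<forall>c. \<forall>z\<in>carrier M. \<tau> (c \<odot>\<^bsub>M\<^esub> z) = c * \<tau> z) \<and>
     (\<forall>z\<in>carrier M. \<tau> (alg_star M z \<otimes>\<^bsub>M\<^esub> z) \<in> \<real>\<^sub>\<ge>\<^sub>0) \<and>
     (\<forall>z\<in>carrier M. \<forall>w\<in>carrier M. \<tau> (z \<otimes>\<^bsub>M\<^esub> w) = \<tau> (w \<otimes>\<^bsub>M\<^esub> z))"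

definition linear_span :: "'c star_alg \<Rightarrow> 'c set \<Rightarrow> 'c set" where
  "linear_span M S = {\<Oplus>\<^bsub>M\<^esub>s\<in>F. c s \<odot>\<^bsub>M\<^esub> s | F c. finite F \<and> F \<subseteq> S}"

section \<open>Free products amalgamated over the unit\<close>

text \<open>
  The unital free product of a family \<open>M\<close> is the completion of its algebraic unital free product
  in the largest C*-norm, i.e. in the supremum of \<open>\<parallel>\<pi>(\<cdot>)\<parallel>\<close> over all unital representations \<open>\<pi>\<close>.
  Such a \<open>\<pi>\<close> on a Hilbert space \<open>H\<close> is the same as a family of unital *-homomorphisms
  \<open>\<pi> x : M x \<rightarrow> B(H)\<close>; hence the free product is the C*-algebra generated by the copies of the
  \<open>M x\<close> in the product of the algebras \<open>B(H)\<close> over all pairs \<open>(H, \<pi>)\<close>.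
\<close>

definition representations ::
    "('x \<Rightarrow> 'c star_alg) \<Rightarrow> ('h hilbert \<times> ('x \<Rightarrow> 'c \<Rightarrow> 'h \<Rightarrow> 'h)) set" where
  "representations M =
     {(H, \<pi>). hilbert_space H \<and> (\<forall>x. unital_star_hom (M x) (op_alg H) (\<pi> x))}"

type_synonym ('x, 'c, 'h) free_elem = "'h hilbert \<times> ('x \<Rightarrow> 'c \<Rightarrow> 'h \<Rightarrow> 'h) \<Rightarrow> 'h \<Rightarrow> 'h"

definition free_incl :: "('x \<Rightarrow> 'c star_alg) \<Rightarrow> 'x \<Rightarrow> 'c \<Rightarrow> ('x, 'c, 'h) free_elem" where
  "free_incl M x z = (\<lambda>(H, \<pi>)\<in>representations M. \<pi> x z)"

definition free_product :: "('x \<Rightarrow> 'c star_alg) \<Rightarrow> ('x, 'c, 'h) free_elem star_alg" where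
  "free_product M =
     generated_alg (prod_alg (representations M) (\<lambda>(H, \<pi>). op_alg H))
       (\<Union>x. free_incl M x ` carrier (M x))"

type_synonym ('x, 'a, 'h) game_elem = "('x, 'a \<Rightarrow> complex, 'h) free_elem"

text \<open>\<open>\<A>(X,A)\<close>, its canonical generators \<open>e\<^bsub>x,a\<^esub>\<close>, and \<open>\<S>\<^bsub>X,A\<^esub>\<close>; the finite non-empty
  sets \<open>X\<close> and \<open>A\<close> are types.\<close>

definition game_alg :: "('x::finite, 'a::finite, 'h) game_elem star_alg" where
  "game_alg = free_product (\<lambda>_. linf)"

definition gen :: "'x::finite \<Rightarrow> 'a::finite \<Rightarrow> ('x, 'a, 'h) game_elem" where
  "gen x a = free_incl (\<lambda>_. linf) x (\<lambda>a'. if a' = a then 1 else 0)"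

definition gen_span :: "('x::finite, 'a::finite, 'h) game_elem set" where
  "gen_span = linear_span game_alg {gen x a | x a. True}"

section \<open>Correlations and games\<close>

text \<open>A correlation \<open>p(a,b|x,y)\<close> is written \<open>p a b x y\<close>.\<close>

type_synonym ('x, 'y, 'a, 'b) correlation = "'a \<Rightarrow> 'b \<Rightarrow> 'x \<Rightarrow> 'y \<Rightarrow> real"

definition C_ns :: "('x::finite, 'y::finite, 'a::finite, 'b::finite) correlation set" where
  "C_ns = {p.
     (\<forall>a b x y. 0 \<le> p a b x y) \<and>
     (\<forall>x y. (\<Sum>a\<in>UNIV. \<Sum>b\<in>UNIV. p a b x y) = 1) \<and>
     (\<forall>x y y' a. (\<Sum>b\<in>UNIV. p a b x y) = (\<Sum>b\<in>UNIV. p a b x y')) \<and>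
     (\<forall>x x' y b. (\<Sum>a\<in>UNIV. p a b x y) = (\<Sum>a\<in>UNIV. p a b x' y))}"

definition pvm :: "'h hilbert \<Rightarrow> ('a::finite \<Rightarrow> 'h \<Rightarrow> 'h) \<Rightarrow> bool" where
  "pvm H P \<longleftrightarrow>
     (\<forall>a. P a \<in> carrier (op_alg H) \<and> P a \<otimes>\<^bsub>op_alg H\<^esub> P a = P a \<and> alg_star (op_alg H) (P a) = P a) \<and>
     (\<Oplus>\<^bsub>op_alg H\<^esub>a\<in>UNIV. P a) = \<one>\<^bsub>op_alg H\<^esub>"

text \<open>The argument \<open>'h itself\<close> selects the universe from which the vectors are taken.\<close>

definition C_qc ::
    "'h itself \<Rightarrow> ('x::finite, 'y::finite, 'a::finite, 'b::finite) correlation set" where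
  "C_qc _ = {p. \<exists>(H :: 'h hilbert) \<zeta> P Q.
     hilbert_space H \<and> \<zeta> \<in> carrier H \<and> hnorm H \<zeta> = 1 \<and>
     (\<forall>x. pvm H (P x)) \<and> (\<forall>y. pvm H (Q y)) \<and>
     (\<forall>x y a b. P x a \<otimes>\<^bsub>op_alg H\<^esub> Q y b = Q y b \<otimes>\<^bsub>op_alg H\<^esub> P x a) \<and>
     (\<forall>x y a b. complex_of_real (p a b x y) = hinner H \<zeta> ((P x a \<otimes>\<^bsub>op_alg H\<^esub> Q y b) \<zeta>))}"

type_synonym ('x, 'y, 'a, 'b) rule = "'x \<times> 'y \<times> 'a \<times> 'b \<Rightarrow> nat"

definition game :: "('x::finite, 'y::finite, 'a::finite, 'b::finite) rule \<Rightarrow> bool" where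
  "game lam \<longleftrightarrow> range lam \<subseteq> {0, 1}"

definition mirror_game :: "('x::finite, 'y::finite, 'a::finite, 'b::finite) rule \<Rightarrow> bool" where
  "mirror_game lam \<longleftrightarrow> game lam \<and> (\<exists>(\<xi> :: 'x \<Rightarrow> 'y) (\<eta> :: 'y \<Rightarrow> 'x).
     (\<forall>x b a a'. a \<noteq> a' \<longrightarrow> lam (x, \<xi> x, a, b) * lam (x, \<xi> x, a', b) = 0) \<and>
     (\<forall>y a b b'. b \<noteq> b' \<longrightarrow> lam (\<eta> y, y, a, b) * lam (\<eta> y, y, a, b') = 0))"

definition perfect ::
    "('x, 'y, 'a, 'b) rule \<Rightarrow> ('x, 'y, 'a, 'b) correlation set \<Rightarrow> ('x, 'y, 'a, 'b) correlation set" where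
  "perfect lam C = {p \<in> C. \<forall>x y a b. lam (x, y, a, b) = 0 \<longrightarrow> p a b x y = 0}"

end

theory Submission
  imports Defs "HOL-Analysis.Elementary_Normed_Spaces"
begin

text \<open>
  Suppose first that \<open>p(a,b|x,y) = \<langle>\<zeta>, P\<^bsub>x,a\<^esub> Q\<^bsub>y,b\<^esub> \<zeta>\<rangle>\<close> is a perfect quantum commuting strategy of the
  mirror game. Since \<open>\<parallel>P\<^bsub>x,a\<^esub> Q\<^bsub>y,b\<^esub> \<zeta>\<parallel>\<^sup>2 = p(a,b|x,y)\<close>, the vectors \<open>P\<^bsub>x,a\<^esub> Q\<^bsub>y,b\<^esub> \<zeta>\<close> of losing answers vanish.
  For the question pair \<open>(\<eta>(y),y)\<close> at most one \<open>b\<close> wins against a given \<open>a\<close>, so with a function \<open>g\<^sub>y\<close>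
  that picks this \<open>b\<close> one gets \<open>Q\<^bsub>y,b\<^esub> \<zeta> = \<Sum> P\<^bsub>\<eta>(y),a\<^esub> \<zeta>\<close>, summed over all \<open>a\<close> with \<open>g\<^sub>y(a) = b\<close>
  (\<open>mirror_vector\<close>). The map \<open>\<xi>\<close> gives in the same way \<open>P\<^bsub>x,a\<^esub> \<zeta>\<close> as a sum of vectors \<open>Q\<^bsub>\<xi>(x),b\<^esub> \<zeta>\<close>.
  Now let \<open>\<tau>(z) = \<langle>\<zeta>, \<pi>(z) \<zeta>\<rangle>\<close>, where \<open>\<pi>\<close> is the representation of \<open>\<A>(X,A)\<close> with
  \<open>\<pi>(e\<^bsub>x,a\<^esub>) = P\<^bsub>x,a\<^esub>\<close>. A factor \<open>P\<^bsub>x,a\<^esub>\<close> next to \<open>\<zeta>\<close> can be exchanged for a sum of operators \<open>Q\<close>, these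
  commute with \<open>\<pi>(z)\<close> and can be moved to the other side of it, and there they are turned back into
  \<open>P\<^bsub>x,a\<^esub>\<close>. Hence \<open>\<tau>\<close> is a trace (\<open>projection_in_tracial_part\<close>, \<open>closed_star_subalg_tracial_part\<close>).
  The homomorphism \<open>\<rho>\<close> sends \<open>f\<^bsub>y,b\<^esub>\<close> to the sum of \<open>e\<^bsub>\<eta>(y),a\<^esub>\<close> over \<open>g\<^sub>y(a) = b\<close>; it comes from the
  homomorphisms \<open>f \<mapsto> f \<circ> g\<^sub>y\<close> from \<open>\<ell>\<^sup>\<infinity>(B)\<close> to \<open>\<ell>\<^sup>\<infinity>(A)\<close> (\<open>pull_hom\<close>).

  For the converse, the construction of Gelfand, Naimark and Segal for \<open>\<tau>\<close> has two commuting actions,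
  left multiplication by \<open>e\<^bsub>x,a\<^esub>\<close> and right multiplication by \<open>\<rho>(f\<^bsub>y,b\<^esub>)\<close>; right multiplication by a
  self-adjoint element is symmetric for the form \<open>\<tau>(u\<^sup>* v)\<close> because \<open>\<tau>\<close> is a trace. The vector of the
  unit then gives the correlation \<open>p\<close>. The construction is carried out on the linear span of the
  words in the generators instead of all of \<open>\<A>(X,A)\<close>: \<open>\<rho>(f\<^bsub>y,b\<^esub>)\<close> lies in the span of the
  generators, so both actions preserve this subspace, and its completion is separable. Hence it has
  at most \<open>2\<^bsup>\<aleph>\<^sub>0\<^esup>\<close> elements and can be moved into the given universe of vectors
  (\<open>correlation_of_trace\<close>, \<open>C_qc_change_universe\<close>).

  The involution on operators is a definite description, so every statement about it rests on the
  existence of adjoints, which is derived from the Riesz representation theorem.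
\<close>

section \<open>Semi-inner products and Hilbert spaces\<close>

lemma complex_field_simps [simp]:
  "carrier complex_field = UNIV" "mult complex_field = (*)" "one complex_field = 1"
  "zero complex_field = 0" "add complex_field = (+)"
  by (simp_all add: complex_field_def)

lemma cring_complex_field: "cring complex_field"
proof (rule cringI)
  show "abelian_group complex_field"
    by (rule abelian_groupI) (auto simp: add.assoc intro: exI[of _ "- x" for x] add.commute)
  show "Group.comm_monoid complex_field"
    by (rule comm_monoidI) auto
qed (simp_all add: algebra_simps)

text \<open>
  The form is only semidefinite, because \<open>\<tau>(u\<^sup>* v)\<close> is degenerate in general; Hilbert spaces are the
  complete and definite case.
\<close>

locale semi_inner_space = Module.module complex_field V
  for V :: "(complex, 'v, 'm) module_scheme" (structure) +
  fixes s :: "'v \<Rightarrow> 'v \<Rightarrow> complex"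
  assumes form_add: "\<lbrakk>u \<in> carrier V; v \<in> carrier V; w \<in> carrier V\<rbrakk> \<Longrightarrow>
      s u (v \<oplus> w) = s u v + s u w"
    and form_smult: "\<lbrakk>u \<in> carrier V; v \<in> carrier V\<rbrakk> \<Longrightarrow> s u (c \<odot> v) = c * s u v"
    and form_cnj: "\<lbrakk>u \<in> carrier V; v \<in> carrier V\<rbrakk> \<Longrightarrow> s v u = cnj (s u v)"
    and form_pos: "v \<in> carrier V \<Longrightarrow> 0 \<le> Re (s v v)"
begin

definition snorm :: "'v \<Rightarrow> real" where "snorm v = sqrt (Re (s v v))"

lemma scale_closed [simp]: "v \<in> carrier V \<Longrightarrow> c \<odot> v \<in> carrier V"
  by (rule smult_closed) simp_all

lemma scale_one [simp]: "v \<in> carrier V \<Longrightarrow> 1 \<odot> v = v"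
  using smult_one[of v] by simp

lemma scale_scale: "v \<in> carrier V \<Longrightarrow> c \<odot> (d \<odot> v) = (c * d) \<odot> v"
  using smult_assoc1[of c d v] by simp

lemma scale_add_left: "v \<in> carrier V \<Longrightarrow> (c + d) \<odot> v = c \<odot> v \<oplus> d \<odot> v"
  using smult_l_distr[of c d v] by simp

lemma scale_add_right: "\<lbrakk>u \<in> carrier V; v \<in> carrier V\<rbrakk> \<Longrightarrow> c \<odot> (u \<oplus> v) = c \<odot> u \<oplus> c \<odot> v"
  using smult_r_distr[of c u v] by simp

lemma scale_minus_one: assumes "v \<in> carrier V" shows "(-1) \<odot> v = \<ominus> v"
proof -
  have "(-1) \<odot> v \<oplus> v = \<zero>"
    using smult_l_distr[of "-1" 1 v] smult_l_null[of v] assms by simp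
  then show ?thesis using assms by (intro M.minus_equality[symmetric]) simp_all
qed

lemma form_add_left: "\<lbrakk>u \<in> carrier V; v \<in> carrier V; w \<in> carrier V\<rbrakk> \<Longrightarrow>
    s (u \<oplus> v) w = s u w + s v w"
  using form_cnj[of w "u \<oplus> v"] form_cnj[of w u] form_cnj[of w v] by (simp add: form_add)

lemma form_smult_left: "\<lbrakk>u \<in> carrier V; v \<in> carrier V\<rbrakk> \<Longrightarrow> s (c \<odot> u) v = cnj c * s u v"
  using form_cnj[of v "c \<odot> u"] form_cnj[of v u] by (simp add: form_smult)

lemma form_uminus: "\<lbrakk>u \<in> carrier V; v \<in> carrier V\<rbrakk> \<Longrightarrow> s u (\<ominus> v) = - s u v"
  using form_smult[of u v "-1"] by (simp add: scale_minus_one)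

lemma form_uminus_left: "\<lbrakk>u \<in> carrier V; v \<in> carrier V\<rbrakk> \<Longrightarrow> s (\<ominus> u) v = - s u v"
  using form_smult_left[of u v "-1"] by (simp add: scale_minus_one)

lemma form_diff: "\<lbrakk>u \<in> carrier V; v \<in> carrier V; w \<in> carrier V\<rbrakk> \<Longrightarrow>
    s u (v \<ominus> w) = s u v - s u w"
  by (simp add: M.minus_eq form_add form_uminus)

lemma form_diff_left: "\<lbrakk>u \<in> carrier V; v \<in> carrier V; w \<in> carrier V\<rbrakk> \<Longrightarrow>
    s (u \<ominus> v) w = s u w - s v w"
  by (simp add: M.minus_eq form_add_left form_uminus_left)

lemma form_zero: "u \<in> carrier V \<Longrightarrow> s u \<zero> = 0"
  using form_smult[of u \<zero> 0] smult_l_null[of \<zero>] by simp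

lemma form_zero_left: "u \<in> carrier V \<Longrightarrow> s \<zero> u = 0"
  using form_cnj[of u \<zero>] by (simp add: form_zero)

lemmas form_simps = form_add form_add_left form_smult form_smult_left form_uminus form_uminus_left
  form_diff form_diff_left form_zero form_zero_left

lemma form_self: assumes "v \<in> carrier V" shows "s v v = of_real ((snorm v)\<^sup>2)"
proof -
  have "Im (s v v) = 0"
    using arg_cong[OF form_cnj[OF assms assms], of Im] by simp
  then show ?thesis using form_pos[OF assms] by (simp add: complex_eq_iff snorm_def)
qed

lemma snorm_nonneg [simp]: "v \<in> carrier V \<Longrightarrow> 0 \<le> snorm v"
  by (simp add: form_pos snorm_def)

lemma snorm_sq: "v \<in> carrier V \<Longrightarrow> (snorm v)\<^sup>2 = Re (s v v)"
  by (simp add: form_pos snorm_def)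

text \<open>
  The form of \<open>u - t s(v,u) v\<close> with itself is a nonnegative quadratic polynomial in the real number
  \<open>t\<close>. For \<open>\<parallel>v\<parallel> \<noteq> 0\<close> its value at \<open>t = 1/\<parallel>v\<parallel>\<^sup>2\<close> is the inequality; for \<open>\<parallel>v\<parallel> = 0\<close> it is affine in \<open>t\<close>, so
  its slope has to vanish.
\<close>

lemma cauchy_schwarz:
  assumes u: "u \<in> carrier V" and v: "v \<in> carrier V"
  shows "cmod (s u v) \<le> snorm u * snorm v"
proof -
  define b where "b = (cmod (s u v))\<^sup>2"
  have sb: "s u v * s v u = of_real b"
    using form_cnj[OF u v] unfolding b_def by (simp add: complex_norm_square flip: of_real_power)
  have Q: "0 \<le> (snorm u)\<^sup>2 - 2 * t * b + t\<^sup>2 * b * (snorm v)\<^sup>2" for t :: real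
  proof -
    define c where "c = of_real t * s v u"
    have cn: "cnj (s v u) = s u v" using form_cnj[OF v u] by simp
    have "s (u \<ominus> c \<odot> v) (u \<ominus> c \<odot> v)
        = s u u - c * s u v - cnj c * s v u + cnj c * c * s v v"
      using u v by (simp add: form_simps algebra_simps)
    also have "\<dots> = s u u - 2 * of_real t * (s u v * s v u)
        + of_real t ^ 2 * (s u v * s v u) * s v v"
      unfolding c_def by (simp add: cn algebra_simps power2_eq_square)
    also have "\<dots> = of_real ((snorm u)\<^sup>2 - 2 * t * b + t\<^sup>2 * b * (snorm v)\<^sup>2)"
      by (subst (1) form_self[OF u], subst (1) form_self[OF v]) (simp add: sb)
    finally have "s (u \<ominus> c \<odot> v) (u \<ominus> c \<odot> v)
        = of_real ((snorm u)\<^sup>2 - 2 * t * b + t\<^sup>2 * b * (snorm v)\<^sup>2)" .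
    moreover have "u \<ominus> c \<odot> v \<in> carrier V" using u v by simp
    ultimately show ?thesis using form_pos[of "u \<ominus> c \<odot> v"] by (simp only: Re_complex_of_real)
  qed
  have "b \<le> (snorm u * snorm v)\<^sup>2"
  proof (cases "snorm v = 0")
    case True
    have "b = 0"
    proof (rule ccontr)
      assume "b \<noteq> 0"
      then have "b > 0" by (simp add: b_def)
      then show False using Q[of "((snorm u)\<^sup>2 + 1) / (2 * b)"] True by (simp add: field_simps)
    qed
    then show ?thesis by simp
  next
    case False
    define q where "q = (snorm v)\<^sup>2"
    have q: "q > 0" using False by (simp add: q_def zero_less_power2)
    have "0 \<le> (snorm u)\<^sup>2 - 2 * (1/q) * b + (1/q)\<^sup>2 * b * q" using Q[of "1/q"] by (simp add: q_def)
    also have "\<dots> = (snorm u)\<^sup>2 - b / q" using q by (simp add: field_simps power2_eq_square)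
    finally show ?thesis using q by (simp add: field_simps power_mult_distrib flip: q_def)
  qed
  then show ?thesis unfolding b_def
    using snorm_nonneg[OF u] snorm_nonneg[OF v] by (rule power2_le_imp_le[OF _ mult_nonneg_nonneg])
qed

text \<open>
  Since \<open>\<parallel>A u\<parallel>\<^sup>2 = s(A u, u)\<close>, the Cauchy-Schwarz inequality cancels one factor \<open>\<parallel>A u\<parallel>\<close>. Projections
  on Hilbert spaces are therefore bounded by one, and multiplication by a projection extends to the
  completion of a space with a trace.
\<close>

lemma symmetric_idempotent_contractive:
  assumes A: "\<And>u. u \<in> carrier V \<Longrightarrow> A u \<in> carrier V"
    and sym: "\<And>u v. \<lbrakk>u \<in> carrier V; v \<in> carrier V\<rbrakk> \<Longrightarrow> s (A u) v = s u (A v)"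
    and idem: "\<And>u. u \<in> carrier V \<Longrightarrow> A (A u) = A u"
    and u: "u \<in> carrier V"
  shows "snorm (A u) \<le> snorm u"
proof -
  have "s (A u) (A u) = s (A u) u" using sym[OF A[OF u] u] idem[OF u] by simp
  then have "(snorm (A u))\<^sup>2 \<le> snorm (A u) * snorm u"
    using cauchy_schwarz[OF A[OF u] u] complex_Re_le_cmod[of "s (A u) u"] snorm_sq[OF A[OF u]] by simp
  then show ?thesis
    using snorm_nonneg[OF A[OF u]] snorm_nonneg[OF u]
    by (cases "snorm (A u) = 0") (auto simp: power2_eq_square)
qed

lemma snorm_triangle:
  assumes u: "u \<in> carrier V" and v: "v \<in> carrier V"
  shows "snorm (u \<oplus> v) \<le> snorm u + snorm v"
proof -
  have "Re (s (u \<oplus> v) (u \<oplus> v)) = (snorm u)\<^sup>2 + Re (s u v) + Re (s v u) + (snorm v)\<^sup>2"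
    using u v by (simp add: form_simps snorm_sq)
  also have "Re (s v u) = Re (s u v)" using form_cnj[OF u v] by simp
  also have "(snorm u)\<^sup>2 + Re (s u v) + Re (s u v) + (snorm v)\<^sup>2 \<le> (snorm u + snorm v)\<^sup>2"
    using cauchy_schwarz[OF u v] complex_Re_le_cmod[of "s u v"]
    by (simp add: power2_sum)
  finally show ?thesis unfolding snorm_def[of "u \<oplus> v"]
    by (rule real_le_lsqrt[OF add_nonneg_nonneg[OF snorm_nonneg[OF u] snorm_nonneg[OF v]]])
qed

lemma snorm_scale: "v \<in> carrier V \<Longrightarrow> snorm (c \<odot> v) = cmod c * snorm v"
proof -
  assume v: "v \<in> carrier V"
  have "s (c \<odot> v) (c \<odot> v) = of_real ((cmod c)\<^sup>2) * s v v"
    using v unfolding complex_norm_square by (simp add: form_simps)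
  then show ?thesis by (simp add: snorm_def real_sqrt_mult)
qed

lemma snorm_zero [simp]: "snorm \<zero> = 0"
  by (simp add: snorm_def form_zero)

lemma snorm_minus: "v \<in> carrier V \<Longrightarrow> snorm (\<ominus> v) = snorm v"
  by (simp add: snorm_def form_simps)

lemma snorm_diff_commute: "\<lbrakk>u \<in> carrier V; v \<in> carrier V\<rbrakk> \<Longrightarrow> snorm (u \<ominus> v) = snorm (v \<ominus> u)"
  by (simp add: snorm_def form_simps algebra_simps)

lemma snorm_triangle_ineq2: "\<lbrakk>u \<in> carrier V; v \<in> carrier V\<rbrakk> \<Longrightarrow> snorm u - snorm v \<le> snorm (u \<ominus> v)"
  using snorm_triangle[of "u \<ominus> v" v] by (simp add: M.minus_eq M.a_assoc M.l_neg)

end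

sublocale hilbert_space \<subseteq> semi_inner_space H "hinner H"
proof
  fix v assume "v \<in> carrier H"
  show "0 \<le> Re (hinner H v v)"
  proof (cases "v = \<zero>")
    case True
    have "hinner H \<zero> \<zero> = 0"
      using hinner_smult[of \<zero> \<zero> 0] smult_l_null[of \<zero>] by simp
    then show ?thesis using True by simp
  next
    case False
    then show ?thesis using hinner_pos \<open>v \<in> carrier H\<close> by (simp add: less_imp_le)
  qed
qed (auto intro: hinner_add hinner_smult hinner_cnj)

context hilbert_space
begin

lemma hnorm_eq [simp]: "hnorm H v = snorm v"
  by (simp add: hnorm_def snorm_def)

lemma snorm_eq_0D: "\<lbrakk>v \<in> carrier H; snorm v = 0\<rbrakk> \<Longrightarrow> v = \<zero>"
  using hinner_pos[of v] by (auto simp: snorm_def)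

lemma diff_eq_zeroD: "\<lbrakk>u \<in> carrier H; v \<in> carrier H; u \<ominus> v = \<zero>\<rbrakk> \<Longrightarrow> u = v"
  by (metis M.minus_closed M.minus_eq M.minus_minus M.a_inv_closed M.minus_equality)

text \<open>
  Identities between vectors are proved by testing against all vectors, which turns them into
  identities between complex numbers.
\<close>

lemma hinner_eqI:
  assumes "u \<in> carrier H" "v \<in> carrier H" "\<And>w. w \<in> carrier H \<Longrightarrow> hinner H w u = hinner H w v"
  shows "u = v"
proof -
  have "hinner H (u \<ominus> v) (u \<ominus> v) = 0" using assms by (simp add: form_simps)
  then have "u \<ominus> v = \<zero>" using assms(1,2) by (intro snorm_eq_0D) (auto simp: snorm_def)
  then show ?thesis using assms(1,2) by (rule diff_eq_zeroD[rotated 2])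
qed

lemma hinner_eqI_left:
  assumes "u \<in> carrier H" "v \<in> carrier H" "\<And>w. w \<in> carrier H \<Longrightarrow> hinner H u w = hinner H v w"
  shows "u = v"
  by (rule hinner_eqI[OF assms(1,2)]) (simp add: assms form_cnj[of u] form_cnj[of v])

lemma tendsto_hinner:
  assumes "\<And>n. f n \<in> carrier H" "l \<in> carrier H" "u \<in> carrier H"
    and "(\<lambda>n::nat. snorm (f n \<ominus> l)) \<longlonglongrightarrow> 0"
  shows "(\<lambda>n. hinner H u (f n)) \<longlonglongrightarrow> hinner H u l"
proof -
  have "(\<lambda>n. hinner H u (f n) - hinner H u l) \<longlonglongrightarrow> 0"
  proof (rule Lim_null_comparison)
    show "\<forall>\<^sub>F n in sequentially. norm (hinner H u (f n) - hinner H u l) \<le> snorm u * snorm (f n \<ominus> l)"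
      using cauchy_schwarz[of u "f n \<ominus> l" for n] assms
      by (intro always_eventually allI) (simp add: form_diff)
    show "(\<lambda>n. snorm u * snorm (f n \<ominus> l)) \<longlonglongrightarrow> 0"
      using tendsto_mult_right_zero[OF assms(4)] by simp
  qed
  then show ?thesis by (simp add: LIM_zero_iff)
qed

text \<open>
  The representing vector is the minimiser of \<open>J(v) = \<parallel>v\<parallel>\<^sup>2 - 2 Re \<phi>(v)\<close>. By the parallelogram law a
  minimising sequence is Cauchy, so a minimiser \<open>r\<close> exists by completeness; the derivative of \<open>J\<close> at
  \<open>r\<close> in the directions \<open>w\<close> and \<open>\<i> w\<close> vanishes, which says \<open>\<langle>r, w\<rangle> = \<phi>(w)\<close>.
\<close>

theorem riesz_representation:
  assumes add: "\<And>u v. \<lbrakk>u \<in> carrier H; v \<in> carrier H\<rbrakk> \<Longrightarrow> \<phi> (u \<oplus> v) = \<phi> u + \<phi> v"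
    and scale: "\<And>c v. v \<in> carrier H \<Longrightarrow> \<phi> (c \<odot> v) = c * \<phi> v"
    and bounded: "\<And>v. v \<in> carrier H \<Longrightarrow> cmod (\<phi> v) \<le> K * snorm v"
  obtains r where "r \<in> carrier H" "\<And>v. v \<in> carrier H \<Longrightarrow> hinner H r v = \<phi> v"
proof -
  define J where "J v = (snorm v)\<^sup>2 - 2 * Re (\<phi> v)" for v
  have neg: "\<phi> (\<ominus> v) = - \<phi> v" if "v \<in> carrier H" for v
    using scale[OF that, of "-1"] that by (simp add: scale_minus_one)
  have phi_diff: "\<phi> (u \<ominus> v) = \<phi> u - \<phi> v" if "u \<in> carrier H" "v \<in> carrier H" for u v
    using that by (simp add: M.minus_eq add neg)
  have J_ge: "- K\<^sup>2 \<le> J v" if "v \<in> carrier H" for v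
  proof -
    have "Re (\<phi> v) \<le> K * snorm v"
      using bounded[OF that] complex_Re_le_cmod order_trans by blast
    moreover have "0 \<le> (snorm v - K)\<^sup>2" by simp
    ultimately show ?thesis by (simp add: J_def power2_diff mult.commute)
  qed
  define m where "m = Inf (J ` carrier H)"
  have bdd: "bdd_below (J ` carrier H)" using J_ge by (auto intro!: bdd_belowI[where m = "- K\<^sup>2"])
  have m_le: "m \<le> J v" if "v \<in> carrier H" for v
    unfolding m_def using bdd that by (simp add: cInf_lower)
  have "\<exists>v\<in>carrier H. J v < m + e" if "e > 0" for e
  proof -
    have "J ` carrier H \<noteq> {}" using M.zero_closed by blast
    then show ?thesis
      using cInf_lessD[of "J ` carrier H" "m + e"] that unfolding m_def by auto
  qed
  then have "\<forall>n::nat. \<exists>v\<in>carrier H. J v < m + 1 / Suc n" by simp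
  then obtain f where f: "\<And>n. f n \<in> carrier H" and Jf: "\<And>n::nat. J (f n) < m + 1 / Suc n"
    by metis
  have par: "(snorm (u \<ominus> v))\<^sup>2 \<le> 2 * (J u - m) + 2 * (J v - m)"
    if "u \<in> carrier H" "v \<in> carrier H" for u v
  proof -
    define w where "w = (1/2) \<odot> (u \<oplus> v)"
    have w: "w \<in> carrier H" using that by (simp add: w_def)
    have "4 * (snorm w)\<^sup>2 + (snorm (u \<ominus> v))\<^sup>2 = 2 * (snorm u)\<^sup>2 + 2 * (snorm v)\<^sup>2"
      using that snorm_sq[OF w] snorm_sq[of "u \<ominus> v"] snorm_sq[of u] snorm_sq[of v]
      by (simp only: M.minus_closed) (simp add: w_def form_simps field_simps)
    moreover have "2 * Re (\<phi> w) = Re (\<phi> u) + Re (\<phi> v)"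
      unfolding w_def using that by (simp add: add scale)
    ultimately have "4 * J w + (snorm (u \<ominus> v))\<^sup>2 = 2 * J u + 2 * J v"
      unfolding J_def by simp
    then show ?thesis using m_le[OF w] by simp
  qed
  have cau: "\<forall>\<epsilon>>0. \<exists>N. \<forall>i\<ge>N. \<forall>j\<ge>N. hnorm H (f i \<ominus> f j) < \<epsilon>"
  proof (intro allI impI)
    fix \<epsilon> :: real assume e: "\<epsilon> > 0"
    obtain N :: nat where N: "1 / Suc N < \<epsilon>\<^sup>2 / 4"
      using e nat_approx_posE[of "\<epsilon>\<^sup>2 / 4"] by auto
    have "hnorm H (f i \<ominus> f j) < \<epsilon>" if "i \<ge> N" "j \<ge> N" for i j
    proof -
      have J_small: "J (f k) - m < \<epsilon>\<^sup>2 / 4" if "k \<ge> N" for k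
      proof -
        have "1 / real (Suc k) \<le> 1 / real (Suc N)" using that by (intro divide_left_mono) auto
        then show ?thesis using Jf[of k] N by simp
      qed
      have "(snorm (f i \<ominus> f j))\<^sup>2 < \<epsilon>\<^sup>2"
        using par[OF f f, of i j] J_small[OF that(1)] J_small[OF that(2)] by argo
      then show ?thesis using e power2_less_imp_less by fastforce
    qed
    then show "\<exists>N. \<forall>i\<ge>N. \<forall>j\<ge>N. hnorm H (f i \<ominus> f j) < \<epsilon>" by blast
  qed
  obtain r where r: "r \<in> carrier H" and lim: "(\<lambda>n. snorm (f n \<ominus> r)) \<longlonglongrightarrow> 0"
    using complete[of f] f cau by auto
  have lim_phi: "(\<lambda>n. \<phi> (f n)) \<longlonglongrightarrow> \<phi> r"
  proof -
    have "(\<lambda>n. \<phi> (f n) - \<phi> r) \<longlonglongrightarrow> 0"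
    proof (rule Lim_null_comparison)
      show "\<forall>\<^sub>F n in sequentially. norm (\<phi> (f n) - \<phi> r) \<le> K * snorm (f n \<ominus> r)"
        using bounded[of "f n \<ominus> r" for n] f r by (intro always_eventually allI) (simp add: phi_diff)
      show "(\<lambda>n. K * snorm (f n \<ominus> r)) \<longlonglongrightarrow> 0"
        using tendsto_mult_right_zero[OF lim] by simp
    qed
    then show ?thesis by (simp add: LIM_zero_iff)
  qed
  have lim_norm: "(\<lambda>n. snorm (f n)) \<longlonglongrightarrow> snorm r"
  proof -
    have "(\<lambda>n. snorm (f n) - snorm r) \<longlonglongrightarrow> 0"
    proof (rule Lim_null_comparison[OF _ lim])
      show "\<forall>\<^sub>F n in sequentially. norm (snorm (f n) - snorm r) \<le> snorm (f n \<ominus> r)"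
        using snorm_triangle_ineq2[OF f r] snorm_triangle_ineq2[OF r f] snorm_diff_commute[OF f r]
        by (intro always_eventually allI) (simp only: real_norm_def abs_le_iff, simp)
    qed
    then show ?thesis by (simp add: LIM_zero_iff)
  qed
  have Jr: "J r = m"
  proof -
    have "(\<lambda>n. J (f n)) \<longlonglongrightarrow> J r"
      unfolding J_def by (intro tendsto_intros lim_norm lim_phi)
    moreover have "(\<lambda>n. J (f n)) \<longlonglongrightarrow> m"
    proof (rule tendsto_sandwich[where f = "\<lambda>_. m" and h = "\<lambda>n. m + 1 / Suc n"])
      show "(\<lambda>n. m + 1 / real (Suc n)) \<longlonglongrightarrow> m"
        using tendsto_add[OF tendsto_const LIMSEQ_Suc[OF lim_1_over_n], of m] by simp
    qed (use m_le f Jf in \<open>auto intro!: always_eventually less_imp_le\<close>)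
    ultimately show ?thesis by (rule LIMSEQ_unique)
  qed
  have Re_eq: "Re (hinner H r w) = Re (\<phi> w)" if w: "w \<in> carrier H" for w
  proof -
    define d where "d = Re (hinner H r w) - Re (\<phi> w)"
    have quad: "0 \<le> 2 * t * d + t\<^sup>2 * (snorm w)\<^sup>2" for t :: real
    proof -
      have "J r \<le> J (r \<oplus> of_real t \<odot> w)" using Jr m_le r w by simp
      moreover have "J (r \<oplus> of_real t \<odot> w) = J r + 2 * t * d + t\<^sup>2 * (snorm w)\<^sup>2"
      proof -
        have "Re (hinner H w r) = Re (hinner H r w)" using form_cnj[OF r w] by simp
        then have "(snorm (r \<oplus> of_real t \<odot> w))\<^sup>2 = (snorm r)\<^sup>2 + 2 * t * Re (hinner H r w) + t\<^sup>2 * (snorm w)\<^sup>2"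
          using r w snorm_sq[of "r \<oplus> of_real t \<odot> w"] snorm_sq[of r] snorm_sq[of w]
          by (simp only: M.a_closed scale_closed) (simp add: form_simps power2_eq_square algebra_simps)
        then show ?thesis unfolding J_def d_def
          using r w by (simp add: add scale algebra_simps)
      qed
      ultimately show ?thesis by simp
    qed
    have "d = 0"
    proof (rule ccontr)
      assume d: "d \<noteq> 0"
      \<comment> \<open>Adding 1 keeps the denominator positive when \<open>w\<close> has norm zero.\<close>
      define q where "q = (snorm w)\<^sup>2 + 1"
      have q: "q > 0" by (simp add: q_def add_nonneg_pos)
      have "0 \<le> 2 * (- d / q) * d + (- d / q)\<^sup>2 * (snorm w)\<^sup>2" by (rule quad)
      also have "\<dots> \<le> 2 * (- d / q) * d + (- d / q)\<^sup>2 * q"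
        by (simp add: q_def mult_left_mono)
      also have "\<dots> = - (d\<^sup>2 / q)" using q by (simp add: field_simps power2_eq_square)
      also have "\<dots> < 0" using d q by simp
      finally show False by simp
    qed
    then show ?thesis by (simp add: d_def)
  qed
  have "hinner H r v = \<phi> v" if v: "v \<in> carrier H" for v
  proof (rule complex_eqI)
    show "Re (hinner H r v) = Re (\<phi> v)" by (rule Re_eq[OF v])
    show "Im (hinner H r v) = Im (\<phi> v)"
      using Re_eq[of "\<i> \<odot> v"] v r by (simp add: form_simps scale)
  qed
  with r show thesis by (rule that)
qed

end

section \<open>Normed *-algebras\<close>

text \<open>
  These axioms hold for the bounded operators on a Hilbert space and pass to bounded products over
  any index set and to closed *-subalgebras, hence to free products. The axiom on the norm of the
  unit makes the constant family of units a bounded one.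
\<close>

locale star_algebra = ring M for M :: "'c star_alg" (structure) +
  assumes scale_closed [simp]: "u \<in> carrier M \<Longrightarrow> c \<odot> u \<in> carrier M"
    and scale_add_left: "u \<in> carrier M \<Longrightarrow> (c + d) \<odot> u = c \<odot> u \<oplus> d \<odot> u"
    and scale_add_right: "\<lbrakk>u \<in> carrier M; v \<in> carrier M\<rbrakk> \<Longrightarrow> c \<odot> (u \<oplus> v) = c \<odot> u \<oplus> c \<odot> v"
    and scale_scale: "u \<in> carrier M \<Longrightarrow> c \<odot> (d \<odot> u) = (c * d) \<odot> u"
    and scale_one [simp]: "u \<in> carrier M \<Longrightarrow> 1 \<odot> u = u"
    and scale_mult_left: "\<lbrakk>u \<in> carrier M; v \<in> carrier M\<rbrakk> \<Longrightarrow> (c \<odot> u) \<otimes> v = c \<odot> (u \<otimes> v)"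
    and scale_mult_right: "\<lbrakk>u \<in> carrier M; v \<in> carrier M\<rbrakk> \<Longrightarrow> u \<otimes> (c \<odot> v) = c \<odot> (u \<otimes> v)"
    and star_closed [simp]: "u \<in> carrier M \<Longrightarrow> alg_star M u \<in> carrier M"
    and star_add: "\<lbrakk>u \<in> carrier M; v \<in> carrier M\<rbrakk> \<Longrightarrow>
      alg_star M (u \<oplus> v) = alg_star M u \<oplus> alg_star M v"
    and star_scale: "u \<in> carrier M \<Longrightarrow> alg_star M (c \<odot> u) = cnj c \<odot> alg_star M u"
    and star_mult: "\<lbrakk>u \<in> carrier M; v \<in> carrier M\<rbrakk> \<Longrightarrow>
      alg_star M (u \<otimes> v) = alg_star M v \<otimes> alg_star M u"
    and star_star [simp]: "u \<in> carrier M \<Longrightarrow> alg_star M (alg_star M u) = u"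
    and norm_nonneg [simp]: "u \<in> carrier M \<Longrightarrow> 0 \<le> alg_norm M u"
    and norm_add: "\<lbrakk>u \<in> carrier M; v \<in> carrier M\<rbrakk> \<Longrightarrow>
      alg_norm M (u \<oplus> v) \<le> alg_norm M u + alg_norm M v"
    and norm_scale: "u \<in> carrier M \<Longrightarrow> alg_norm M (c \<odot> u) \<le> cmod c * alg_norm M u"
    and norm_mult: "\<lbrakk>u \<in> carrier M; v \<in> carrier M\<rbrakk> \<Longrightarrow>
      alg_norm M (u \<otimes> v) \<le> alg_norm M u * alg_norm M v"
    and norm_star: "u \<in> carrier M \<Longrightarrow> alg_norm M (alg_star M u) \<le> alg_norm M u"
    and norm_one: "alg_norm M \<one> \<le> 1"
begin

lemma scale_zero: assumes "u \<in> carrier M" shows "0 \<odot> u = \<zero>"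
proof -
  have "0 \<odot> u \<oplus> 0 \<odot> u = 0 \<odot> u" using scale_add_left[OF assms, of 0 0] by simp
  then show ?thesis using assms by (metis add.l_cancel_one' scale_closed)
qed

lemma scale_minus_one: assumes "u \<in> carrier M" shows "(-1) \<odot> u = \<ominus> u"
  using scale_add_left[OF assms, of "-1" 1] scale_zero[OF assms] assms
  by (intro minus_equality[symmetric]) simp_all

lemma minus_eq_scale: "v \<in> carrier M \<Longrightarrow> u \<ominus> v = u \<oplus> (-1) \<odot> v"
  by (simp add: minus_eq scale_minus_one)

lemma star_one [simp]: "alg_star M \<one> = \<one>"
  by (metis one_closed r_one l_one star_closed star_mult star_star)

lemma module: "Module.module complex_field M"
  by (intro Module.moduleI cring_complex_field is_abelian_group)
     (simp_all add: scale_add_left scale_add_right scale_scale)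

lemma closed_star_subalg_carrier: "closed_star_subalg M (carrier M)"
  by (simp add: closed_star_subalg_def)

lemma closed_star_subalg_subspace:
  assumes "closed_star_subalg M B"
  shows "\<zero> \<in> B" "\<lbrakk>u \<in> B; v \<in> B\<rbrakk> \<Longrightarrow> u \<oplus> v \<in> B" "u \<in> B \<Longrightarrow> c \<odot> u \<in> B" "B \<subseteq> carrier M"
proof -
  have B: "B \<subseteq> carrier M" "\<one> \<in> B" "\<And>u v. \<lbrakk>u \<in> B; v \<in> B\<rbrakk> \<Longrightarrow> u \<oplus> v \<in> B" "\<And>c u. u \<in> B \<Longrightarrow> c \<odot> u \<in> B"
    using assms by (auto simp: closed_star_subalg_def)
  show "\<zero> \<in> B" using B(4)[OF B(2), of 0] by (simp add: scale_zero)
  show "\<lbrakk>u \<in> B; v \<in> B\<rbrakk> \<Longrightarrow> u \<oplus> v \<in> B" "u \<in> B \<Longrightarrow> c \<odot> u \<in> B" "B \<subseteq> carrier M" by (fact B)+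
qed

lemma restrict_carrier:
  assumes "closed_star_subalg M B"
  shows "star_algebra (M\<lparr>carrier := B\<rparr>)"
proof -
  have B: "B \<subseteq> carrier M" "\<one> \<in> B"
      "\<And>u v. \<lbrakk>u \<in> B; v \<in> B\<rbrakk> \<Longrightarrow> u \<oplus> v \<in> B" "\<And>u v. \<lbrakk>u \<in> B; v \<in> B\<rbrakk> \<Longrightarrow> u \<otimes> v \<in> B"
      "\<And>c u. u \<in> B \<Longrightarrow> c \<odot> u \<in> B" "\<And>u. u \<in> B \<Longrightarrow> alg_star M u \<in> B"
    using assms by (auto simp: closed_star_subalg_def)
  have zero: "\<zero> \<in> B" by (rule closed_star_subalg_subspace(1)[OF assms])
  have inv: "\<exists>y\<in>B. y \<oplus> x = \<zero>" if "x \<in> B" for x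
    using that B(1) by (intro bexI[of _ "(-1) \<odot> x"] B(5)) (auto simp: scale_minus_one l_neg)
  have "ring (M\<lparr>carrier := B\<rparr>)"
  proof (rule ringI)
    show "abelian_group (M\<lparr>carrier := B\<rparr>)"
      using B(1) zero inv by (intro abelian_groupI) (auto simp: B(3) a_ac subset_iff)
    show "Group.monoid (M\<lparr>carrier := B\<rparr>)"
      using B(1) by (intro Group.monoidI) (auto simp: B m_assoc subset_iff)
  qed (use B(1) in \<open>auto simp: l_distr r_distr subset_iff\<close>)
  then show ?thesis
    using B(1) by (intro star_algebra.intro star_algebra_axioms.intro)
      (auto simp: B subset_iff scale_add_left scale_add_right scale_scale scale_mult_left
        scale_mult_right star_add star_scale star_mult norm_add norm_scale norm_mult norm_star norm_one)
qed

text \<open>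
  The family of closed *-subalgebras that is intersected contains the whole carrier. Otherwise the
  intersection could be the universe of the type.
\<close>

lemma closed_star_subalg_generated:
  assumes "S \<subseteq> carrier M"
  shows "closed_star_subalg M (carrier (generated_alg M S))"
proof -
  let ?G = "\<Inter>{B. closed_star_subalg M B \<and> S \<subseteq> B}"
  have G: "u \<in> ?G \<longleftrightarrow> (\<forall>B. closed_star_subalg M B \<and> S \<subseteq> B \<longrightarrow> u \<in> B)" for u by blast
  have "closed_star_subalg M ?G"
    unfolding closed_star_subalg_def[of M ?G]
  proof (intro conjI ballI allI impI subsetI)
    fix u assume "u \<in> ?G"
    then show "u \<in> carrier M" using assms closed_star_subalg_carrier unfolding G by blast
  next
    fix s :: "nat \<Rightarrow> 'c" and l
    assume l: "l \<in> carrier M" and s: "(\<forall>n. s n \<in> ?G) \<and> (\<lambda>n. alg_norm M (s n \<ominus> l)) \<longlonglongrightarrow> 0"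
    have "l \<in> B" if "closed_star_subalg M B" "S \<subseteq> B" for B
    proof -
      have "\<forall>n. s n \<in> B" using s that unfolding G by blast
      then show ?thesis using that(1) l s unfolding closed_star_subalg_def by blast
    qed
    then show "l \<in> ?G" unfolding G by blast
  qed (auto simp: closed_star_subalg_def)
  then show ?thesis by (simp add: generated_alg_def)
qed

end

lemma generated_alg_ops [simp]:
  "mult (generated_alg M S) = mult M" "one (generated_alg M S) = one M"
  "zero (generated_alg M S) = zero M" "add (generated_alg M S) = add M"
  "smult (generated_alg M S) = smult M" "alg_star (generated_alg M S) = alg_star M"
  "alg_norm (generated_alg M S) = alg_norm M"
  by (simp_all add: generated_alg_def)

lemma generated_superset: "S \<subseteq> carrier (generated_alg M S)"
  by (auto simp: generated_alg_def)

text \<open>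
  This is the induction principle for generated algebras: a property that defines a closed
  *-subalgebra holds everywhere if it holds for the generators.
\<close>

lemma generated_least: "\<lbrakk>closed_star_subalg M B; S \<subseteq> B\<rbrakk> \<Longrightarrow> carrier (generated_alg M S) \<subseteq> B"
  by (auto simp: generated_alg_def)

lemma star_algebra_generated:
  "\<lbrakk>star_algebra M; S \<subseteq> carrier M\<rbrakk> \<Longrightarrow> star_algebra (generated_alg M S)"
  using star_algebra.restrict_carrier[OF _ star_algebra.closed_star_subalg_generated]
  by (fastforce simp: generated_alg_def)

text \<open>
  Finite sums occur in operator algebras, in products, in \<open>\<ell>\<^sup>\<infinity>\<close> and in Hilbert spaces; evaluation at a
  vector or a point, homomorphisms, inclusions and traces are all additive and so commute with them.
\<close>

lemma additive_finsum:
  assumes M: "abelian_monoid M" and N: "abelian_monoid N"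
    and closed: "\<And>u. u \<in> carrier M \<Longrightarrow> \<phi> u \<in> carrier N"
    and zero: "\<phi> \<zero>\<^bsub>M\<^esub> = \<zero>\<^bsub>N\<^esub>"
    and add: "\<And>u v. \<lbrakk>u \<in> carrier M; v \<in> carrier M\<rbrakk> \<Longrightarrow> \<phi> (u \<oplus>\<^bsub>M\<^esub> v) = \<phi> u \<oplus>\<^bsub>N\<^esub> \<phi> v"
    and "finite A" "\<And>i. i \<in> A \<Longrightarrow> f i \<in> carrier M"
  shows "\<phi> (\<Oplus>\<^bsub>M\<^esub>i\<in>A. f i) = (\<Oplus>\<^bsub>N\<^esub>i\<in>A. \<phi> (f i))"
  using \<open>finite A\<close> assms(7)
proof (induction A)
  case empty
  then show ?case
    by (simp add: zero abelian_monoid.finsum_empty[OF M] abelian_monoid.finsum_empty[OF N])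
next
  case (insert i A)
  then show ?case
    by (simp add: abelian_monoid.finsum_insert[OF M] abelian_monoid.finsum_insert[OF N] add closed
        abelian_monoid.finsum_closed[OF M] Pi_iff)
qed

lemma additive_sum:
  fixes \<phi> :: "'c \<Rightarrow> 'd::comm_monoid_add"
  assumes M: "abelian_monoid M"
    and zero: "\<phi> \<zero>\<^bsub>M\<^esub> = 0"
    and add: "\<And>u v. \<lbrakk>u \<in> carrier M; v \<in> carrier M\<rbrakk> \<Longrightarrow> \<phi> (u \<oplus>\<^bsub>M\<^esub> v) = \<phi> u + \<phi> v"
    and "finite A" "\<And>i. i \<in> A \<Longrightarrow> f i \<in> carrier M"
  shows "\<phi> (\<Oplus>\<^bsub>M\<^esub>i\<in>A. f i) = (\<Sum>i\<in>A. \<phi> (f i))"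
  using \<open>finite A\<close> assms(5)
proof (induction A)
  case empty
  then show ?case by (simp add: zero abelian_monoid.finsum_empty[OF M])
next
  case (insert i A)
  then show ?case
    by (simp add: abelian_monoid.finsum_insert[OF M] add abelian_monoid.finsum_closed[OF M] Pi_iff)
qed

section \<open>Bounded operators\<close>

lemma op_alg_simps [simp]:
  "carrier (op_alg H) = {T. bounded_op H T}"
  "one (op_alg H) = (\<lambda>v\<in>carrier H. v)"
  "zero (op_alg H) = (\<lambda>v\<in>carrier H. \<zero>\<^bsub>H\<^esub>)"
  by (simp_all add: op_alg_def)

lemma op_alg_apply [simp]:
  assumes "v \<in> carrier H"
  shows "(S \<otimes>\<^bsub>op_alg H\<^esub> T) v = S (T v)" "(S \<oplus>\<^bsub>op_alg H\<^esub> T) v = S v \<oplus>\<^bsub>H\<^esub> T v"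
    "(c \<odot>\<^bsub>op_alg H\<^esub> T) v = c \<odot>\<^bsub>H\<^esub> T v"
  using assms by (simp_all add: op_alg_def)

lemma op_alg_extensional:
  "S \<otimes>\<^bsub>op_alg H\<^esub> T \<in> extensional (carrier H)" "S \<oplus>\<^bsub>op_alg H\<^esub> T \<in> extensional (carrier H)"
  "c \<odot>\<^bsub>op_alg H\<^esub> T \<in> extensional (carrier H)"
  by (simp_all add: op_alg_def)

lemma bounded_op_closed: "\<lbrakk>bounded_op H T; v \<in> carrier H\<rbrakk> \<Longrightarrow> T v \<in> carrier H"
  by (auto simp: bounded_op_def)

lemma bounded_op_add:
  "\<lbrakk>bounded_op H T; u \<in> carrier H; v \<in> carrier H\<rbrakk> \<Longrightarrow> T (u \<oplus>\<^bsub>H\<^esub> v) = T u \<oplus>\<^bsub>H\<^esub> T v"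
  by (simp add: bounded_op_def)

lemma bounded_op_scale: "\<lbrakk>bounded_op H T; v \<in> carrier H\<rbrakk> \<Longrightarrow> T (c \<odot>\<^bsub>H\<^esub> v) = c \<odot>\<^bsub>H\<^esub> T v"
  by (simp add: bounded_op_def)

lemma bounded_op_ext:
  "\<lbrakk>bounded_op H S; bounded_op H T; \<And>v. v \<in> carrier H \<Longrightarrow> S v = T v\<rbrakk> \<Longrightarrow> S = T"
  unfolding bounded_op_def by (meson PiE_ext)

context hilbert_space
begin

lemma bounded_op_bound:
  assumes "bounded_op H T"
  shows "\<exists>K\<ge>0. \<forall>v\<in>carrier H. snorm (T v) \<le> K * snorm v"
proof -
  obtain K where K: "\<And>v. v \<in> carrier H \<Longrightarrow> snorm (T v) \<le> K * snorm v"
    using assms unfolding bounded_op_def hnorm_eq by blast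
  have "snorm (T v) \<le> max K 0 * snorm v" if "v \<in> carrier H" for v
    using K[OF that] mult_right_mono[of K "max K 0" "snorm v"] snorm_nonneg[OF that] by linarith
  then show ?thesis by (intro exI[of _ "max K 0"]) simp
qed

lemma bounded_opI:
  assumes "T \<in> extensional (carrier H)" "\<And>v. v \<in> carrier H \<Longrightarrow> T v \<in> carrier H"
    and "\<And>u v. \<lbrakk>u \<in> carrier H; v \<in> carrier H\<rbrakk> \<Longrightarrow> T (u \<oplus> v) = T u \<oplus> T v"
    and "\<And>c v. v \<in> carrier H \<Longrightarrow> T (c \<odot> v) = c \<odot> T v"
    and "\<And>v. v \<in> carrier H \<Longrightarrow> snorm (T v) \<le> K * snorm v"
  shows "bounded_op H T"
proof -
  have "\<exists>K. \<forall>v\<in>carrier H. hnorm H (T v) \<le> K * hnorm H v" using assms(5) by (auto intro: exI[of _ K])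
  then show ?thesis using assms(1-4) unfolding bounded_op_def PiE_def by auto
qed

lemma bounded_op_one: "bounded_op H (\<lambda>v\<in>carrier H. v)"
  by (rule bounded_opI[where K = 1]) auto

lemma bounded_op_zero: "bounded_op H (\<lambda>v\<in>carrier H. \<zero>)"
  by (rule bounded_opI[where K = 0]) (auto simp: smult_r_null)

lemma bounded_op_plus:
  assumes S: "bounded_op H S" and T: "bounded_op H T"
  shows "bounded_op H (S \<oplus>\<^bsub>op_alg H\<^esub> T)"
proof -
  obtain K where K: "\<And>v. v \<in> carrier H \<Longrightarrow> snorm (S v) \<le> K * snorm v"
    using bounded_op_bound[OF S] by blast
  obtain L where L: "\<And>v. v \<in> carrier H \<Longrightarrow> snorm (T v) \<le> L * snorm v"
    using bounded_op_bound[OF T] by blast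
  note cl = bounded_op_closed[OF S] bounded_op_closed[OF T]
  show ?thesis
  proof (rule bounded_opI[where K = "K + L"])
    fix v assume v: "v \<in> carrier H"
    show "snorm ((S \<oplus>\<^bsub>op_alg H\<^esub> T) v) \<le> (K + L) * snorm v"
      using snorm_triangle[OF cl(1)[OF v] cl(2)[OF v]] K[OF v] L[OF v] v by (simp add: distrib_right)
  qed (auto simp: op_alg_extensional cl bounded_op_add[OF S] bounded_op_add[OF T]
      bounded_op_scale[OF S] bounded_op_scale[OF T] scale_add_right M.a_ac)
qed

lemma bounded_op_times:
  assumes S: "bounded_op H S" and T: "bounded_op H T"
  shows "bounded_op H (S \<otimes>\<^bsub>op_alg H\<^esub> T)"
proof -
  obtain K where K: "\<And>v. v \<in> carrier H \<Longrightarrow> snorm (S v) \<le> K * snorm v" "0 \<le> K"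
    using bounded_op_bound[OF S] by blast
  obtain L where L: "\<And>v. v \<in> carrier H \<Longrightarrow> snorm (T v) \<le> L * snorm v"
    using bounded_op_bound[OF T] by blast
  note cl = bounded_op_closed[OF S] bounded_op_closed[OF T]
  show ?thesis
  proof (rule bounded_opI[where K = "K * L"])
    fix v assume v: "v \<in> carrier H"
    show "snorm ((S \<otimes>\<^bsub>op_alg H\<^esub> T) v) \<le> (K * L) * snorm v"
      using K(1)[OF cl(2)[OF v]] mult_left_mono[OF L[OF v] K(2)] v by (simp add: mult.assoc)
  qed (auto simp: op_alg_extensional cl bounded_op_add[OF S] bounded_op_add[OF T]
      bounded_op_scale[OF S] bounded_op_scale[OF T])
qed

lemma bounded_op_smult:
  assumes T: "bounded_op H T"
  shows "bounded_op H (c \<odot>\<^bsub>op_alg H\<^esub> T)"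
proof -
  obtain K where K: "\<And>v. v \<in> carrier H \<Longrightarrow> snorm (T v) \<le> K * snorm v"
    using bounded_op_bound[OF T] by blast
  note cl = bounded_op_closed[OF T]
  show ?thesis
  proof (rule bounded_opI[where K = "cmod c * K"])
    fix v assume v: "v \<in> carrier H"
    show "snorm ((c \<odot>\<^bsub>op_alg H\<^esub> T) v) \<le> (cmod c * K) * snorm v"
      using mult_left_mono[OF K[OF v], of "cmod c"]
      by (simp only: op_alg_apply[OF v] snorm_scale[OF cl[OF v]] norm_ge_zero mult.assoc)
  next
    fix d v assume v: "v \<in> carrier H"
    show "(c \<odot>\<^bsub>op_alg H\<^esub> T) (d \<odot> v) = d \<odot> (c \<odot>\<^bsub>op_alg H\<^esub> T) v"
      using v by (simp add: bounded_op_scale[OF T] cl scale_scale mult.commute)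
  qed (auto simp: op_alg_extensional cl bounded_op_add[OF T] scale_add_right)
qed

text \<open>
  \<open>\<parallel>S u\<parallel>\<^sup>2 = \<langle>u, T S u\<rangle> \<le> \<parallel>u\<parallel> K \<parallel>S u\<parallel>\<close>.
\<close>

lemma adjoint_bound:
  assumes T: "\<And>v. v \<in> carrier H \<Longrightarrow> T v \<in> carrier H"
    and S: "\<And>v. v \<in> carrier H \<Longrightarrow> S v \<in> carrier H"
    and K: "\<And>v. v \<in> carrier H \<Longrightarrow> snorm (T v) \<le> K * snorm v" "0 \<le> K"
    and adj: "\<And>u v. \<lbrakk>u \<in> carrier H; v \<in> carrier H\<rbrakk> \<Longrightarrow> hinner H (S u) v = hinner H u (T v)"
    and u: "u \<in> carrier H"
  shows "snorm (S u) \<le> K * snorm u"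
proof (cases "snorm (S u) = 0")
  case True
  then show ?thesis using K(2) u by simp
next
  case False
  then have pos: "snorm (S u) > 0" using snorm_nonneg[OF S[OF u]] by linarith
  have "(snorm (S u))\<^sup>2 = Re (hinner H u (T (S u)))" using adj S u snorm_sq by simp
  also have "\<dots> \<le> snorm u * snorm (T (S u))"
    using cauchy_schwarz[OF u T[OF S[OF u]]] complex_Re_le_cmod order_trans by blast
  also have "\<dots> \<le> snorm u * (K * snorm (S u))"
    using K(1)[OF S[OF u]] snorm_nonneg[OF u] by (rule mult_left_mono)
  finally have "snorm (S u) * snorm (S u) \<le> (K * snorm u) * snorm (S u)"
    by (simp add: power2_eq_square algebra_simps)
  then show ?thesis using pos by (rule mult_right_le_imp_le)
qed

text \<open>
  \<open>S u\<close> is the vector that represents the functional \<open>v \<mapsto> \<langle>u, T v\<rangle>\<close>; linearity and the bound follow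
  from uniqueness and from \<open>adjoint_bound\<close>.
\<close>

lemma adjoint_exists:
  assumes T: "bounded_op H T"
  obtains S where "bounded_op H S"
    "\<And>u v. \<lbrakk>u \<in> carrier H; v \<in> carrier H\<rbrakk> \<Longrightarrow> hinner H (S u) v = hinner H u (T v)"
proof -
  obtain K where K: "0 \<le> K" "\<And>v. v \<in> carrier H \<Longrightarrow> snorm (T v) \<le> K * snorm v"
    using bounded_op_bound[OF T] by blast
  note cl = bounded_op_closed[OF T]
  have "\<exists>r\<in>carrier H. \<forall>v\<in>carrier H. hinner H r v = hinner H u (T v)" if u: "u \<in> carrier H" for u
  proof -
    have "cmod (hinner H u (T v)) \<le> (snorm u * K) * snorm v" if v: "v \<in> carrier H" for v
      using order_trans[OF cauchy_schwarz[OF u cl[OF v]] mult_left_mono[OF K(2)[OF v] snorm_nonneg[OF u]]]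
      by (simp add: mult.assoc)
    with u obtain r where "r \<in> carrier H" "\<And>v. v \<in> carrier H \<Longrightarrow> hinner H r v = hinner H u (T v)"
      by (rule_tac riesz_representation[of "\<lambda>v. hinner H u (T v)" "snorm u * K"])
        (auto simp: bounded_op_add[OF T] bounded_op_scale[OF T] cl form_simps)
    then show ?thesis by blast
  qed
  then obtain S0 where S0: "\<And>u. u \<in> carrier H \<Longrightarrow> S0 u \<in> carrier H"
      "\<And>u v. \<lbrakk>u \<in> carrier H; v \<in> carrier H\<rbrakk> \<Longrightarrow> hinner H (S0 u) v = hinner H u (T v)"
    by metis
  define S where "S = (\<lambda>u\<in>carrier H. S0 u)"
  have S: "\<And>u. u \<in> carrier H \<Longrightarrow> S u \<in> carrier H"
      "\<And>u v. \<lbrakk>u \<in> carrier H; v \<in> carrier H\<rbrakk> \<Longrightarrow> hinner H (S u) v = hinner H u (T v)"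
    using S0 by (simp_all add: S_def)
  have "bounded_op H S"
  proof (rule bounded_opI[where K = K])
    fix u assume u: "u \<in> carrier H"
    show "snorm (S u) \<le> K * snorm u" by (rule adjoint_bound[of T S K]) (use S cl K u in auto)
  qed (auto simp: S form_simps cl intro!: hinner_eqI_left, simp add: S_def)
  then show thesis using that S(2) by blast
qed

lemma adjoint_unique:
  assumes T: "bounded_op H T" and S: "bounded_op H S"
    and adj: "\<And>u v. \<lbrakk>u \<in> carrier H; v \<in> carrier H\<rbrakk> \<Longrightarrow> hinner H (S u) v = hinner H u (T v)"
  shows "alg_star (op_alg H) T = S"
proof -
  have "(THE S. bounded_op H S \<and> (\<forall>u\<in>carrier H. \<forall>v\<in>carrier H. hinner H (S u) v = hinner H u (T v))) = S"
  proof (rule the_equality)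
    fix R assume R: "bounded_op H R \<and> (\<forall>u\<in>carrier H. \<forall>v\<in>carrier H. hinner H (R u) v = hinner H u (T v))"
    show "R = S"
      by (rule bounded_op_ext[of H]) (use R S adj in \<open>auto intro!: hinner_eqI_left simp: bounded_op_closed\<close>)
  qed (use S adj in auto)
  then show ?thesis by (simp add: op_alg_def)
qed

lemma
  assumes "bounded_op H T"
  shows bounded_op_star: "bounded_op H (alg_star (op_alg H) T)"
    and hinner_star: "\<lbrakk>u \<in> carrier H; v \<in> carrier H\<rbrakk> \<Longrightarrow>
      hinner H (alg_star (op_alg H) T u) v = hinner H u (T v)"
  using adjoint_exists[OF assms] adjoint_unique[OF assms] by metis+

lemma hinner_star_right:
  assumes "bounded_op H T" "u \<in> carrier H" "v \<in> carrier H"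
  shows "hinner H u (alg_star (op_alg H) T v) = hinner H (T u) v"
  using form_cnj[of "alg_star (op_alg H) T v" u] form_cnj[of v "T u"] hinner_star[OF assms(1,3,2)]
    assms bounded_op_star bounded_op_closed by metis

lemma op_norm_bdd:
  assumes T: "bounded_op H T"
  shows "bdd_above ((\<lambda>v. snorm (T v)) ` {v \<in> carrier H. snorm v \<le> 1})"
proof -
  obtain K where K: "0 \<le> K" "\<And>v. v \<in> carrier H \<Longrightarrow> snorm (T v) \<le> K * snorm v"
    using bounded_op_bound[OF T] by blast
  have "snorm (T v) \<le> K" if "v \<in> carrier H" "snorm v \<le> 1" for v
    using K(2)[OF that(1)] mult_left_mono[OF that(2) K(1)] by simp
  then show ?thesis by (auto intro!: bdd_aboveI[where M = K])
qed

lemma op_norm_eq: "alg_norm (op_alg H) T = (SUP v\<in>{v \<in> carrier H. snorm v \<le> 1}. snorm (T v))"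
  by (simp add: op_alg_def)

lemma op_norm_ge:
  assumes T: "bounded_op H T" and v: "v \<in> carrier H"
  shows "snorm (T v) \<le> alg_norm (op_alg H) T * snorm v"
proof (cases "snorm v = 0")
  case True
  obtain K where "\<And>v. v \<in> carrier H \<Longrightarrow> snorm (T v) \<le> K * snorm v"
    using bounded_op_bound[OF T] by blast
  from this[OF v] True show ?thesis by simp
next
  case False
  then have pos: "0 < snorm v" using snorm_nonneg[OF v] by linarith
  define w where "w = of_real (1 / snorm v) \<odot> v"
  have w: "w \<in> carrier H" "snorm w = 1"
    using v pos snorm_scale[OF v, of "of_real (1 / snorm v)"] unfolding w_def
    by (simp_all only: scale_closed norm_of_real) simp
  have "snorm (T w) \<le> alg_norm (op_alg H) T"
    unfolding op_norm_eq using w by (intro cSUP_upper op_norm_bdd[OF T]) simp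
  moreover have "snorm (T w) = snorm (T v) / snorm v"
  proof -
    have "T w = of_real (1 / snorm v) \<odot> T v" unfolding w_def by (rule bounded_op_scale[OF T v])
    then show ?thesis
      using snorm_scale[OF bounded_op_closed[OF T v], of "of_real (1 / snorm v)"] pos
      by (simp only: norm_of_real) simp
  qed
  ultimately show ?thesis using pos by (simp add: divide_le_eq)
qed

lemma op_norm_le:
  assumes "\<And>v. v \<in> carrier H \<Longrightarrow> snorm (T v) \<le> K * snorm v" "0 \<le> K"
  shows "alg_norm (op_alg H) T \<le> K"
  unfolding op_norm_eq
proof (rule cSUP_least)
  have "\<zero> \<in> {v \<in> carrier H. snorm v \<le> 1}" by simp
  then show "{v \<in> carrier H. snorm v \<le> 1} \<noteq> {}" by blast
  fix v assume "v \<in> {v \<in> carrier H. snorm v \<le> 1}"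
  then have "v \<in> carrier H" "snorm v \<le> 1" by simp_all
  then show "snorm (T v) \<le> K" using assms(1)[of v] mult_left_mono[OF _ assms(2), of "snorm v" 1] by simp
qed

lemma op_norm_nonneg: "bounded_op H T \<Longrightarrow> 0 \<le> alg_norm (op_alg H) T"
proof -
  assume T: "bounded_op H T"
  have "0 \<le> snorm (T \<zero>)" using bounded_op_closed[OF T] by simp
  also have "\<dots> \<le> alg_norm (op_alg H) T"
    unfolding op_norm_eq by (intro cSUP_upper op_norm_bdd[OF T]) simp
  finally show ?thesis .
qed

theorem star_algebra_op_alg: "star_algebra (op_alg H)"
proof -
  note cl = bounded_op_closed bounded_op_plus bounded_op_times bounded_op_smult bounded_op_star
    bounded_op_one bounded_op_zero
  note lin = bounded_op_add bounded_op_scale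
  have ring: "ring (op_alg H)"
  proof (rule ringI)
    show "abelian_group (op_alg H)"
    proof (rule abelian_groupI)
      fix T assume T: "T \<in> carrier (op_alg H)"
      show "\<exists>S\<in>carrier (op_alg H). S \<oplus>\<^bsub>op_alg H\<^esub> T = \<zero>\<^bsub>op_alg H\<^esub>"
      proof (rule bexI[of _ "(-1) \<odot>\<^bsub>op_alg H\<^esub> T"])
        show "(-1) \<odot>\<^bsub>op_alg H\<^esub> T \<oplus>\<^bsub>op_alg H\<^esub> T = \<zero>\<^bsub>op_alg H\<^esub>"
          by (rule bounded_op_ext[of H]) (use T in \<open>auto simp: cl scale_minus_one M.l_neg\<close>)
      qed (use T cl in auto)
    qed (auto intro!: bounded_op_ext[of H] simp: cl M.a_ac)
    show "Group.monoid (op_alg H)"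
      by (rule Group.monoidI) (auto intro!: bounded_op_ext[of H] simp: cl)
  qed (auto intro!: bounded_op_ext[of H] simp: cl lin)
  have nm: "alg_norm (op_alg H) (alg_star (op_alg H) T) \<le> alg_norm (op_alg H) T"
    if T: "bounded_op H T" for T
  proof (rule op_norm_le)
    fix v assume v: "v \<in> carrier H"
    show "snorm (alg_star (op_alg H) T v) \<le> alg_norm (op_alg H) T * snorm v"
      by (rule adjoint_bound[of T _ "alg_norm (op_alg H) T"])
        (use T v in \<open>auto simp: cl op_norm_ge op_norm_nonneg hinner_star\<close>)
  qed (rule op_norm_nonneg[OF T])
  show ?thesis
  proof (intro star_algebra.intro ring star_algebra_axioms.intro)
    fix S T assume "S \<in> carrier (op_alg H)" "T \<in> carrier (op_alg H)"
    then have ST: "bounded_op H S" "bounded_op H T" by simp_all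
    show "alg_star (op_alg H) (S \<oplus>\<^bsub>op_alg H\<^esub> T) = alg_star (op_alg H) S \<oplus>\<^bsub>op_alg H\<^esub> alg_star (op_alg H) T"
      using ST by (intro adjoint_unique) (auto simp: cl form_simps hinner_star)
    show "alg_star (op_alg H) (S \<otimes>\<^bsub>op_alg H\<^esub> T) = alg_star (op_alg H) T \<otimes>\<^bsub>op_alg H\<^esub> alg_star (op_alg H) S"
      using ST by (intro adjoint_unique) (auto simp: cl form_simps hinner_star)
    show "alg_norm (op_alg H) (S \<oplus>\<^bsub>op_alg H\<^esub> T) \<le> alg_norm (op_alg H) S + alg_norm (op_alg H) T"
    proof (rule op_norm_le)
      fix v assume v: "v \<in> carrier H"
      show "snorm ((S \<oplus>\<^bsub>op_alg H\<^esub> T) v) \<le> (alg_norm (op_alg H) S + alg_norm (op_alg H) T) * snorm v"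
        using snorm_triangle[OF cl(1)[OF ST(1) v] cl(1)[OF ST(2) v]] op_norm_ge[OF ST(1) v] op_norm_ge[OF ST(2) v]
        by (simp only: op_alg_apply[OF v] distrib_right)
    qed (use ST op_norm_nonneg in simp)
    show "alg_norm (op_alg H) (S \<otimes>\<^bsub>op_alg H\<^esub> T) \<le> alg_norm (op_alg H) S * alg_norm (op_alg H) T"
    proof (rule op_norm_le)
      fix v assume v: "v \<in> carrier H"
      show "snorm ((S \<otimes>\<^bsub>op_alg H\<^esub> T) v) \<le> (alg_norm (op_alg H) S * alg_norm (op_alg H) T) * snorm v"
        using order_trans[OF op_norm_ge[OF ST(1) cl(1)[OF ST(2) v]]
            mult_left_mono[OF op_norm_ge[OF ST(2) v] op_norm_nonneg[OF ST(1)]]]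
        by (simp only: op_alg_apply[OF v] mult.assoc)
    qed (use ST op_norm_nonneg in simp)
  next
    fix T c assume "T \<in> carrier (op_alg H)"
    then have T: "bounded_op H T" by simp
    show "alg_star (op_alg H) (alg_star (op_alg H) T) = T"
      using T by (intro adjoint_unique) (auto simp: cl hinner_star_right)
    show "alg_star (op_alg H) (c \<odot>\<^bsub>op_alg H\<^esub> T) = cnj c \<odot>\<^bsub>op_alg H\<^esub> alg_star (op_alg H) T"
      using T by (intro adjoint_unique) (auto simp: cl form_simps hinner_star)
    show "alg_norm (op_alg H) (c \<odot>\<^bsub>op_alg H\<^esub> T) \<le> cmod c * alg_norm (op_alg H) T"
    proof (rule op_norm_le)
      fix v assume v: "v \<in> carrier H"
      show "snorm ((c \<odot>\<^bsub>op_alg H\<^esub> T) v) \<le> cmod c * alg_norm (op_alg H) T * snorm v"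
        using mult_left_mono[OF op_norm_ge[OF T v], of "cmod c"]
        by (simp only: op_alg_apply[OF v] snorm_scale[OF cl(1)[OF T v]] mult.assoc norm_ge_zero)
    qed (use T op_norm_nonneg in simp)
  qed (auto intro!: bounded_op_ext[of H] simp: cl lin scale_scale scale_add_left scale_add_right op_norm_nonneg nm op_norm_le)
qed

end

section \<open>Products of normed *-algebras\<close>

lemma prod_alg_apply [simp]:
  assumes "i \<in> I"
  shows "(F \<otimes>\<^bsub>prod_alg I M\<^esub> G) i = F i \<otimes>\<^bsub>M i\<^esub> G i" "\<one>\<^bsub>prod_alg I M\<^esub> i = \<one>\<^bsub>M i\<^esub>"
    "(F \<oplus>\<^bsub>prod_alg I M\<^esub> G) i = F i \<oplus>\<^bsub>M i\<^esub> G i" "\<zero>\<^bsub>prod_alg I M\<^esub> i = \<zero>\<^bsub>M i\<^esub>"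
    "(c \<odot>\<^bsub>prod_alg I M\<^esub> F) i = c \<odot>\<^bsub>M i\<^esub> F i"
    "alg_star (prod_alg I M) F i = alg_star (M i) (F i)"
  using assms by (simp_all add: prod_alg_def)

lemma prod_alg_extensional [simp]:
  "F \<otimes>\<^bsub>prod_alg I M\<^esub> G \<in> extensional I" "\<one>\<^bsub>prod_alg I M\<^esub> \<in> extensional I"
  "F \<oplus>\<^bsub>prod_alg I M\<^esub> G \<in> extensional I" "\<zero>\<^bsub>prod_alg I M\<^esub> \<in> extensional I"
  "c \<odot>\<^bsub>prod_alg I M\<^esub> F \<in> extensional I" "alg_star (prod_alg I M) F \<in> extensional I"
  by (simp_all add: prod_alg_def)

lemma prod_carrierD: "\<lbrakk>F \<in> carrier (prod_alg I M); i \<in> I\<rbrakk> \<Longrightarrow> F i \<in> carrier (M i)"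
  by (auto simp: prod_alg_def)

lemma prod_carrier_extensional: "F \<in> carrier (prod_alg I M) \<Longrightarrow> F \<in> extensional I"
  by (auto simp: prod_alg_def PiE_def)

lemma prod_carrierI:
  "\<lbrakk>F \<in> extensional I; \<And>i. i \<in> I \<Longrightarrow> F i \<in> carrier (M i); \<And>i. i \<in> I \<Longrightarrow> alg_norm (M i) (F i) \<le> K\<rbrakk>
    \<Longrightarrow> F \<in> carrier (prod_alg I M)"
  by (auto simp: prod_alg_def PiE_def intro!: bdd_aboveI[where M = K])

lemma prod_ext:
  "\<lbrakk>F \<in> carrier (prod_alg I M); G \<in> carrier (prod_alg I M); \<And>i. i \<in> I \<Longrightarrow> F i = G i\<rbrakk> \<Longrightarrow> F = G"
  by (rule extensionalityI[of _ I]) (auto dest: prod_carrier_extensional)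

lemma prod_norm_ge:
  "\<lbrakk>F \<in> carrier (prod_alg I M); i \<in> I\<rbrakk> \<Longrightarrow> alg_norm (M i) (F i) \<le> alg_norm (prod_alg I M) F"
  by (auto simp: prod_alg_def intro!: cSup_upper)

lemma prod_norm_le:
  "\<lbrakk>\<And>i. i \<in> I \<Longrightarrow> alg_norm (M i) (F i) \<le> K; 0 \<le> K\<rbrakk> \<Longrightarrow> alg_norm (prod_alg I M) F \<le> K"
  unfolding prod_alg_def star_alg.simps by (rule cSup_least) auto

lemma prod_norm_nonneg: "F \<in> carrier (prod_alg I M) \<Longrightarrow> 0 \<le> alg_norm (prod_alg I M) F"
  by (auto simp: prod_alg_def intro!: cSup_upper)

text \<open>
  The laws hold in each coordinate. The norm inequalities of the factors give bounds that do not
  depend on the coordinate, so the operations preserve bounded families.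
\<close>

theorem star_algebra_prod_alg:
  assumes M: "\<And>i. i \<in> I \<Longrightarrow> star_algebra (M i)"
  shows "star_algebra (prod_alg I M)"
proof -
  let ?P = "prod_alg I M"
  note ring = star_algebra.axioms(1)[OF M]
  note closed = ring.ring_simprules(1,2,5,6)[OF ring] star_algebra.scale_closed[OF M]
    star_algebra.star_closed[OF M]
  note laws = star_algebra.scale_add_left[OF M] star_algebra.scale_add_right[OF M]
    star_algebra.scale_scale[OF M] star_algebra.scale_one[OF M] star_algebra.scale_mult_left[OF M]
    star_algebra.scale_mult_right[OF M] star_algebra.star_add[OF M] star_algebra.star_scale[OF M]
    star_algebra.star_mult[OF M] star_algebra.star_star[OF M]
  note pc = prod_carrierD[where I = I and M = M]
  have add_norm: "alg_norm (M i) ((F \<oplus>\<^bsub>?P\<^esub> G) i) \<le> alg_norm ?P F + alg_norm ?P G"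
    if "F \<in> carrier ?P" "G \<in> carrier ?P" "i \<in> I" for F G i
    using star_algebra.norm_add[OF M[OF that(3)] pc[OF that(1,3)] pc[OF that(2,3)]]
      prod_norm_ge[OF that(1,3)] prod_norm_ge[OF that(2,3)] that(3) by simp
  have mult_norm: "alg_norm (M i) ((F \<otimes>\<^bsub>?P\<^esub> G) i) \<le> alg_norm ?P F * alg_norm ?P G"
    if "F \<in> carrier ?P" "G \<in> carrier ?P" "i \<in> I" for F G i
  proof -
    note p = pc[OF that(1,3)] pc[OF that(2,3)]
    have "alg_norm (M i) (F i) * alg_norm (M i) (G i) \<le> alg_norm ?P F * alg_norm ?P G"
      using prod_norm_ge[OF that(1,3)] prod_norm_ge[OF that(2,3)] prod_norm_nonneg[OF that(1)]
        star_algebra.norm_nonneg[OF M[OF that(3)] p(2)] by (rule mult_mono)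
    then show ?thesis using star_algebra.norm_mult[OF M[OF that(3)] p] that(3) by simp
  qed
  have scale_norm: "alg_norm (M i) ((c \<odot>\<^bsub>?P\<^esub> F) i) \<le> cmod c * alg_norm ?P F"
    if "F \<in> carrier ?P" "i \<in> I" for F c i
    using order_trans[OF star_algebra.norm_scale[OF M[OF that(2)] pc[OF that], of c]
          mult_left_mono[OF prod_norm_ge[OF that] norm_ge_zero]] that(2) by simp
  have star_norm: "alg_norm (M i) (alg_star ?P F i) \<le> alg_norm ?P F"
    if "F \<in> carrier ?P" "i \<in> I" for F i
    using order_trans[OF star_algebra.norm_star[OF M[OF that(2)] pc[OF that]] prod_norm_ge[OF that]]
      that(2) by simp
  have add: "F \<oplus>\<^bsub>?P\<^esub> G \<in> carrier ?P" if "F \<in> carrier ?P" "G \<in> carrier ?P" for F G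
    using add_norm[OF that] by (intro prod_carrierI) (auto simp: pc closed that)
  have mult: "F \<otimes>\<^bsub>?P\<^esub> G \<in> carrier ?P" if "F \<in> carrier ?P" "G \<in> carrier ?P" for F G
    using mult_norm[OF that] by (intro prod_carrierI) (auto simp: pc closed that)
  have scale: "c \<odot>\<^bsub>?P\<^esub> F \<in> carrier ?P" if "F \<in> carrier ?P" for F c
    using scale_norm[OF that] by (intro prod_carrierI) (auto simp: pc closed that)
  have star: "alg_star ?P F \<in> carrier ?P" if "F \<in> carrier ?P" for F
    using star_norm[OF that] by (intro prod_carrierI) (auto simp: pc closed that)
  have zero: "\<zero>\<^bsub>?P\<^esub> \<in> carrier ?P"
  proof (rule prod_carrierI[where K = 0])
    fix i assume i: "i \<in> I"
    interpret star_algebra "M i" by (rule M[OF i])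
    show "\<zero>\<^bsub>?P\<^esub> i \<in> carrier (M i)" using i by simp
    show "alg_norm (M i) (\<zero>\<^bsub>?P\<^esub> i) \<le> 0"
      using norm_scale[of "\<zero>\<^bsub>M i\<^esub>" 0] i by (simp add: scale_zero)
  qed simp
  have one: "\<one>\<^bsub>?P\<^esub> \<in> carrier ?P"
  proof (rule prod_carrierI[where K = 1])
    fix i assume i: "i \<in> I"
    interpret star_algebra "M i" by (rule M[OF i])
    show "\<one>\<^bsub>?P\<^esub> i \<in> carrier (M i)" using i by simp
    show "alg_norm (M i) (\<one>\<^bsub>?P\<^esub> i) \<le> 1" using norm_one i by simp
  qed simp
  note pclosed = add mult scale star zero one
  have neg: "(-1) \<odot>\<^bsub>?P\<^esub> F \<oplus>\<^bsub>?P\<^esub> F = \<zero>\<^bsub>?P\<^esub>" if F: "F \<in> carrier ?P" for F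
  proof (rule prod_ext)
    fix i assume i: "i \<in> I"
    interpret star_algebra "M i" by (rule M[OF i])
    show "((-1) \<odot>\<^bsub>?P\<^esub> F \<oplus>\<^bsub>?P\<^esub> F) i = \<zero>\<^bsub>?P\<^esub> i"
      using i pc[OF F i] by (simp add: scale_minus_one l_neg)
  qed (use pclosed F in blast)+
  have undef: "F i = undefined" if "F \<in> carrier ?P" "i \<notin> I" for F i
    using prod_carrier_extensional[OF that(1)] that(2) by (simp add: extensional_def)
  note pointwise = fun_eq_iff restrict_def undef pc closed
  have inverse: "\<exists>G\<in>carrier ?P. G \<oplus>\<^bsub>?P\<^esub> F = \<zero>\<^bsub>?P\<^esub>" if "F \<in> carrier ?P" for F
    using neg[OF that] scale[OF that] by blast
  note eqI = prod_ext[of _ I M]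
  have "ring ?P"
  proof (rule ringI)
    show "abelian_group ?P"
      by (rule abelian_groupI)
        (auto intro!: eqI inverse simp: pclosed pc closed ring.ring_simprules(7,8,10,15,22)[OF ring])
    show "Group.monoid ?P"
      by (rule Group.monoidI)
        (auto intro!: eqI simp: pclosed pc closed ring.ring_simprules(11,12)[OF ring]
          monoid.r_one[OF ring.is_monoid[OF ring]])
  qed (auto intro!: eqI simp: pclosed pc closed ring.ring_simprules(13,23)[OF ring])
  then show ?thesis
  proof (intro star_algebra.intro star_algebra_axioms.intro)
    fix F G assume FG: "F \<in> carrier ?P" "G \<in> carrier ?P"
    note nonneg = prod_norm_nonneg[OF FG(1)] prod_norm_nonneg[OF FG(2)]
    show "alg_norm ?P (F \<oplus>\<^bsub>?P\<^esub> G) \<le> alg_norm ?P F + alg_norm ?P G"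
      using nonneg by (intro prod_norm_le add_norm FG) auto
    show "alg_norm ?P (F \<otimes>\<^bsub>?P\<^esub> G) \<le> alg_norm ?P F * alg_norm ?P G"
      using nonneg by (intro prod_norm_le mult_norm FG) auto
  next
    fix F c assume F: "F \<in> carrier ?P"
    show "alg_norm ?P (c \<odot>\<^bsub>?P\<^esub> F) \<le> cmod c * alg_norm ?P F"
      using prod_norm_nonneg[OF F] by (intro prod_norm_le scale_norm F) auto
    show "alg_norm ?P (alg_star ?P F) \<le> alg_norm ?P F"
      using prod_norm_nonneg[OF F] by (intro prod_norm_le star_norm F) auto
  next
    show "alg_norm ?P \<one>\<^bsub>?P\<^esub> \<le> 1"
      using star_algebra.norm_one[OF M] by (intro prod_norm_le) auto
  qed (auto intro!: eqI simp: pclosed pc closed laws prod_norm_nonneg)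
qed

section \<open>Free products of copies of the finite-dimensional commutative algebra\<close>

abbreviation point_mass :: "'a \<Rightarrow> 'a \<Rightarrow> complex" where
  "point_mass a \<equiv> (\<lambda>a'. if a' = a then 1 else 0)"

lemma unital_star_homD:
  assumes "unital_star_hom M N \<phi>"
  shows "u \<in> carrier M \<Longrightarrow> \<phi> u \<in> carrier N" "\<phi> \<one>\<^bsub>M\<^esub> = \<one>\<^bsub>N\<^esub>"
    "\<lbrakk>u \<in> carrier M; v \<in> carrier M\<rbrakk> \<Longrightarrow> \<phi> (u \<oplus>\<^bsub>M\<^esub> v) = \<phi> u \<oplus>\<^bsub>N\<^esub> \<phi> v"
    "\<lbrakk>u \<in> carrier M; v \<in> carrier M\<rbrakk> \<Longrightarrow> \<phi> (u \<otimes>\<^bsub>M\<^esub> v) = \<phi> u \<otimes>\<^bsub>N\<^esub> \<phi> v"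
    "u \<in> carrier M \<Longrightarrow> \<phi> (c \<odot>\<^bsub>M\<^esub> u) = c \<odot>\<^bsub>N\<^esub> \<phi> u"
    "u \<in> carrier M \<Longrightarrow> \<phi> (alg_star M u) = alg_star N (\<phi> u)"
  using assms by (auto simp: unital_star_hom_def)

lemma unital_star_hom_comp:
  "\<lbrakk>unital_star_hom M N \<phi>; unital_star_hom N L \<psi>\<rbrakk> \<Longrightarrow> unital_star_hom M L (\<lambda>u. \<psi> (\<phi> u))"
  by (auto simp: unital_star_hom_def Pi_iff)

lemma unital_star_hom_zero:
  assumes "star_algebra M" "star_algebra N" "unital_star_hom M N \<phi>"
  shows "\<phi> \<zero>\<^bsub>M\<^esub> = \<zero>\<^bsub>N\<^esub>"
proof -
  interpret M: star_algebra M by fact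
  interpret N: star_algebra N by fact
  show ?thesis
    using unital_star_homD(5)[OF assms(3) M.one_closed, of 0] unital_star_homD(1)[OF assms(3) M.one_closed]
    by (simp add: M.scale_zero N.scale_zero)
qed

lemma unital_star_hom_finsum:
  assumes "star_algebra M" "star_algebra N" "unital_star_hom M N \<phi>"
    and "finite A" "\<And>i. i \<in> A \<Longrightarrow> f i \<in> carrier M"
  shows "\<phi> (\<Oplus>\<^bsub>M\<^esub>i\<in>A. f i) = (\<Oplus>\<^bsub>N\<^esub>i\<in>A. \<phi> (f i))"
proof -
  interpret M: star_algebra M by fact
  interpret N: star_algebra N by fact
  show ?thesis
    using unital_star_homD[OF assms(3)] unital_star_hom_zero[OF assms(1-3)] assms(4,5)
    by (intro additive_finsum M.abelian_monoid_axioms N.abelian_monoid_axioms) auto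
qed

lemma closed_star_subalg_limit:
  "\<lbrakk>closed_star_subalg M B; l \<in> carrier M; \<And>n. s n \<in> B; (\<lambda>n::nat. alg_norm M (s n \<ominus>\<^bsub>M\<^esub> l)) \<longlonglongrightarrow> 0\<rbrakk>
    \<Longrightarrow> l \<in> B"
  unfolding closed_star_subalg_def by blast

text \<open>
  Contractivity turns norm limits into norm limits, so that closedness pulls back. Together with
  \<open>generated_least\<close> this proves membership statements about images of a generated algebra.
\<close>

lemma closed_star_subalg_vimage:
  assumes M: "star_algebra M" and N: "star_algebra N" and hom: "unital_star_hom M N \<phi>"
    and contractive: "\<And>u. u \<in> carrier M \<Longrightarrow> alg_norm N (\<phi> u) \<le> alg_norm M u"
    and B: "closed_star_subalg N B"
  shows "closed_star_subalg M {u \<in> carrier M. \<phi> u \<in> B}"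
  unfolding closed_star_subalg_def[of M]
proof (intro conjI ballI allI impI)
  interpret M: star_algebra M by fact
  interpret N: star_algebra N by fact
  note \<phi> = unital_star_homD[OF hom]
  fix s l
  assume l: "l \<in> carrier M"
    and s: "(\<forall>n. s n \<in> {u \<in> carrier M. \<phi> u \<in> B}) \<and> (\<lambda>n::nat. alg_norm M (s n \<ominus>\<^bsub>M\<^esub> l)) \<longlonglongrightarrow> 0"
  then have sM: "s n \<in> carrier M" and sB: "\<phi> (s n) \<in> B" for n by simp_all
  have "(\<lambda>n. alg_norm N (\<phi> (s n) \<ominus>\<^bsub>N\<^esub> \<phi> l)) \<longlonglongrightarrow> 0"
  proof (rule tendsto_sandwich[OF _ _ tendsto_const conjunct2[OF s]])
    have eq: "\<phi> (s n) \<ominus>\<^bsub>N\<^esub> \<phi> l = \<phi> (s n \<ominus>\<^bsub>M\<^esub> l)" for n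
      using l sM by (simp add: M.minus_eq_scale N.minus_eq_scale \<phi>)
    have mem: "s n \<ominus>\<^bsub>M\<^esub> l \<in> carrier M" for n using l sM by simp
    show "\<forall>\<^sub>F n in sequentially. alg_norm N (\<phi> (s n) \<ominus>\<^bsub>N\<^esub> \<phi> l) \<le> alg_norm M (s n \<ominus>\<^bsub>M\<^esub> l)"
      unfolding eq by (intro always_eventually allI contractive mem)
    show "\<forall>\<^sub>F n in sequentially. 0 \<le> alg_norm N (\<phi> (s n) \<ominus>\<^bsub>N\<^esub> \<phi> l)"
      unfolding eq by (intro always_eventually allI N.norm_nonneg \<phi>(1) mem)
  qed
  then have "\<phi> l \<in> B" by (rule closed_star_subalg_limit[OF B \<phi>(1)[OF l] sB])
  then show "l \<in> {u \<in> carrier M. \<phi> u \<in> B}" using l by simp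
next
  interpret M: star_algebra M by fact
  note \<phi> = unital_star_homD[OF hom]
  have B': "\<one>\<^bsub>N\<^esub> \<in> B" "\<And>u v. \<lbrakk>u \<in> B; v \<in> B\<rbrakk> \<Longrightarrow> u \<oplus>\<^bsub>N\<^esub> v \<in> B" "\<And>u v. \<lbrakk>u \<in> B; v \<in> B\<rbrakk> \<Longrightarrow> u \<otimes>\<^bsub>N\<^esub> v \<in> B"
      "\<And>c u. u \<in> B \<Longrightarrow> c \<odot>\<^bsub>N\<^esub> u \<in> B" "\<And>u. u \<in> B \<Longrightarrow> alg_star N u \<in> B"
    using B by (auto simp: closed_star_subalg_def)
  show "\<one>\<^bsub>M\<^esub> \<in> {u \<in> carrier M. \<phi> u \<in> B}" by (simp add: \<phi> B')
  fix u v c assume "u \<in> {u \<in> carrier M. \<phi> u \<in> B}" "v \<in> {u \<in> carrier M. \<phi> u \<in> B}"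
  then have uv: "u \<in> carrier M" "\<phi> u \<in> B" "v \<in> carrier M" "\<phi> v \<in> B" by simp_all
  show "u \<oplus>\<^bsub>M\<^esub> v \<in> {u \<in> carrier M. \<phi> u \<in> B}" using uv by (simp add: \<phi> B')
  show "u \<otimes>\<^bsub>M\<^esub> v \<in> {u \<in> carrier M. \<phi> u \<in> B}" using uv by (simp add: \<phi> B')
next
  interpret M: star_algebra M by fact
  note \<phi> = unital_star_homD[OF hom]
  fix u c assume "u \<in> {u \<in> carrier M. \<phi> u \<in> B}"
  then have u: "u \<in> carrier M" "\<phi> u \<in> B" by simp_all
  show "c \<odot>\<^bsub>M\<^esub> u \<in> {u \<in> carrier M. \<phi> u \<in> B}" "alg_star M u \<in> {u \<in> carrier M. \<phi> u \<in> B}"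
    using u B by (auto simp: \<phi> closed_star_subalg_def)
qed auto

lemma linf_simps [simp]:
  "carrier linf = UNIV" "mult linf = (\<lambda>f g a. f a * g a)" "one linf = (\<lambda>a. 1)"
  "zero linf = (\<lambda>a. 0)" "add linf = (\<lambda>f g a. f a + g a)" "smult linf = (\<lambda>c f a. c * f a)"
  "alg_star linf = (\<lambda>f a. cnj (f a))"
  by (simp_all add: linf_def)

lemma linf_norm_ge: "cmod (f a) \<le> alg_norm linf (f :: 'a::finite \<Rightarrow> complex)"
  unfolding linf_def by (auto intro!: cSUP_upper)

lemma linf_norm_le: "(\<And>a. cmod (f a) \<le> K) \<Longrightarrow> alg_norm linf (f :: 'a::finite \<Rightarrow> complex) \<le> K"
  unfolding linf_def by (auto intro!: cSUP_least)

lemma star_algebra_linf: "star_algebra (linf :: ('a::finite \<Rightarrow> complex) star_alg)"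
proof -
  have "ring (linf :: ('a \<Rightarrow> complex) star_alg)"
  proof (rule ringI)
    show "abelian_group (linf :: ('a \<Rightarrow> complex) star_alg)"
      by (rule abelian_groupI) (auto simp: algebra_simps fun_eq_iff intro: exI[of _ "\<lambda>a. - x a" for x])
    show "Group.monoid (linf :: ('a \<Rightarrow> complex) star_alg)"
      by (rule Group.monoidI) (auto simp: algebra_simps)
  qed (auto simp: algebra_simps)
  moreover have "0 \<le> alg_norm linf f" for f :: "'a \<Rightarrow> complex"
    using order_trans[OF norm_ge_zero linf_norm_ge] .
  ultimately show ?thesis
    by (intro star_algebra.intro star_algebra_axioms.intro)
      (auto simp: algebra_simps norm_mult intro!: linf_norm_le linf_norm_ge mult_mono mult_left_mono
         order_trans[OF norm_triangle_ineq add_mono])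
qed

lemma linf_decomposition:
  "f = (\<Oplus>\<^bsub>linf\<^esub>a\<in>UNIV. f a \<odot>\<^bsub>linf\<^esub> point_mass a)" for f :: "'a::finite \<Rightarrow> complex"
proof (rule ext)
  fix b
  interpret star_algebra "linf :: ('a \<Rightarrow> complex) star_alg" by (rule star_algebra_linf)
  have "(\<Oplus>\<^bsub>linf\<^esub>a\<in>UNIV. f a \<odot>\<^bsub>linf\<^esub> point_mass a) b = (\<Sum>a\<in>UNIV. (f a \<odot>\<^bsub>linf\<^esub> point_mass a) b)"
    by (rule additive_sum[where \<phi> = "\<lambda>u. u b"]) (auto intro: abelian_monoid_axioms)
  also have "\<dots> = (\<Sum>a\<in>UNIV. if b = a then f a else 0)" by (intro sum.cong) auto
  also have "\<dots> = f b" by simp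
  finally show "f b = (\<Oplus>\<^bsub>linf\<^esub>a\<in>UNIV. f a \<odot>\<^bsub>linf\<^esub> point_mass a) b" ..
qed

text \<open>
  A unital *-homomorphism from \<open>\<ell>\<^sup>\<infinity>(A)\<close> is determined by the images of the point masses, which are
  projections that add up to the unit.
\<close>

lemma linf_hom:
  fixes \<phi> :: "('a::finite \<Rightarrow> complex) \<Rightarrow> 'c"
  assumes N: "star_algebra N" and \<phi>: "unital_star_hom linf N \<phi>"
  shows "\<phi> f \<in> carrier N"
    and "\<phi> (point_mass a) \<otimes>\<^bsub>N\<^esub> \<phi> (point_mass a) = \<phi> (point_mass a)"
    and "alg_star N (\<phi> (point_mass a)) = \<phi> (point_mass a)"
    and "\<phi> f = (\<Oplus>\<^bsub>N\<^esub>a\<in>UNIV. f a \<odot>\<^bsub>N\<^esub> \<phi> (point_mass a))"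
    and "(\<Oplus>\<^bsub>N\<^esub>a\<in>UNIV. \<phi> (point_mass a)) = \<one>\<^bsub>N\<^esub>"
proof -
  interpret N: star_algebra N by fact
  show closed: "\<phi> f \<in> carrier N" for f using unital_star_homD(1)[OF \<phi>] by simp
  show "\<phi> (point_mass a) \<otimes>\<^bsub>N\<^esub> \<phi> (point_mass a) = \<phi> (point_mass a)"
    by (subst unital_star_homD(4)[OF \<phi>, symmetric]) (auto intro!: arg_cong[where f = \<phi>])
  show "alg_star N (\<phi> (point_mass a)) = \<phi> (point_mass a)"
    by (subst unital_star_homD(6)[OF \<phi>, symmetric]) (auto intro!: arg_cong[where f = \<phi>])
  show dec: "\<phi> f = (\<Oplus>\<^bsub>N\<^esub>a\<in>UNIV. f a \<odot>\<^bsub>N\<^esub> \<phi> (point_mass a))" for f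
  proof -
    have "\<phi> f = \<phi> (\<Oplus>\<^bsub>linf\<^esub>a\<in>UNIV. f a \<odot>\<^bsub>linf\<^esub> point_mass a)"
      by (rule arg_cong[OF linf_decomposition])
    also have "\<dots> = (\<Oplus>\<^bsub>N\<^esub>a\<in>UNIV. \<phi> (f a \<odot>\<^bsub>linf\<^esub> point_mass a))"
      by (rule unital_star_hom_finsum[OF star_algebra_linf N \<phi>]) auto
    finally have "\<phi> f = (\<Oplus>\<^bsub>N\<^esub>a\<in>UNIV. \<phi> (f a \<odot>\<^bsub>linf\<^esub> point_mass a))" .
    then show ?thesis using unital_star_homD(5)[OF \<phi>] by simp
  qed
  have "\<phi> (\<lambda>a. 1) = \<one>\<^bsub>N\<^esub>" using unital_star_homD(2)[OF \<phi>] by simp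
  then show "(\<Oplus>\<^bsub>N\<^esub>a\<in>UNIV. \<phi> (point_mass a)) = \<one>\<^bsub>N\<^esub>"
    using dec[of "\<lambda>a. 1"] by (simp add: N.scale_one closed)
qed

lemma (in star_algebra) norm_finsum:
  assumes "finite A" "\<And>i. i \<in> A \<Longrightarrow> f i \<in> carrier M"
  shows "alg_norm M (\<Oplus>i\<in>A. f i) \<le> (\<Sum>i\<in>A. alg_norm M (f i))"
  using assms
proof (induction A)
  case empty
  then show ?case using norm_scale[of \<zero> 0] by (simp add: scale_zero)
next
  case (insert i A)
  have "alg_norm M (f i \<oplus> (\<Oplus>i\<in>A. f i)) \<le> alg_norm M (f i) + alg_norm M (\<Oplus>i\<in>A. f i)"
    using insert.prems by (intro norm_add finsum_closed) auto
  then show ?case using insert by (simp add: finsum_insert Pi_iff)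
qed

lemma (in hilbert_space) projection_norm:
  assumes P: "bounded_op H P" "P \<otimes>\<^bsub>op_alg H\<^esub> P = P" "alg_star (op_alg H) P = P"
  shows "alg_norm (op_alg H) P \<le> 1"
proof (rule op_norm_le)
  fix v assume v: "v \<in> carrier H"
  show "snorm (P v) \<le> 1 * snorm v"
    unfolding mult_1_left
  proof (rule symmetric_idempotent_contractive[OF _ _ _ v])
    fix u assume u: "u \<in> carrier H"
    then show "P u \<in> carrier H" by (rule bounded_op_closed[OF P(1)])
    show "P (P u) = P u" using op_alg_apply(1)[OF u, of P P] P(2) by simp
    fix w assume "w \<in> carrier H"
    then show "hinner H (P u) w = hinner H u (P w)" using hinner_star[OF P(1) u] P(3) by simp
  qed
qed simp

abbreviation rep_prod :: "('x \<Rightarrow> 'c star_alg) \<Rightarrow> ('x, 'c, 'h) free_elem star_alg" where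
  "rep_prod M \<equiv> prod_alg (representations M) (\<lambda>(H, \<pi>). op_alg H)"

lemma representationsD:
  assumes "(H, \<pi>) \<in> representations M"
  shows "hilbert_space H" "unital_star_hom (M x) (op_alg H) (\<pi> x)" "star_algebra (op_alg H)"
  using assms hilbert_space.star_algebra_op_alg by (auto simp: representations_def)

lemma star_algebra_rep_prod: "star_algebra (rep_prod M)"
  by (rule star_algebra_prod_alg) (auto dest: representationsD(3))

lemma rep_prod_apply [simp]:
  assumes "(H, \<pi>) \<in> representations M"
  shows "(F \<otimes>\<^bsub>rep_prod M\<^esub> G) (H, \<pi>) = F (H, \<pi>) \<otimes>\<^bsub>op_alg H\<^esub> G (H, \<pi>)"
    "\<one>\<^bsub>rep_prod M\<^esub> (H, \<pi>) = \<one>\<^bsub>op_alg H\<^esub>"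
    "(F \<oplus>\<^bsub>rep_prod M\<^esub> G) (H, \<pi>) = F (H, \<pi>) \<oplus>\<^bsub>op_alg H\<^esub> G (H, \<pi>)"
    "(c \<odot>\<^bsub>rep_prod M\<^esub> F) (H, \<pi>) = c \<odot>\<^bsub>op_alg H\<^esub> F (H, \<pi>)"
    "alg_star (rep_prod M) F (H, \<pi>) = alg_star (op_alg H) (F (H, \<pi>))"
  using assms by simp_all

lemma rep_ext:
  assumes "F \<in> extensional (representations M)" "G \<in> extensional (representations M)"
    and "\<And>H \<pi>. (H, \<pi>) \<in> representations M \<Longrightarrow> F (H, \<pi>) = G (H, \<pi>)"
  shows "F = G"
  by (rule extensionalityI[OF assms(1,2)]) (use assms(3) in auto)

lemma free_incl_extensional: "free_incl M x z \<in> extensional (representations M)"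
  unfolding free_incl_def by (rule restrict_extensional)

lemma free_incl_apply [simp]:
  "(H, \<pi>) \<in> representations M \<Longrightarrow> free_incl M x z (H, \<pi>) = \<pi> x z"
  by (simp add: free_incl_def)

text \<open>
  An element of the product needs a norm bound that is uniform in the representation. As \<open>\<pi>(f)\<close> is
  the combination of projections with coefficients \<open>f(a)\<close>, the sum of all \<open>|f(a)|\<close> is one.
\<close>

lemma free_incl_closed:
  fixes x :: 'x and f :: "'a::finite \<Rightarrow> complex"
  shows "free_incl (\<lambda>_. linf) x f \<in> carrier (rep_prod (\<lambda>_. linf) :: ('x, 'a \<Rightarrow> complex, 'h) free_elem star_alg)"
proof (rule prod_carrierI)
  show "free_incl (\<lambda>_. linf) x f \<in> extensional (representations (\<lambda>_. linf))"
    by (simp add: free_incl_def)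
  fix i :: "'h hilbert \<times> ('x \<Rightarrow> ('a \<Rightarrow> complex) \<Rightarrow> 'h \<Rightarrow> 'h)"
  assume i: "i \<in> representations (\<lambda>_. linf)"
  obtain H \<pi> where [simp]: "i = (H, \<pi>)" by (cases i)
  have r: "(H, \<pi>) \<in> representations (\<lambda>_. linf)" using i by simp
  interpret hilbert_space H using r by (rule representationsD)
  interpret op: star_algebra "op_alg H" using r by (rule representationsD)
  note hom = linf_hom[OF op.star_algebra_axioms representationsD(2)[OF r, of x]]
  show "free_incl (\<lambda>_. linf) x f i \<in> carrier (case i of (H, \<pi>) \<Rightarrow> op_alg H)"
    using hom(1) r by simp
  have "alg_norm (op_alg H) (\<pi> x f) \<le> (\<Sum>a\<in>UNIV. alg_norm (op_alg H) (f a \<odot>\<^bsub>op_alg H\<^esub> \<pi> x (point_mass a)))"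
    using op.norm_finsum[of UNIV "\<lambda>a. f a \<odot>\<^bsub>op_alg H\<^esub> \<pi> x (point_mass a)"] hom(1)
    by (subst hom(4)) (simp add: op.scale_closed del: op_alg_simps)
  also have "\<dots> \<le> (\<Sum>a\<in>UNIV. cmod (f a))"
  proof (rule sum_mono)
    fix a
    have "bounded_op H (\<pi> x (point_mass a))" using hom(1)[of "point_mass a"] by simp
    then have "alg_norm (op_alg H) (\<pi> x (point_mass a)) \<le> 1"
      using hom(2,3) by (rule projection_norm)
    then show "alg_norm (op_alg H) (f a \<odot>\<^bsub>op_alg H\<^esub> \<pi> x (point_mass a)) \<le> cmod (f a)"
      using order_trans[OF op.norm_scale[OF hom(1), of "f a" "point_mass a"] mult_left_mono[of _ 1 "cmod (f a)"]]
      by simp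
  qed
  finally show "alg_norm (case i of (H, \<pi>) \<Rightarrow> op_alg H) (free_incl (\<lambda>_. linf) x f i) \<le> (\<Sum>a\<in>UNIV. cmod (f a))"
    using r by simp
qed

lemma generators_closed:
  "(\<Union>x. free_incl (\<lambda>_. linf) x ` carrier linf) \<subseteq> carrier (rep_prod (\<lambda>_::'x. linf :: ('a::finite \<Rightarrow> complex) star_alg))"
  using free_incl_closed by auto

lemma game_alg_eq: "game_alg = generated_alg (rep_prod (\<lambda>_. linf)) (\<Union>x. free_incl (\<lambda>_. linf) x ` carrier linf)"
  by (simp add: game_alg_def free_product_def)

lemma game_alg_ops [simp]:
  "mult game_alg = mult (rep_prod (\<lambda>_. linf))" "one game_alg = one (rep_prod (\<lambda>_. linf))"
  "zero game_alg = zero (rep_prod (\<lambda>_. linf))" "add game_alg = add (rep_prod (\<lambda>_. linf))"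
  "smult game_alg = smult (rep_prod (\<lambda>_. linf))" "alg_star game_alg = alg_star (rep_prod (\<lambda>_. linf))"
  by (simp_all add: game_alg_eq)

interpretation game: star_algebra "game_alg :: ('x::finite, 'a::finite, 'h) game_elem star_alg"
  unfolding game_alg_eq by (rule star_algebra_generated[OF star_algebra_rep_prod generators_closed])

lemma closed_star_subalg_game:
  "closed_star_subalg (rep_prod (\<lambda>_. linf)) (carrier (game_alg :: ('x::finite, 'a::finite, 'h) game_elem star_alg))"
  unfolding game_alg_eq
  by (rule star_algebra.closed_star_subalg_generated[OF star_algebra_rep_prod generators_closed])

lemma game_carrier: "F \<in> carrier game_alg \<Longrightarrow> F \<in> carrier (rep_prod (\<lambda>_. linf))"
  using closed_star_subalg_game by (auto simp: closed_star_subalg_def)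

lemma game_carrier_apply:
  "\<lbrakk>F \<in> carrier game_alg; (H, \<pi>) \<in> representations (\<lambda>_. linf)\<rbrakk> \<Longrightarrow> bounded_op H (F (H, \<pi>))"
  using prod_carrierD[OF game_carrier] by fastforce

lemma game_alg_least:
  assumes "closed_star_subalg (rep_prod (\<lambda>_. linf)) B" "\<And>x f. free_incl (\<lambda>_. linf) x f \<in> B"
  shows "carrier game_alg \<subseteq> B"
  unfolding game_alg_eq by (rule generated_least) (use assms in auto)

lemma game_ext:
  assumes "F \<in> carrier game_alg" "G \<in> carrier game_alg"
    and "\<And>H \<pi>. (H, \<pi>) \<in> representations (\<lambda>_. linf) \<Longrightarrow> F (H, \<pi>) = G (H, \<pi>)"
  shows "F = G"
  by (rule prod_ext[OF game_carrier[OF assms(1)] game_carrier[OF assms(2)]]) (use assms(3) in auto)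

lemma free_incl_hom:
  "unital_star_hom linf (game_alg :: ('x::finite, 'a::finite, 'h) game_elem star_alg) (free_incl (\<lambda>_. linf) x)"
proof -
  have mem: "free_incl (\<lambda>_. linf) x f \<in> carrier (game_alg :: ('x, 'a, 'h) game_elem star_alg)" for f
    unfolding game_alg_eq by (rule subsetD[OF generated_superset]) auto
  note closed = mem game.one_closed game.a_closed game.m_closed game.scale_closed game.star_closed
  show ?thesis
    unfolding unital_star_hom_def
  proof (intro conjI ballI allI funcsetI mem; (rule game_ext; (intro mem closed)?)?)
    fix f g :: "'a \<Rightarrow> complex" and c
      and H and \<pi> :: "'x \<Rightarrow> ('a \<Rightarrow> complex) \<Rightarrow> 'h \<Rightarrow> 'h"
    assume r: "(H, \<pi>) \<in> representations (\<lambda>_. linf)"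
    note hom = unital_star_homD[OF representationsD(2)[OF r, of x]]
    show "free_incl (\<lambda>_. linf) x \<one>\<^bsub>linf\<^esub> (H, \<pi>) = \<one>\<^bsub>game_alg\<^esub> (H, \<pi>)"
      using r hom(2) by (simp del: op_alg_simps linf_simps)
    show "free_incl (\<lambda>_. linf) x (f \<oplus>\<^bsub>linf\<^esub> g) (H, \<pi>)
        = (free_incl (\<lambda>_. linf) x f \<oplus>\<^bsub>game_alg\<^esub> free_incl (\<lambda>_. linf) x g) (H, \<pi>)"
      using r hom(3)[of f g] by (simp del: linf_simps(2-))
    show "free_incl (\<lambda>_. linf) x (f \<otimes>\<^bsub>linf\<^esub> g) (H, \<pi>)
        = (free_incl (\<lambda>_. linf) x f \<otimes>\<^bsub>game_alg\<^esub> free_incl (\<lambda>_. linf) x g) (H, \<pi>)"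
      using r hom(4)[of f g] by (simp del: linf_simps(2-))
    show "free_incl (\<lambda>_. linf) x (c \<odot>\<^bsub>linf\<^esub> f) (H, \<pi>)
        = (c \<odot>\<^bsub>game_alg\<^esub> free_incl (\<lambda>_. linf) x f) (H, \<pi>)"
      using r hom(5)[of f c] by (simp del: linf_simps(2-))
    show "free_incl (\<lambda>_. linf) x (alg_star linf f) (H, \<pi>)
        = alg_star game_alg (free_incl (\<lambda>_. linf) x f) (H, \<pi>)"
      using r hom(6)[of f] by (simp del: linf_simps(2-))
  qed
qed

lemma gen_eq: "gen x a = free_incl (\<lambda>_. linf) x (point_mass a)"
  by (simp add: gen_def)

lemmas free_incl_mem [simp] = linf_hom(1)[OF game.star_algebra_axioms free_incl_hom]

lemma gen_mem [simp]: "gen x a \<in> carrier game_alg"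
  by (simp add: gen_eq)

lemma gen_idem: "gen x a \<otimes>\<^bsub>game_alg\<^esub> gen x a = gen x a"
  unfolding gen_eq by (rule linf_hom(2)[OF game.star_algebra_axioms free_incl_hom])

lemma gen_star: "alg_star game_alg (gen x a) = gen x a"
  unfolding gen_eq by (rule linf_hom(3)[OF game.star_algebra_axioms free_incl_hom])

lemma free_incl_gen: "free_incl (\<lambda>_. linf) x f = (\<Oplus>\<^bsub>game_alg\<^esub>a\<in>UNIV. f a \<odot>\<^bsub>game_alg\<^esub> gen x a)"
  unfolding gen_eq by (rule linf_hom(4)[OF game.star_algebra_axioms free_incl_hom])

lemma gen_sum: "(\<Oplus>\<^bsub>game_alg\<^esub>a\<in>UNIV. gen x a) = \<one>\<^bsub>game_alg\<^esub>"
  unfolding gen_eq by (rule linf_hom(5)[OF game.star_algebra_axioms free_incl_hom])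

section \<open>Linear spans\<close>

context star_algebra
begin

lemma finsum_subspace:
  assumes "\<zero> \<in> B" "\<And>u v. \<lbrakk>u \<in> B; v \<in> B\<rbrakk> \<Longrightarrow> u \<oplus> v \<in> B" "B \<subseteq> carrier M"
    and "finite A" "\<And>i. i \<in> A \<Longrightarrow> f i \<in> B"
  shows "(\<Oplus>i\<in>A. f i) \<in> B"
  using assms(4,5)
proof (induction A)
  case (insert i A)
  then have "finsum M f (insert i A) = f i \<oplus> finsum M f A"
    using assms(3) by (intro finsum_insert) auto
  then show ?case using insert assms(2) by simp
qed (simp add: assms(1))

lemma linear_span_closed: "S \<subseteq> carrier M \<Longrightarrow> linear_span M S \<subseteq> carrier M"
  unfolding linear_span_def by (auto intro!: finsum_closed simp: subset_iff)

lemma linear_span_least: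
  assumes "\<zero> \<in> B" "\<And>u v. \<lbrakk>u \<in> B; v \<in> B\<rbrakk> \<Longrightarrow> u \<oplus> v \<in> B" "\<And>c u. u \<in> B \<Longrightarrow> c \<odot> u \<in> B"
    and "B \<subseteq> carrier M" "S \<subseteq> B"
  shows "linear_span M S \<subseteq> B"
  unfolding linear_span_def using assms by (auto intro!: finsum_subspace simp: subset_iff)

text \<open>
  A combination of a subset of \<open>S\<close> is extended by zero coefficients. Sums over the fixed index set \<open>S\<close>
  can then be added termwise.
\<close>

lemma linear_span_finite:
  assumes S: "finite S" "S \<subseteq> carrier M"
  shows "linear_span M S = {\<Oplus>s\<in>S. c s \<odot> s | c. True}"
proof -
  have extend: "(\<Oplus>s\<in>F. c s \<odot> s) = (\<Oplus>s\<in>S. (if s \<in> F then c s else 0) \<odot> s)"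
    if F: "F \<subseteq> S" for F c
  proof (rule add.finprod_mono_neutral_cong_left[OF S(1) F])
    fix s assume "s \<in> S - F"
    then show "(if s \<in> F then c s else 0) \<odot> s = \<zero>" using S(2) scale_zero by auto
  next
    show "(\<lambda>s. (if s \<in> F then c s else 0) \<odot> s) \<in> S \<rightarrow> carrier M" using S(2) by auto
  qed simp
  show ?thesis
  proof
    show "linear_span M S \<subseteq> {\<Oplus>s\<in>S. c s \<odot> s | c. True}"
    proof
      fix u assume "u \<in> linear_span M S"
      then obtain F c where F: "F \<subseteq> S" and u: "u = (\<Oplus>s\<in>F. c s \<odot> s)"
        unfolding linear_span_def by auto
      show "u \<in> {\<Oplus>s\<in>S. c s \<odot> s | c. True}"
        unfolding u extend[OF F] by (intro CollectI exI[of _ "\<lambda>s. if s \<in> F then c s else 0"]) simp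
    qed
    show "{\<Oplus>s\<in>S. c s \<odot> s | c. True} \<subseteq> linear_span M S"
      using S(1) unfolding linear_span_def by auto
  qed
qed

lemma linear_span_base:
  assumes "s \<in> S" "S \<subseteq> carrier M"
  shows "s \<in> linear_span M S"
proof -
  have "s = (\<Oplus>t\<in>{s}. (\<lambda>_. 1) t \<odot> t)" using assms by (subst finsum_insert) auto
  then show ?thesis
    using assms(1) unfolding linear_span_def by (intro CollectI exI[of _ "{s}"] exI[of _ "\<lambda>_. 1"]) simp
qed

lemma linear_span_mem:
  "finite S \<Longrightarrow> (\<Oplus>s\<in>S. c s \<odot> s) \<in> linear_span M S"
  unfolding linear_span_def by (intro CollectI exI[of _ S] exI[of _ c]) simp

lemma
  assumes S: "finite S" "S \<subseteq> carrier M"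
  shows linear_span_zero: "\<zero> \<in> linear_span M S"
    and linear_span_add: "\<lbrakk>u \<in> linear_span M S; v \<in> linear_span M S\<rbrakk> \<Longrightarrow> u \<oplus> v \<in> linear_span M S"
    and linear_span_scale: "u \<in> linear_span M S \<Longrightarrow> c \<odot> u \<in> linear_span M S"
proof -
  show "\<zero> \<in> linear_span M S"
    unfolding linear_span_def by (intro CollectI exI[of _ "{}"]) simp
next
  assume "u \<in> linear_span M S" "v \<in> linear_span M S"
  then obtain c d where "u = (\<Oplus>s\<in>S. c s \<odot> s)" "v = (\<Oplus>s\<in>S. d s \<odot> s)"
    unfolding linear_span_finite[OF S] by blast
  moreover have "(\<Oplus>s\<in>S. (c s + d s) \<odot> s) = (\<Oplus>s\<in>S. c s \<odot> s \<oplus> d s \<odot> s)"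
    using S(2) by (intro finsum_cong') (auto simp: scale_add_left subset_iff)
  ultimately have "u \<oplus> v = (\<Oplus>s\<in>S. (c s + d s) \<odot> s)"
    using S(2) by (simp add: finsum_addf Pi_iff subset_iff)
  then show "u \<oplus> v \<in> linear_span M S" using linear_span_mem[OF S(1), of "\<lambda>s. c s + d s"] by simp
next
  assume "u \<in> linear_span M S"
  then obtain d where u: "u = (\<Oplus>s\<in>S. d s \<odot> s)"
    unfolding linear_span_finite[OF S] by blast
  interpret mod: Module.module complex_field M by (rule module)
  have "c \<odot> u = (\<Oplus>s\<in>S. c \<odot> (d s \<odot> s))"
    using S unfolding u by (intro mod.finsum_smult_ldistr) auto
  also have "\<dots> = (\<Oplus>s\<in>S. (c * d s) \<odot> s)"
    using S(2) by (intro finsum_cong') (auto simp: scale_scale subset_iff)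
  finally show "c \<odot> u \<in> linear_span M S" using linear_span_mem[OF S(1), of "\<lambda>s. c * d s"] by simp
qed

end

section \<open>Pulling back representations\<close>

text \<open>
  The representation whose \<open>y\<close>-th part is the \<open>\<eta>(y)\<close>-th part of \<open>\<pi>\<close> composed with the homomorphism
  \<open>f \<mapsto> f \<circ> g\<^sub>y\<close> from \<open>\<ell>\<^sup>\<infinity>(B)\<close> to \<open>\<ell>\<^sup>\<infinity>(A)\<close>.
\<close>

definition pull_rep :: "('y \<Rightarrow> 'x) \<Rightarrow> ('y \<Rightarrow> 'a \<Rightarrow> 'b) \<Rightarrow> ('x \<Rightarrow> ('a \<Rightarrow> complex) \<Rightarrow> 'h \<Rightarrow> 'h)
    \<Rightarrow> 'y \<Rightarrow> ('b \<Rightarrow> complex) \<Rightarrow> 'h \<Rightarrow> 'h" where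
  "pull_rep \<eta> g \<pi> = (\<lambda>y f. \<pi> (\<eta> y) (\<lambda>a. f (g y a)))"

text \<open>
  Elements of a free product are functions on the representations of its factors. Hence the
  homomorphism that the universal property attaches to the maps \<open>f \<mapsto> f \<circ> g\<^sub>y\<close> from the \<open>y\<close>-th factor
  into the \<open>\<eta>(y)\<close>-th one is composition with \<open>pull_rep\<close>.
\<close>

definition pull_hom :: "('y \<Rightarrow> 'x) \<Rightarrow> ('y \<Rightarrow> 'a::finite \<Rightarrow> 'b::finite) \<Rightarrow>
    ('y, 'b, 'h) game_elem \<Rightarrow> ('x, 'a, 'h) game_elem" where
  "pull_hom \<eta> g F = (\<lambda>(H, \<pi>)\<in>representations (\<lambda>_. linf). F (H, pull_rep \<eta> g \<pi>))"

lemma pull_rep: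
  fixes \<eta> :: "'y \<Rightarrow> 'x" and g :: "'y \<Rightarrow> 'a::finite \<Rightarrow> 'b::finite"
  assumes "(H, \<pi>) \<in> representations (\<lambda>_. linf)"
  shows "(H, pull_rep \<eta> g \<pi>) \<in> representations (\<lambda>_. linf)"
proof -
  have "unital_star_hom linf (op_alg H) (pull_rep \<eta> g \<pi> y)" for y
  proof -
    have "unital_star_hom linf linf (\<lambda>f a. f (g y a))"
      by (simp add: unital_star_hom_def)
    from unital_star_hom_comp[OF this representationsD(2)[OF assms]]
    show ?thesis by (simp add: pull_rep_def)
  qed
  then show ?thesis using representationsD(1)[OF assms] by (simp add: representations_def)
qed

lemma pull_hom_extensional: "pull_hom \<eta> g F \<in> extensional (representations (\<lambda>_. linf))"
  unfolding pull_hom_def by (rule restrict_extensional)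

lemma pull_hom_apply [simp]:
  "(H, \<pi>) \<in> representations (\<lambda>_. linf) \<Longrightarrow> pull_hom \<eta> g F (H, \<pi>) = F (H, pull_rep \<eta> g \<pi>)"
  by (simp add: pull_hom_def)

lemma pull_hom_prod:
  assumes F: "F \<in> carrier (rep_prod (\<lambda>_. linf))"
  shows "pull_hom \<eta> g F \<in> carrier (rep_prod (\<lambda>_. linf))"
    and "alg_norm (rep_prod (\<lambda>_. linf)) (pull_hom \<eta> g F) \<le> alg_norm (rep_prod (\<lambda>_. linf)) F"
proof -
  have norm: "alg_norm (case i of (H, \<pi>) \<Rightarrow> op_alg H) (pull_hom \<eta> g F i) \<le> alg_norm (rep_prod (\<lambda>_. linf)) F"
    and mem: "pull_hom \<eta> g F i \<in> carrier (case i of (H, \<pi>) \<Rightarrow> op_alg H)"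
    if i: "i \<in> representations (\<lambda>_. linf)" for i
  proof -
    obtain H \<pi> where [simp]: "i = (H, \<pi>)" by (cases i)
    have r: "(H, \<pi>) \<in> representations (\<lambda>_. linf)" using i by simp
    show "alg_norm (case i of (H, \<pi>) \<Rightarrow> op_alg H) (pull_hom \<eta> g F i) \<le> alg_norm (rep_prod (\<lambda>_. linf)) F"
      using prod_norm_ge[OF F pull_rep[OF r, of \<eta> g]] r by simp
    show "pull_hom \<eta> g F i \<in> carrier (case i of (H, \<pi>) \<Rightarrow> op_alg H)"
      using prod_carrierD[OF F pull_rep[OF r, of \<eta> g]] r by simp
  qed
  show "pull_hom \<eta> g F \<in> carrier (rep_prod (\<lambda>_. linf))"
    by (rule prod_carrierI[OF pull_hom_extensional mem norm])
  show "alg_norm (rep_prod (\<lambda>_. linf)) (pull_hom \<eta> g F) \<le> alg_norm (rep_prod (\<lambda>_. linf)) F"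
    by (rule prod_norm_le[OF norm prod_norm_nonneg[OF F]])
qed

lemma pull_rep_apply: "pull_rep \<eta> g \<pi> y f = \<pi> (\<eta> y) (\<lambda>a. f (g y a))"
  by (simp add: pull_rep_def)

lemma pull_hom_free_incl:
  "pull_hom \<eta> g (free_incl (\<lambda>_. linf) y f) = free_incl (\<lambda>_. linf) (\<eta> y) (\<lambda>a. f (g y a))"
  by (rule rep_ext[where M = "\<lambda>_. linf"])
    (simp_all add: pull_rep pull_rep_apply pull_hom_extensional free_incl_extensional)

lemma pull_hom_ops:
  "pull_hom \<eta> g \<one>\<^bsub>rep_prod (\<lambda>_. linf)\<^esub> = \<one>\<^bsub>rep_prod (\<lambda>_. linf)\<^esub>"
  "pull_hom \<eta> g (F \<oplus>\<^bsub>rep_prod (\<lambda>_. linf)\<^esub> G) = pull_hom \<eta> g F \<oplus>\<^bsub>rep_prod (\<lambda>_. linf)\<^esub> pull_hom \<eta> g G"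
  "pull_hom \<eta> g (F \<otimes>\<^bsub>rep_prod (\<lambda>_. linf)\<^esub> G) = pull_hom \<eta> g F \<otimes>\<^bsub>rep_prod (\<lambda>_. linf)\<^esub> pull_hom \<eta> g G"
  "pull_hom \<eta> g (c \<odot>\<^bsub>rep_prod (\<lambda>_. linf)\<^esub> F) = c \<odot>\<^bsub>rep_prod (\<lambda>_. linf)\<^esub> pull_hom \<eta> g F"
  "pull_hom \<eta> g (alg_star (rep_prod (\<lambda>_. linf)) F) = alg_star (rep_prod (\<lambda>_. linf)) (pull_hom \<eta> g F)"
  by - (rule rep_ext[where M = "\<lambda>_. linf"]; simp add: pull_rep pull_hom_extensional del: op_alg_simps)+

text \<open>
  On the full product the pull-back is a contractive *-homomorphism, because the operations are
  defined representation by representation. It maps generators to generators, so the preimage of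
  \<open>\<A>(X,A)\<close> is a closed *-subalgebra that contains \<open>\<A>(Y,B)\<close>.
\<close>

theorem pull_hom_star_hom:
  "unital_star_hom game_alg game_alg (pull_hom \<eta> g :: ('y::finite, 'b::finite, 'h) game_elem \<Rightarrow> ('x::finite, 'a::finite, 'h) game_elem)"
proof -
  let ?Y = "rep_prod (\<lambda>_. linf) :: ('y, 'b, 'h) game_elem star_alg"
  let ?X = "rep_prod (\<lambda>_. linf) :: ('x, 'a, 'h) game_elem star_alg"
  let ?B = "{F \<in> carrier ?Y. pull_hom \<eta> g F \<in> carrier (game_alg :: ('x, 'a, 'h) game_elem star_alg)}"
  have "unital_star_hom ?Y ?X (pull_hom \<eta> g)"
    unfolding unital_star_hom_def by (auto simp: pull_hom_ops pull_hom_prod)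
  then have "closed_star_subalg ?Y ?B"
    using star_algebra_rep_prod star_algebra_rep_prod closed_star_subalg_game
    by (intro closed_star_subalg_vimage) (auto simp: pull_hom_prod)
  then have "carrier game_alg \<subseteq> ?B"
    by (rule game_alg_least) (simp add: pull_hom_free_incl free_incl_closed)
  then show ?thesis
    unfolding unital_star_hom_def by (auto simp: pull_hom_ops)
qed

lemma gen_set:
  "finite {gen x a :: ('x::finite, 'a::finite, 'h) game_elem | x a. True}"
  "{gen x a :: ('x::finite, 'a::finite, 'h) game_elem | x a. True} \<subseteq> carrier game_alg"
proof -
  have "{gen x a :: ('x, 'a, 'h) game_elem | x a. True} = (\<lambda>(x, a). gen x a) ` UNIV" by auto
  then show "finite {gen x a :: ('x, 'a, 'h) game_elem | x a. True}" by simp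
qed auto

lemma gen_span_subspace:
  "\<zero>\<^bsub>game_alg\<^esub> \<in> gen_span" "\<lbrakk>u \<in> gen_span; v \<in> gen_span\<rbrakk> \<Longrightarrow> u \<oplus>\<^bsub>game_alg\<^esub> v \<in> gen_span"
  "u \<in> gen_span \<Longrightarrow> c \<odot>\<^bsub>game_alg\<^esub> u \<in> gen_span" "gen_span \<subseteq> carrier game_alg" "gen x a \<in> gen_span"
  unfolding gen_span_def
  by (rule game.linear_span_zero[OF gen_set] game.linear_span_add[OF gen_set]
      game.linear_span_scale[OF gen_set] game.linear_span_closed[OF gen_set(2)]
      game.linear_span_base[OF _ gen_set(2)]; blast)+

lemma pull_hom_gen:
  "pull_hom \<eta> g (gen y b) = (\<Oplus>\<^bsub>game_alg\<^esub>a\<in>UNIV. (if g y a = b then 1 else 0) \<odot>\<^bsub>game_alg\<^esub> gen (\<eta> y) a)"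
  unfolding gen_eq[of y b] pull_hom_free_incl by (rule free_incl_gen)

theorem pull_hom_gen_span:
  "pull_hom \<eta> g ` (gen_span :: ('y::finite, 'b::finite, 'h) game_elem set)
    \<subseteq> (gen_span :: ('x::finite, 'a::finite, 'h) game_elem set)"
proof -
  note span = gen_span_subspace
  have base: "pull_hom \<eta> g (gen y b) \<in> (gen_span :: ('x, 'a, 'h) game_elem set)" for y b
    unfolding pull_hom_gen by (intro game.finsum_subspace[OF span(1,2,4)] span(3,5)) auto
  show ?thesis
  proof (rule image_subsetI)
    fix u :: "('y, 'b, 'h) game_elem" assume "u \<in> gen_span"
    then obtain F c where F: "finite F" "F \<subseteq> {gen y b | y b. True}"
        and u: "u = (\<Oplus>\<^bsub>game_alg\<^esub>s\<in>F. c s \<odot>\<^bsub>game_alg\<^esub> s)"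
      unfolding gen_span_def linear_span_def by auto
    have FM: "s \<in> carrier game_alg" if "s \<in> F" for s using that F(2) by auto
    note hom = pull_hom_star_hom[of \<eta> g]
    have "pull_hom \<eta> g u = (\<Oplus>\<^bsub>game_alg\<^esub>s\<in>F. pull_hom \<eta> g (c s \<odot>\<^bsub>game_alg\<^esub> s))"
      unfolding u by (rule unital_star_hom_finsum[OF game.star_algebra_axioms game.star_algebra_axioms hom F(1)])
        (use FM game.scale_closed in blast)
    also have "\<dots> \<in> gen_span"
    proof -
      have "pull_hom \<eta> g (c s \<odot>\<^bsub>game_alg\<^esub> s) \<in> (gen_span :: ('x, 'a, 'h) game_elem set)" if s: "s \<in> F" for s
        unfolding unital_star_homD(5)[OF hom FM[OF s]]
        using F(2) s base span(3) by blast
      then show ?thesis by (intro game.finsum_subspace[OF span(1,2,4) F(1)])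
    qed
    finally show "pull_hom \<eta> g u \<in> gen_span" .
  qed
qed

section \<open>Projection-valued measures\<close>

context hilbert_space
begin

lemma op_sum_apply:
  assumes "finite A" "\<And>a. a \<in> A \<Longrightarrow> bounded_op H (T a)" "v \<in> carrier H"
  shows "(\<Oplus>\<^bsub>op_alg H\<^esub>a\<in>A. T a) v = (\<Oplus>a\<in>A. T a v)"
proof -
  interpret op: star_algebra "op_alg H" by (rule star_algebra_op_alg)
  show ?thesis
    using assms
    by (intro additive_finsum[where \<phi> = "\<lambda>T. T v"] op.abelian_monoid_axioms M.abelian_monoid_axioms)
      (auto simp: bounded_op_closed)
qed

lemma hinner_finsum:
  assumes "finite A" "\<And>a. a \<in> A \<Longrightarrow> f a \<in> carrier H" "u \<in> carrier H"
  shows "hinner H u (\<Oplus>a\<in>A. f a) = (\<Sum>a\<in>A. hinner H u (f a))"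
  using assms by (intro additive_sum M.abelian_monoid_axioms) (auto simp: form_simps)

lemma bounded_op_finsum:
  assumes "bounded_op H T" "finite A" "\<And>a. a \<in> A \<Longrightarrow> f a \<in> carrier H"
  shows "T (\<Oplus>a\<in>A. f a) = (\<Oplus>a\<in>A. T (f a))"
proof -
  have "T \<zero> = \<zero>"
    using bounded_op_scale[OF assms(1) M.zero_closed, of 0] bounded_op_closed[OF assms(1) M.zero_closed]
    by (metis M.zero_closed complex_field_simps(4) smult_l_null)
  then show ?thesis
    using assms by (intro additive_finsum M.abelian_monoid_axioms) (auto simp: bounded_op_closed bounded_op_add)
qed

text \<open>
  The abstract conditions are read off at vectors. From left to right this uses that adjoints
  exist, from right to left that they are unique.
\<close>

lemma pvm_iff:
  fixes P :: "'a::finite \<Rightarrow> 'h \<Rightarrow> 'h"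
  shows "pvm H P \<longleftrightarrow> (\<forall>a. bounded_op H (P a)) \<and> (\<forall>a. \<forall>v\<in>carrier H. P a (P a v) = P a v) \<and>
    (\<forall>a. \<forall>u\<in>carrier H. \<forall>v\<in>carrier H. hinner H (P a u) v = hinner H u (P a v)) \<and>
    (\<forall>v\<in>carrier H. (\<Oplus>a\<in>UNIV. P a v) = v)" (is "_ \<longleftrightarrow> ?R")
proof
  assume pvm: "pvm H P"
  then have b: "bounded_op H (P a)" and idem: "P a \<otimes>\<^bsub>op_alg H\<^esub> P a = P a"
    and star: "alg_star (op_alg H) (P a) = P a" for a
    by (auto simp: pvm_def)
  have sum: "(\<Oplus>\<^bsub>op_alg H\<^esub>a\<in>UNIV. P a) = \<one>\<^bsub>op_alg H\<^esub>" using pvm by (simp add: pvm_def)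
  show ?R
  proof (intro conjI allI ballI b)
    fix a v assume v: "v \<in> carrier H"
    show "P a (P a v) = P a v" using op_alg_apply(1)[OF v, of "P a" "P a"] idem by simp
    show "(\<Oplus>a\<in>UNIV. P a v) = v" using op_sum_apply[of UNIV P v] b v sum by simp
    fix u assume "u \<in> carrier H"
    then show "hinner H (P a u) v = hinner H u (P a v)" using hinner_star[OF b _ v, of u a] star by simp
  qed
next
  assume R: ?R
  then have b: "bounded_op H (P a)" for a by simp
  interpret op: star_algebra "op_alg H" by (rule star_algebra_op_alg)
  show "pvm H P"
    unfolding pvm_def
  proof (intro conjI allI)
    fix a
    show "P a \<in> carrier (op_alg H)" using b by simp
    show "P a \<otimes>\<^bsub>op_alg H\<^esub> P a = P a"
      by (rule bounded_op_ext[of H]) (use R in \<open>simp_all add: bounded_op_times\<close>)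
    show "alg_star (op_alg H) (P a) = P a" by (rule adjoint_unique) (use R in simp_all)
  next
    have "(\<Oplus>\<^bsub>op_alg H\<^esub>a\<in>UNIV. P a) \<in> carrier (op_alg H)" using b by (intro op.finsum_closed) auto
    then have bsum: "bounded_op H (\<Oplus>\<^bsub>op_alg H\<^esub>a\<in>UNIV. P a)" by simp
    have "(\<Oplus>\<^bsub>op_alg H\<^esub>a\<in>UNIV. P a) = (\<lambda>v\<in>carrier H. v)"
    proof (rule bounded_op_ext[OF bsum bounded_op_one])
      fix v assume v: "v \<in> carrier H"
      have "(\<Oplus>\<^bsub>op_alg H\<^esub>a\<in>UNIV. P a) v = (\<Oplus>a\<in>UNIV. P a v)" by (rule op_sum_apply) (auto simp: b v)
      also have "\<dots> = v" using R v by blast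
      finally show "(\<Oplus>\<^bsub>op_alg H\<^esub>a\<in>UNIV. P a) v = (\<lambda>v\<in>carrier H. v) v" using v by simp
    qed
    then show "(\<Oplus>\<^bsub>op_alg H\<^esub>a\<in>UNIV. P a) = \<one>\<^bsub>op_alg H\<^esub>" by simp
  qed
qed

lemma pvmD:
  fixes P :: "'a::finite \<Rightarrow> 'h \<Rightarrow> 'h"
  assumes "pvm H P"
  shows "bounded_op H (P a)" "v \<in> carrier H \<Longrightarrow> P a (P a v) = P a v"
    "\<lbrakk>u \<in> carrier H; v \<in> carrier H\<rbrakk> \<Longrightarrow> hinner H (P a u) v = hinner H u (P a v)"
    "v \<in> carrier H \<Longrightarrow> (\<Oplus>a\<in>UNIV. P a v) = v"
  using assms unfolding pvm_iff by blast+

text \<open>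
  For \<open>w = P\<^sub>b v\<close> the identity \<open>\<parallel>w\<parallel>\<^sup>2 = \<Sum>\<^sub>c \<parallel>P\<^sub>c w\<parallel>\<^sup>2\<close> already holds with the term \<open>c = b\<close> alone, so all other
  terms vanish.
\<close>

lemma pvm_orthogonal:
  fixes P :: "'a::finite \<Rightarrow> 'h \<Rightarrow> 'h"
  assumes P: "pvm H P" and v: "v \<in> carrier H" and ab: "a \<noteq> b"
  shows "P a (P b v) = \<zero>"
proof -
  note R = pvmD[OF P]
  note cl = bounded_op_closed[OF R(1)]
  let ?w = "P b v"
  have w: "?w \<in> carrier H" by (rule cl[OF v])
  have norm: "hinner H ?w (P c ?w) = of_real ((snorm (P c ?w))\<^sup>2)" for c
  proof -
    have "hinner H ?w (P c ?w) = hinner H ?w (P c (P c ?w))" using R(2)[OF w] by simp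
    also have "\<dots> = hinner H (P c ?w) (P c ?w)" using R(3)[OF w cl[OF w]] by simp
    also have "\<dots> = of_real ((snorm (P c ?w))\<^sup>2)" by (rule form_self[OF cl[OF w]])
    finally show ?thesis .
  qed
  have "hinner H ?w ?w = hinner H ?w (\<Oplus>c\<in>UNIV. P c ?w)" using R(4)[OF w] by simp
  also have "\<dots> = (\<Sum>c\<in>UNIV. of_real ((snorm (P c ?w))\<^sup>2))"
    using cl[OF w] w norm by (subst hinner_finsum) simp_all
  finally have "(snorm ?w)\<^sup>2 = (\<Sum>c\<in>UNIV. (snorm (P c ?w))\<^sup>2)"
    unfolding form_self[OF w] by (simp flip: of_real_sum of_real_power)
  also have "\<dots> = (snorm (P b ?w))\<^sup>2 + (\<Sum>c\<in>UNIV - {b}. (snorm (P c ?w))\<^sup>2)"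
    by (rule sum.remove) auto
  also have "P b ?w = ?w" by (rule R(2)[OF v])
  finally have "(\<Sum>c\<in>UNIV - {b}. (snorm (P c ?w))\<^sup>2) = 0" by simp
  then have "\<forall>c\<in>UNIV - {b}. (snorm (P c ?w))\<^sup>2 = 0"
    by (subst (asm) sum_nonneg_eq_0_iff) auto
  then have "snorm (P a ?w) = 0" using ab by simp
  then show ?thesis using snorm_eq_0D cl[OF w] by blast
qed

end

lemma (in star_algebra) star_zero: "alg_star M \<zero> = \<zero>"
  using star_scale[of \<zero> 0] by (simp add: scale_zero)

lemma (in star_algebra) star_finsum:
  assumes "finite A" "\<And>i. i \<in> A \<Longrightarrow> f i \<in> carrier M"
  shows "alg_star M (\<Oplus>i\<in>A. f i) = (\<Oplus>i\<in>A. alg_star M (f i))"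
  using assms by (intro additive_finsum abelian_monoid_axioms) (auto simp: star_zero star_add)

text \<open>
  The converse of \<open>linf_hom\<close>. Orthogonality removes the mixed terms in a product of two sums.
\<close>

lemma (in star_algebra) hom_of_orthogonal_projections:
  fixes P :: "'a::finite \<Rightarrow> 'c"
  assumes P: "\<And>a. P a \<in> carrier M" "\<And>a. P a \<otimes> P a = P a" "\<And>a b. a \<noteq> b \<Longrightarrow> P a \<otimes> P b = \<zero>"
    and star: "\<And>a. alg_star M (P a) = P a" and sum: "(\<Oplus>a\<in>UNIV. P a) = \<one>"
  shows "unital_star_hom linf M (\<lambda>f. \<Oplus>a\<in>UNIV. f a \<odot> P a)"
    and "(\<Oplus>b\<in>UNIV. point_mass a b \<odot> P b) = P a"
proof -
  interpret mod: Module.module complex_field M by (rule module)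
  have pick: "(\<Oplus>b\<in>UNIV. (if a = b then h b else \<zero>)) = h a" if "\<And>b. h b \<in> carrier M" for a and h :: "'a \<Rightarrow> 'c"
    using that by (intro add.finprod_singleton) auto
  have "(\<Oplus>b\<in>UNIV. point_mass a b \<odot> P b) = (\<Oplus>b\<in>UNIV. (if a = b then P b else \<zero>))"
    using P by (intro finsum_cong') (auto simp: scale_zero)
  then show "(\<Oplus>b\<in>UNIV. point_mass a b \<odot> P b) = P a" using pick P by simp
  show "unital_star_hom linf M (\<lambda>f. \<Oplus>a\<in>UNIV. f a \<odot> P a)"
    unfolding unital_star_hom_def
  proof (intro conjI ballI allI)
    show "(\<lambda>f. \<Oplus>a\<in>UNIV. f a \<odot> P a) \<in> carrier linf \<rightarrow> carrier M"
      using P by (auto intro!: finsum_closed)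
    show "(\<Oplus>a\<in>UNIV. \<one>\<^bsub>linf\<^esub> a \<odot> P a) = \<one>" using P sum by simp
    fix f g :: "'a \<Rightarrow> complex" and c
    show "(\<Oplus>a\<in>UNIV. (f \<oplus>\<^bsub>linf\<^esub> g) a \<odot> P a) = (\<Oplus>a\<in>UNIV. f a \<odot> P a) \<oplus> (\<Oplus>a\<in>UNIV. g a \<odot> P a)"
      using P by (subst finsum_addf[symmetric]) (auto simp: scale_add_left)
    show "(\<Oplus>a\<in>UNIV. (c \<odot>\<^bsub>linf\<^esub> f) a \<odot> P a) = c \<odot> (\<Oplus>a\<in>UNIV. f a \<odot> P a)"
      using P by (subst mod.finsum_smult_ldistr) (auto simp: scale_scale)
    show "(\<Oplus>a\<in>UNIV. (alg_star linf f) a \<odot> P a) = alg_star M (\<Oplus>a\<in>UNIV. f a \<odot> P a)"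
      using P by (subst star_finsum) (auto simp: star_scale star)
    have "(\<Oplus>a\<in>UNIV. f a \<odot> P a) \<otimes> (\<Oplus>b\<in>UNIV. g b \<odot> P b)
        = (\<Oplus>a\<in>UNIV. (f a \<odot> P a) \<otimes> (\<Oplus>b\<in>UNIV. g b \<odot> P b))"
      using P by (intro finsum_ldistr) (auto intro!: finsum_closed)
    also have "\<dots> = (\<Oplus>a\<in>UNIV. (f a * g a) \<odot> P a)"
    proof (rule finsum_cong')
      fix a
      have "(f a \<odot> P a) \<otimes> (\<Oplus>b\<in>UNIV. g b \<odot> P b) = (\<Oplus>b\<in>UNIV. (f a \<odot> P a) \<otimes> (g b \<odot> P b))"
        using P by (intro finsum_rdistr) (auto intro!: finsum_closed)
      also have "\<dots> = (\<Oplus>b\<in>UNIV. (if a = b then (f b * g b) \<odot> P b else \<zero>))"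
      proof (rule finsum_cong')
        fix b
        have "(f a \<odot> P a) \<otimes> (g b \<odot> P b) = (f a * g b) \<odot> (P a \<otimes> P b)"
          using P by (simp add: scale_mult_left scale_mult_right scale_scale mult.commute)
        moreover have "c \<odot> \<zero> = \<zero>" for c using mod.smult_r_null[of c] by simp
        ultimately show "(f a \<odot> P a) \<otimes> (g b \<odot> P b) = (if a = b then (f b * g b) \<odot> P b else \<zero>)"
          using P by simp
      qed (use P in auto)
      also have "\<dots> = (f a * g a) \<odot> P a" using P by (intro pick) simp
      finally show "(f a \<odot> P a) \<otimes> (\<Oplus>b\<in>UNIV. g b \<odot> P b) = (f a * g a) \<odot> P a" .
    qed (use P in auto)
    finally show "(\<Oplus>a\<in>UNIV. (f \<otimes>\<^bsub>linf\<^esub> g) a \<odot> P a) = (\<Oplus>a\<in>UNIV. f a \<odot> P a) \<otimes> (\<Oplus>a\<in>UNIV. g a \<odot> P a)"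
      by simp
  qed
qed

lemma (in hilbert_space) pvm_hom:
  fixes P :: "'a::finite \<Rightarrow> 'h \<Rightarrow> 'h"
  assumes "pvm H P"
  shows "unital_star_hom linf (op_alg H) (\<lambda>f. \<Oplus>\<^bsub>op_alg H\<^esub>a\<in>UNIV. f a \<odot>\<^bsub>op_alg H\<^esub> P a)"
    and "(\<Oplus>\<^bsub>op_alg H\<^esub>b\<in>UNIV. point_mass a b \<odot>\<^bsub>op_alg H\<^esub> P b) = P a"
proof -
  interpret op: star_algebra "op_alg H" by (rule star_algebra_op_alg)
  have b: "bounded_op H (P a)" for a using assms by (simp add: pvm_def)
  have "P a \<otimes>\<^bsub>op_alg H\<^esub> P b = \<zero>\<^bsub>op_alg H\<^esub>" if "a \<noteq> b" for a b
    by (rule bounded_op_ext[of H])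
      (use that pvm_orthogonal[OF assms] b in \<open>auto intro!: bounded_op_times bounded_op_zero\<close>)
  note hom = op.hom_of_orthogonal_projections[of P, OF _ _ this]
  show "unital_star_hom linf (op_alg H) (\<lambda>f. \<Oplus>\<^bsub>op_alg H\<^esub>a\<in>UNIV. f a \<odot>\<^bsub>op_alg H\<^esub> P a)"
    using assms by (intro hom(1)) (auto simp: pvm_def)
  show "(\<Oplus>\<^bsub>op_alg H\<^esub>b\<in>UNIV. point_mass a b \<odot>\<^bsub>op_alg H\<^esub> P b) = P a"
    using assms by (intro hom(2)) (auto simp: pvm_def)
qed

section \<open>From commuting measurements to a trace\<close>

text \<open>
  Here \<open>S\<close> will be the set of operators of the second player. The functional \<open>T \<mapsto> \<langle>\<zeta>, T \<zeta>\<rangle>\<close> is to be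
  shown to be tracial on an algebra of operators that commute with \<open>S\<close>. The set \<open>tracial_part\<close> tests
  \<open>T\<close> against the whole commutant and not only against elements of that algebra: the commutant is
  fixed while \<open>T\<close> varies, so the condition can be propagated from generators.
\<close>

definition commutant :: "'h hilbert \<Rightarrow> ('h \<Rightarrow> 'h) set \<Rightarrow> ('h \<Rightarrow> 'h) set" where
  "commutant H S = {T. bounded_op H T \<and> (\<forall>Q\<in>S. \<forall>v\<in>carrier H. T (Q v) = Q (T v))}"

definition tracial_part :: "'h hilbert \<Rightarrow> ('h \<Rightarrow> 'h) set \<Rightarrow> 'h \<Rightarrow> ('h \<Rightarrow> 'h) set" where
  "tracial_part H S \<zeta> = {T \<in> commutant H S.
     \<forall>W\<in>commutant H S. hinner H \<zeta> (T (W \<zeta>)) = hinner H \<zeta> (W (T \<zeta>))}"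

context hilbert_space
begin

text \<open>
  Norm convergence implies weak convergence, and the conditions that define the commutant and
  the tracial part are weakly closed.
\<close>

lemma tendsto_op_hinner:
  assumes T: "\<And>n. bounded_op H (T n)" and L: "bounded_op H L"
    and lim: "(\<lambda>n. alg_norm (op_alg H) (T n \<ominus>\<^bsub>op_alg H\<^esub> L)) \<longlonglongrightarrow> 0"
    and u: "u \<in> carrier H" and v: "v \<in> carrier H"
  shows "(\<lambda>n. hinner H u (T n v)) \<longlonglongrightarrow> hinner H u (L v)"
proof -
  interpret op: star_algebra "op_alg H" by (rule star_algebra_op_alg)
  note cl = bounded_op_closed[OF T v] bounded_op_closed[OF L v]
  have b: "bounded_op H (T n \<ominus>\<^bsub>op_alg H\<^esub> L)" for n
    using op.minus_closed[of "T n" L] T L by simp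
  have diff: "(T n \<ominus>\<^bsub>op_alg H\<^esub> L) v = T n v \<ominus> L v" for n
    using op.minus_eq_scale[of L "T n"] L v cl by (simp add: scale_minus_one M.minus_eq)
  have "(\<lambda>n. snorm (T n v \<ominus> L v)) \<longlonglongrightarrow> 0"
  proof (rule Lim_null_comparison)
    show "\<forall>\<^sub>F n in sequentially. norm (snorm (T n v \<ominus> L v)) \<le> alg_norm (op_alg H) (T n \<ominus>\<^bsub>op_alg H\<^esub> L) * snorm v"
      using op_norm_ge[OF b v] cl unfolding diff by (intro always_eventually allI) simp
    show "(\<lambda>n. alg_norm (op_alg H) (T n \<ominus>\<^bsub>op_alg H\<^esub> L) * snorm v) \<longlonglongrightarrow> 0"
      using tendsto_mult_left_zero[OF lim] by simp
  qed
  then show ?thesis by (rule tendsto_hinner[OF cl u])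
qed

context
  fixes S :: "('h \<Rightarrow> 'h) set"
  assumes S: "\<And>Q. Q \<in> S \<Longrightarrow> bounded_op H Q"
    and sym: "\<And>Q u v. \<lbrakk>Q \<in> S; u \<in> carrier H; v \<in> carrier H\<rbrakk> \<Longrightarrow> hinner H (Q u) v = hinner H u (Q v)"
begin

lemma commutant_bounded: "T \<in> commutant H S \<Longrightarrow> bounded_op H T"
  by (simp add: commutant_def)

lemma commutant_commute: "\<lbrakk>T \<in> commutant H S; Q \<in> S; v \<in> carrier H\<rbrakk> \<Longrightarrow> T (Q v) = Q (T v)"
  by (simp add: commutant_def)

lemma commutantI:
  "\<lbrakk>bounded_op H T; \<And>Q v. \<lbrakk>Q \<in> S; v \<in> carrier H\<rbrakk> \<Longrightarrow> T (Q v) = Q (T v)\<rbrakk> \<Longrightarrow> T \<in> commutant H S"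
  by (simp add: commutant_def)

lemma commutant_mult:
  assumes T: "T \<in> commutant H S" and W: "W \<in> commutant H S"
  shows "T \<otimes>\<^bsub>op_alg H\<^esub> W \<in> commutant H S"
proof -
  note b = commutant_bounded[OF T] commutant_bounded[OF W]
  show ?thesis
    using bounded_op_closed[OF S] bounded_op_closed[OF b(2)]
    by (intro commutantI bounded_op_times b) (simp add: commutant_commute[OF T] commutant_commute[OF W])
qed

lemma commutant_star:
  assumes T: "T \<in> commutant H S"
  shows "alg_star (op_alg H) T \<in> commutant H S"
proof -
  note b = commutant_bounded[OF T]
  note bs = bounded_op_star[OF b]
  note cl = bounded_op_closed[OF b] bounded_op_closed[OF bs] bounded_op_closed[OF S]
  show ?thesis
  proof (rule commutantI[OF bs], rule hinner_eqI)
    fix Q v u assume *: "Q \<in> S" "v \<in> carrier H" "u \<in> carrier H"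
    have "hinner H u (alg_star (op_alg H) T (Q v)) = hinner H (Q (T u)) v"
      using * cl by (simp add: hinner_star_right[OF b] sym)
    also have "\<dots> = hinner H (T (Q u)) v" using * by (simp add: commutant_commute[OF T])
    also have "\<dots> = hinner H u (Q (alg_star (op_alg H) T v))"
      using * cl by (simp add: hinner_star_right[OF b] flip: sym)
    finally show "hinner H u (alg_star (op_alg H) T (Q v)) = hinner H u (Q (alg_star (op_alg H) T v))" .
  qed (use cl in auto)
qed

lemma tracialD:
  assumes "T \<in> tracial_part H S \<zeta>"
  shows "bounded_op H T" "T \<in> commutant H S"
    "W \<in> commutant H S \<Longrightarrow> hinner H \<zeta> (T (W \<zeta>)) = hinner H \<zeta> (W (T \<zeta>))"
  using assms by (auto simp: tracial_part_def commutant_def)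

text \<open>
  For a product, \<open>\<langle>\<zeta>, T U W \<zeta>\<rangle> = \<langle>\<zeta>, U W T \<zeta>\<rangle> = \<langle>\<zeta>, W T U \<zeta>\<rangle>\<close> by the condition for \<open>T\<close> with \<open>U W\<close> and the
  condition for \<open>U\<close> with \<open>W T\<close>. For an adjoint one takes complex conjugates and uses the condition for
  \<open>T\<close> with \<open>W\<^sup>*\<close>.
\<close>

lemma closed_star_subalg_tracial_part:
  assumes \<zeta>: "\<zeta> \<in> carrier H"
  shows "closed_star_subalg (op_alg H) (tracial_part H S \<zeta>)"
  unfolding closed_star_subalg_def
proof (intro conjI ballI allI impI)
  show "tracial_part H S \<zeta> \<subseteq> carrier (op_alg H)" by (auto dest: tracialD)
  show "\<one>\<^bsub>op_alg H\<^esub> \<in> tracial_part H S \<zeta>"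
    using \<zeta> bounded_op_one bounded_op_closed[OF S] bounded_op_closed[OF commutant_bounded]
    by (auto simp: tracial_part_def intro!: commutantI)
next
  fix T U assume T: "T \<in> tracial_part H S \<zeta>" and U: "U \<in> tracial_part H S \<zeta>"
  note b = tracialD(1)[OF T] tracialD(1)[OF U]
  note cl = bounded_op_closed[OF b(1)] bounded_op_closed[OF b(2)] bounded_op_closed[OF S]
    bounded_op_closed[OF commutant_bounded]
  have comm: "T \<oplus>\<^bsub>op_alg H\<^esub> U \<in> commutant H S"
    using cl by (intro commutantI bounded_op_plus b)
      (simp add: commutant_commute[OF tracialD(2)[OF T]] commutant_commute[OF tracialD(2)[OF U]]
        bounded_op_add[OF S])
  show "T \<oplus>\<^bsub>op_alg H\<^esub> U \<in> tracial_part H S \<zeta>"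
    unfolding tracial_part_def
  proof (intro CollectI conjI comm ballI)
    fix W assume W: "W \<in> commutant H S"
    show "hinner H \<zeta> ((T \<oplus>\<^bsub>op_alg H\<^esub> U) (W \<zeta>)) = hinner H \<zeta> (W ((T \<oplus>\<^bsub>op_alg H\<^esub> U) \<zeta>))"
      using \<zeta> W cl tracialD(3)[OF T W] tracialD(3)[OF U W]
      by (simp add: bounded_op_add[OF commutant_bounded[OF W]] form_add)
  qed
  show "T \<otimes>\<^bsub>op_alg H\<^esub> U \<in> tracial_part H S \<zeta>"
    unfolding tracial_part_def
  proof (intro CollectI conjI ballI commutant_mult tracialD(2)[OF T] tracialD(2)[OF U])
    fix W assume W: "W \<in> commutant H S"
    have "hinner H \<zeta> (T ((U \<otimes>\<^bsub>op_alg H\<^esub> W) \<zeta>)) = hinner H \<zeta> ((U \<otimes>\<^bsub>op_alg H\<^esub> W) (T \<zeta>))"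
      by (rule tracialD(3)[OF T commutant_mult[OF tracialD(2)[OF U] W]])
    moreover have "hinner H \<zeta> (U ((W \<otimes>\<^bsub>op_alg H\<^esub> T) \<zeta>)) = hinner H \<zeta> ((W \<otimes>\<^bsub>op_alg H\<^esub> T) (U \<zeta>))"
      by (rule tracialD(3)[OF U commutant_mult[OF W tracialD(2)[OF T]]])
    ultimately show "hinner H \<zeta> ((T \<otimes>\<^bsub>op_alg H\<^esub> U) (W \<zeta>)) = hinner H \<zeta> (W ((T \<otimes>\<^bsub>op_alg H\<^esub> U) \<zeta>))"
      using \<zeta> W cl by simp
  qed
next
  fix T c assume T: "T \<in> tracial_part H S \<zeta>"
  note b = tracialD(1)[OF T]
  note cl = bounded_op_closed[OF b] bounded_op_closed[OF S] bounded_op_closed[OF commutant_bounded]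
  have comm: "c \<odot>\<^bsub>op_alg H\<^esub> T \<in> commutant H S"
    using cl by (intro commutantI bounded_op_smult b)
      (simp add: commutant_commute[OF tracialD(2)[OF T]] bounded_op_scale[OF S])
  show "c \<odot>\<^bsub>op_alg H\<^esub> T \<in> tracial_part H S \<zeta>"
    unfolding tracial_part_def
  proof (intro CollectI conjI comm ballI)
    fix W assume W: "W \<in> commutant H S"
    show "hinner H \<zeta> ((c \<odot>\<^bsub>op_alg H\<^esub> T) (W \<zeta>)) = hinner H \<zeta> (W ((c \<odot>\<^bsub>op_alg H\<^esub> T) \<zeta>))"
      using \<zeta> W cl tracialD(3)[OF T W]
      by (simp add: bounded_op_scale[OF commutant_bounded[OF W]] form_smult)
  qed
next
  fix T assume T: "T \<in> tracial_part H S \<zeta>"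
  note b = tracialD(1)[OF T]
  note bs = bounded_op_star[OF b]
  show "alg_star (op_alg H) T \<in> tracial_part H S \<zeta>"
    unfolding tracial_part_def
  proof (intro CollectI conjI ballI commutant_star tracialD(2)[OF T])
    fix W assume W: "W \<in> commutant H S"
    let ?T = "alg_star (op_alg H) T" and ?W = "alg_star (op_alg H) W"
    note bW = commutant_bounded[OF W]
    note cl = bounded_op_closed[OF b \<zeta>] bounded_op_closed[OF bW \<zeta>]
      bounded_op_closed[OF bs \<zeta>] bounded_op_closed[OF bounded_op_star[OF bW] \<zeta>]
    have "hinner H \<zeta> (?T (W \<zeta>)) = hinner H (T \<zeta>) (W \<zeta>)" using \<zeta> cl by (intro hinner_star_right[OF b])
    also have "\<dots> = cnj (hinner H (W \<zeta>) (T \<zeta>))" by (rule form_cnj[OF cl(2,1)])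
    also have "hinner H (W \<zeta>) (T \<zeta>) = hinner H \<zeta> (?W (T \<zeta>))"
      using hinner_star_right[OF bW \<zeta> cl(1)] by simp
    also have "\<dots> = hinner H \<zeta> (T (?W \<zeta>))" using tracialD(3)[OF T commutant_star[OF W]] by simp
    also have "\<dots> = hinner H (?T \<zeta>) (?W \<zeta>)" using hinner_star[OF b \<zeta> cl(4)] by simp
    also have "cnj \<dots> = hinner H (?W \<zeta>) (?T \<zeta>)" using form_cnj[OF cl(3,4)] by simp
    also have "\<dots> = hinner H \<zeta> (W (?T \<zeta>))" by (rule hinner_star[OF bW \<zeta> cl(3)])
    finally show "hinner H \<zeta> (?T (W \<zeta>)) = hinner H \<zeta> (W (?T \<zeta>))" .
  qed
next
  fix T :: "nat \<Rightarrow> 'h \<Rightarrow> 'h" and L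
  assume "L \<in> carrier (op_alg H)"
    and *: "(\<forall>n. T n \<in> tracial_part H S \<zeta>) \<and> (\<lambda>n. alg_norm (op_alg H) (T n \<ominus>\<^bsub>op_alg H\<^esub> L)) \<longlonglongrightarrow> 0"
  then have T: "\<And>n. T n \<in> tracial_part H S \<zeta>" and L: "bounded_op H L" by simp_all
  note lim = tendsto_op_hinner[OF tracialD(1)[OF T] L conjunct2[OF *]]
  note cl = bounded_op_closed[OF tracialD(1)[OF T]] bounded_op_closed[OF L] bounded_op_closed[OF S]
  have comm: "L \<in> commutant H S"
  proof (rule commutantI[OF L], rule hinner_eqI)
    fix Q v u assume Q: "Q \<in> S" "v \<in> carrier H" and u: "u \<in> carrier H"
    have "(\<lambda>n. hinner H u (T n (Q v))) = (\<lambda>n. hinner H (Q u) (T n v))"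
      using Q u cl by (simp add: commutant_commute[OF tracialD(2)[OF T]] sym)
    then have "(\<lambda>n. hinner H (Q u) (T n v)) \<longlonglongrightarrow> hinner H u (L (Q v))"
      using lim[OF u cl(3)[OF Q]] by simp
    moreover have "(\<lambda>n. hinner H (Q u) (T n v)) \<longlonglongrightarrow> hinner H (Q u) (L v)"
      by (rule lim[OF cl(3)[OF Q(1) u] Q(2)])
    ultimately have "hinner H u (L (Q v)) = hinner H (Q u) (L v)" by (rule LIMSEQ_unique)
    also have "\<dots> = hinner H u (Q (L v))" by (rule sym[OF Q(1) u cl(2)[OF Q(2)]])
    finally show "hinner H u (L (Q v)) = hinner H u (Q (L v))" .
  qed (use cl in auto)
  show "L \<in> tracial_part H S \<zeta>"
    unfolding tracial_part_def
  proof (intro CollectI conjI comm ballI)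
    fix W assume W: "W \<in> commutant H S"
    note bW = commutant_bounded[OF W]
    let ?w = "alg_star (op_alg H) W \<zeta>"
    have w: "?w \<in> carrier H" by (rule bounded_op_closed[OF bounded_op_star[OF bW] \<zeta>])
    have "(\<lambda>n. hinner H \<zeta> (T n (W \<zeta>))) = (\<lambda>n. hinner H ?w (T n \<zeta>))"
      using tracialD(3)[OF T W] hinner_star[OF bW \<zeta>] cl(1)[OF \<zeta>] by simp
    then have "(\<lambda>n. hinner H ?w (T n \<zeta>)) \<longlonglongrightarrow> hinner H \<zeta> (L (W \<zeta>))"
      using lim[OF \<zeta> bounded_op_closed[OF bW \<zeta>]] by simp
    from LIMSEQ_unique[OF this lim[OF w \<zeta>]]
    show "hinner H \<zeta> (L (W \<zeta>)) = hinner H \<zeta> (W (L \<zeta>))"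
      using hinner_star[OF bW \<zeta>] cl(2)[OF \<zeta>] by simp
  qed
qed

text \<open>
  This is where the exchange of the two players happens. With \<open>E = \<Sum>\<^sub>b c\<^sub>b Q\<^sub>b\<close> and \<open>P \<zeta> = E \<zeta>\<close> one has
  \<open>\<langle>\<zeta>, P W \<zeta>\<rangle> = \<langle>P \<zeta>, W \<zeta>\<rangle> = \<langle>E \<zeta>, W \<zeta>\<rangle> = \<langle>\<zeta>, E W \<zeta>\<rangle> = \<langle>\<zeta>, W E \<zeta>\<rangle> = \<langle>\<zeta>, W P \<zeta>\<rangle>\<close>. The
  coefficients are real, so that \<open>E\<close> is self-adjoint.
\<close>

lemma projection_in_tracial_part:
  fixes Q :: "'b::finite \<Rightarrow> 'h \<Rightarrow> 'h" and c :: "'b \<Rightarrow> real"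
  assumes \<zeta>: "\<zeta> \<in> carrier H" and P: "P \<in> commutant H S"
    and P_sym: "\<And>u v. \<lbrakk>u \<in> carrier H; v \<in> carrier H\<rbrakk> \<Longrightarrow> hinner H (P u) v = hinner H u (P v)"
    and Q: "\<And>b. Q b \<in> S" and eq: "P \<zeta> = (\<Oplus>b\<in>UNIV. of_real (c b) \<odot> Q b \<zeta>)"
  shows "P \<in> tracial_part H S \<zeta>"
  unfolding tracial_part_def
proof (intro CollectI conjI P ballI)
  fix W assume W: "W \<in> commutant H S"
  note bW = commutant_bounded[OF W] and bP = commutant_bounded[OF P]
  have cl: "Q b u \<in> carrier H" if "u \<in> carrier H" for b u
    using bounded_op_closed[OF S[OF Q]] that .
  note W\<zeta> = bounded_op_closed[OF bW \<zeta>] and P\<zeta> = bounded_op_closed[OF bP \<zeta>]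
  have expand: "hinner H u (P \<zeta>) = (\<Sum>b\<in>UNIV. of_real (c b) * hinner H u (Q b \<zeta>))"
    if "u \<in> carrier H" for u
    unfolding eq using that cl[OF \<zeta>] by (subst hinner_finsum) (simp_all add: form_smult)
  have "hinner H \<zeta> (P (W \<zeta>)) = hinner H (P \<zeta>) (W \<zeta>)" using P_sym \<zeta> W\<zeta> by simp
  also have "\<dots> = cnj (hinner H (W \<zeta>) (P \<zeta>))" by (rule form_cnj[OF W\<zeta> P\<zeta>])
  also have "\<dots> = (\<Sum>b\<in>UNIV. of_real (c b) * cnj (hinner H (W \<zeta>) (Q b \<zeta>)))"
    by (simp add: expand[OF W\<zeta>])
  also have "\<dots> = (\<Sum>b\<in>UNIV. of_real (c b) * hinner H (alg_star (op_alg H) W \<zeta>) (Q b \<zeta>))"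
  proof (rule sum.cong[OF refl])
    fix b
    have "cnj (hinner H (W \<zeta>) (Q b \<zeta>)) = hinner H (Q b \<zeta>) (W \<zeta>)"
      using form_cnj[OF W\<zeta> cl[OF \<zeta>]] by simp
    also have "\<dots> = hinner H \<zeta> (Q b (W \<zeta>))" by (rule sym[OF Q \<zeta> W\<zeta>])
    also have "\<dots> = hinner H \<zeta> (W (Q b \<zeta>))" using commutant_commute[OF W Q \<zeta>] by simp
    also have "\<dots> = hinner H (alg_star (op_alg H) W \<zeta>) (Q b \<zeta>)"
      using hinner_star[OF bW \<zeta> cl[OF \<zeta>]] by simp
    finally show "of_real (c b) * cnj (hinner H (W \<zeta>) (Q b \<zeta>))
        = of_real (c b) * hinner H (alg_star (op_alg H) W \<zeta>) (Q b \<zeta>)" by simp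
  qed
  also have "\<dots> = hinner H (alg_star (op_alg H) W \<zeta>) (P \<zeta>)"
    by (rule expand[symmetric]) (rule bounded_op_closed[OF bounded_op_star[OF bW] \<zeta>])
  also have "\<dots> = hinner H \<zeta> (W (P \<zeta>))" by (rule hinner_star[OF bW \<zeta> P\<zeta>])
  finally show "hinner H \<zeta> (P (W \<zeta>)) = hinner H \<zeta> (W (P \<zeta>))" .
qed

end

text \<open>
  If the answer \<open>b\<close> is determined by \<open>a\<close>, then inserting \<open>\<Sum>\<^sub>b Q\<^sub>b = 1\<close> shows \<open>P\<^sub>a \<zeta> = P\<^sub>a Q\<^bsub>g(a)\<^esub> \<zeta>\<close>. Inserting
  \<open>\<Sum>\<^sub>a P\<^sub>a = 1\<close> in front of \<open>Q\<^sub>b \<zeta>\<close> leaves exactly these terms with \<open>g(a) = b\<close>.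
\<close>

lemma mirror_vector:
  fixes P :: "'a::finite \<Rightarrow> 'h \<Rightarrow> 'h" and Q :: "'b::finite \<Rightarrow> 'h \<Rightarrow> 'h" and g :: "'a \<Rightarrow> 'b"
  assumes P: "pvm H P" and Q: "pvm H Q" and \<zeta>: "\<zeta> \<in> carrier H"
    and zero: "\<And>a b. b \<noteq> g a \<Longrightarrow> P a (Q b \<zeta>) = \<zero>"
  shows "Q b \<zeta> = (\<Oplus>a\<in>UNIV. (if g a = b then 1 else 0) \<odot> P a \<zeta>)"
proof -
  note cl = bounded_op_closed[OF pvmD(1)[OF P]] bounded_op_closed[OF pvmD(1)[OF Q]]
  have "P a \<zeta> = P a (Q (g a) \<zeta>)" for a
  proof -
    have "P a \<zeta> = P a (\<Oplus>b\<in>UNIV. Q b \<zeta>)" using pvmD(4)[OF Q \<zeta>] by simp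
    also have "\<dots> = (\<Oplus>b\<in>UNIV. P a (Q b \<zeta>))"
      using cl \<zeta> by (intro bounded_op_finsum pvmD(1)[OF P]) auto
    also have "\<dots> = (\<Oplus>b\<in>UNIV. (if g a = b then P a (Q b \<zeta>) else \<zero>))"
      using cl \<zeta> zero by (intro M.finsum_cong') auto
    also have "\<dots> = P a (Q (g a) \<zeta>)" using cl \<zeta> by (intro M.add.finprod_singleton) auto
    finally show ?thesis .
  qed
  note eq = this
  have "Q b \<zeta> = (\<Oplus>a\<in>UNIV. P a (Q b \<zeta>))" using pvmD(4)[OF P cl(2)[OF \<zeta>]] by simp
  also have "\<dots> = (\<Oplus>a\<in>UNIV. (if g a = b then 1 else 0) \<odot> P a \<zeta>)"
  proof (rule M.finsum_cong')
    fix a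
    show "P a (Q b \<zeta>) = (if g a = b then 1 else 0) \<odot> P a \<zeta>"
      using zero[of b a] eq[of a] cl \<zeta> smult_l_null[of "P a \<zeta>"] by auto
  qed (use cl \<zeta> in auto)
  finally show ?thesis .
qed

text \<open>
  \<open>\<parallel>P\<^sub>a Q\<^sub>b \<zeta>\<parallel>\<^sup>2 = \<langle>\<zeta>, P\<^sub>a Q\<^sub>b \<zeta>\<rangle>\<close> for commuting projections.
\<close>

lemma correlation_zero:
  assumes P: "pvm H P" and Q: "pvm H Q" and \<zeta>: "\<zeta> \<in> carrier H"
    and comm: "\<And>v. v \<in> carrier H \<Longrightarrow> P a (Q b v) = Q b (P a v)"
    and zero: "hinner H \<zeta> (P a (Q b \<zeta>)) = 0"
  shows "P a (Q b \<zeta>) = \<zero>"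
proof -
  note cl = bounded_op_closed[OF pvmD(1)[OF P]] bounded_op_closed[OF pvmD(1)[OF Q]]
  have "hinner H (P a (Q b \<zeta>)) (P a (Q b \<zeta>)) = hinner H (Q b \<zeta>) (P a (Q b \<zeta>))"
    using cl \<zeta> by (simp add: pvmD(2,3)[OF P])
  also have "\<dots> = hinner H \<zeta> (P a (Q b \<zeta>))"
    using cl \<zeta> by (simp add: pvmD(2,3)[OF Q] comm)
  finally show ?thesis
    using zero cl \<zeta> by (intro snorm_eq_0D) (auto simp: snorm_def)
qed

end

lemma evaluation_hom:
  assumes "(H, \<pi>) \<in> representations M"
  shows "unital_star_hom (rep_prod M) (op_alg H) (\<lambda>F. F (H, \<pi>))"
  unfolding unital_star_hom_def
  using assms prod_carrierD[OF _ assms, of _ "\<lambda>(H, \<pi>). op_alg H"] by (auto simp del: op_alg_simps)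

text \<open>
  The functional is the vector functional of \<open>\<zeta>\<close> in the representation given by the operators of the
  first player, and the homomorphism is the pull-back along \<open>\<eta>\<close> and the maps \<open>g\<^sub>y\<close> described at the
  beginning.
\<close>

theorem trace_of_correlation:
  fixes lam :: "('x::finite, 'y::finite, 'a::finite, 'b::finite) rule"
    and p :: "('x, 'y, 'a, 'b) correlation"
  assumes mirror: "mirror_game lam" and p: "p \<in> perfect lam (C_qc TYPE('h))"
  shows "\<exists>(\<tau> :: ('x, 'a, 'h) game_elem \<Rightarrow> complex)
      (\<rho> :: ('y, 'b, 'h) game_elem \<Rightarrow> ('x, 'a, 'h) game_elem).
       trace game_alg \<tau> \<and>
       unital_star_hom game_alg game_alg \<rho> \<and>
       \<rho> ` gen_span \<subseteq> gen_span \<and>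
       (\<forall>x y a b. complex_of_real (p a b x y) = \<tau> (gen x a \<otimes>\<^bsub>game_alg\<^esub> \<rho> (gen y b)))"
proof -
  obtain H :: "'h hilbert" and \<zeta> P Q where H: "hilbert_space H" and \<zeta>: "\<zeta> \<in> carrier H"
    and P: "\<And>x. pvm H (P x)" and Q: "\<And>y. pvm H (Q y)"
    and comm_op: "\<And>x y a b. P x a \<otimes>\<^bsub>op_alg H\<^esub> Q y b = Q y b \<otimes>\<^bsub>op_alg H\<^esub> P x a"
    and p_eq: "\<And>x y a b. complex_of_real (p a b x y) = hinner H \<zeta> ((P x a \<otimes>\<^bsub>op_alg H\<^esub> Q y b) \<zeta>)"
    using p unfolding perfect_def C_qc_def by blast
  interpret hilbert_space H by (rule H)
  interpret op: star_algebra "op_alg H" by (rule star_algebra_op_alg)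
  have comm: "P x a (Q y b v) = Q y b (P x a v)" if "v \<in> carrier H" for x y a b v
    using fun_cong[OF comm_op, of x a y b v] that by simp
  have p_eq': "complex_of_real (p a b x y) = hinner H \<zeta> (P x a (Q y b \<zeta>))" for a b x y
    using p_eq[of a b x y] \<zeta> by simp
  note cl = bounded_op_closed[OF pvmD(1)[OF P]] bounded_op_closed[OF pvmD(1)[OF Q]]
  have PQ_zero: "P x a (Q y b \<zeta>) = \<zero>\<^bsub>H\<^esub>" if "lam (x, y, a, b) = 0" for x y a b
    using p that p_eq'[of a b x y]
    by (intro correlation_zero[OF P Q \<zeta> comm]) (auto simp: perfect_def)
  obtain \<xi> \<eta> where
    \<xi>: "\<And>x b a a'. a \<noteq> a' \<Longrightarrow> lam (x, \<xi> x, a, b) * lam (x, \<xi> x, a', b) = 0" and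
    \<eta>: "\<And>y a b b'. b \<noteq> b' \<Longrightarrow> lam (\<eta> y, y, a, b) * lam (\<eta> y, y, a, b') = 0"
    using mirror unfolding mirror_game_def by blast
  \<comment> \<open>If no \<open>b\<close> wins against \<open>a\<close>, the chosen value is arbitrary; then \<open>P\<^bsub>\<eta>(y),a\<^esub> \<zeta> = 0\<close>, so any
  value is correct. A value is needed because \<open>\<rho>\<close> has to preserve the unit.\<close>
  define g where "g y a = (SOME b. lam (\<eta> y, y, a, b) \<noteq> 0)" for y a
  define h where "h x b = (SOME a. lam (x, \<xi> x, a, b) \<noteq> 0)" for x b
  have g: "lam (\<eta> y, y, a, b) = 0" if "b \<noteq> g y a" for y a b
    using \<eta>[OF that] someI[of "\<lambda>b. lam (\<eta> y, y, a, b) \<noteq> 0" b] unfolding g_def by force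
  have h: "lam (x, \<xi> x, a, b) = 0" if "a \<noteq> h x b" for x a b
    using \<xi>[OF that] someI[of "\<lambda>a. lam (x, \<xi> x, a, b) \<noteq> 0" a] unfolding h_def by force
  have Q\<zeta>: "Q y b \<zeta> = (\<Oplus>\<^bsub>H\<^esub>a\<in>UNIV. (if g y a = b then 1 else 0) \<odot>\<^bsub>H\<^esub> P (\<eta> y) a \<zeta>)" for y b
    by (rule mirror_vector[OF P Q \<zeta>]) (rule PQ_zero[OF g])
  have P\<zeta>: "P x a \<zeta> = (\<Oplus>\<^bsub>H\<^esub>b\<in>UNIV. (if h x b = a then 1 else 0) \<odot>\<^bsub>H\<^esub> Q (\<xi> x) b \<zeta>)" for x a
    by (rule mirror_vector[OF Q P \<zeta>]) (simp add: comm[OF \<zeta>, symmetric] PQ_zero[OF h])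
  define S where "S = {Q y b | y b. True}"
  have S: "bounded_op H T" "\<lbrakk>u \<in> carrier H; v \<in> carrier H\<rbrakk> \<Longrightarrow> hinner H (T u) v = hinner H u (T v)"
    if "T \<in> S" for T u v
    using that pvmD(1,3)[OF Q] by (auto simp: S_def)
  have P_tracial: "P x a \<in> tracial_part H S \<zeta>" for x a
  proof (rule projection_in_tracial_part[OF S \<zeta>])
    show "P x a \<in> commutant H S"
      using pvmD(1)[OF P] comm by (auto simp: commutant_def S_def)
    show "Q (\<xi> x) b \<in> S" for b by (auto simp: S_def)
    show "P x a \<zeta> = (\<Oplus>\<^bsub>H\<^esub>b\<in>UNIV. of_real (if h x b = a then 1 else 0) \<odot>\<^bsub>H\<^esub> Q (\<xi> x) b \<zeta>)"
      using P\<zeta>[of x a] by (simp add: if_distrib[of complex_of_real] cong: if_cong)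
  qed (use pvmD(3)[OF P] in auto)
  \<comment> \<open>The representation of the free product with \<open>e\<^bsub>x,a\<^esub> \<mapsto> P\<^bsub>x,a\<^esub>\<close>.\<close>
  define \<pi> where "\<pi> x f = (\<Oplus>\<^bsub>op_alg H\<^esub>a\<in>UNIV. f a \<odot>\<^bsub>op_alg H\<^esub> P x a)" for x and f :: "'a \<Rightarrow> complex"
  have r: "(H, \<pi>) \<in> representations (\<lambda>_. linf)"
    using pvm_hom(1)[OF P] H by (simp add: representations_def \<pi>_def[abs_def])
  have closed_T: "closed_star_subalg (op_alg H) (tracial_part H S \<zeta>)"
    by (rule closed_star_subalg_tracial_part[OF S \<zeta>])
  note subspace = op.closed_star_subalg_subspace[OF closed_T]
  have \<pi>_tracial: "\<pi> x f \<in> tracial_part H S \<zeta>" for x f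
    unfolding \<pi>_def
    by (intro op.finsum_subspace[OF subspace(1,2,4)] subspace(3) P_tracial) auto
  have tracial: "F (H, \<pi>) \<in> tracial_part H S \<zeta>" if F: "F \<in> carrier game_alg" for F
  proof -
    let ?B = "{F \<in> carrier (rep_prod (\<lambda>_. linf)). F (H, \<pi>) \<in> tracial_part H S \<zeta>}"
    have "closed_star_subalg (rep_prod (\<lambda>_. linf)) ?B"
      using prod_norm_ge[OF _ r]
      by (intro closed_star_subalg_vimage[OF star_algebra_rep_prod op.star_algebra_axioms evaluation_hom[OF r] _ closed_T])
        fastforce
    then have "carrier game_alg \<subseteq> ?B"
      by (rule game_alg_least) (simp add: free_incl_closed r \<pi>_tracial)
    then show ?thesis using F by blast
  qed
  define \<tau> where "\<tau> F = hinner H \<zeta> (F (H, \<pi>) \<zeta>)" for F :: "('x, 'a, 'h) game_elem"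
  have b: "bounded_op H (F (H, \<pi>))" if "F \<in> carrier game_alg" for F
    by (rule game_carrier_apply[OF that r])
  note bcl = bounded_op_closed[OF b \<zeta>]
  have gen: "gen x a (H, \<pi>) = P x a" for x a
    using pvm_hom(2)[OF P, of a x] r by (simp add: gen_eq \<pi>_def)
  show ?thesis
  proof (intro exI[of _ \<tau>] exI[of _ "pull_hom \<eta> g"] conjI allI pull_hom_star_hom pull_hom_gen_span)
    show "trace game_alg \<tau>"
      unfolding trace_def
    proof (intro conjI ballI allI)
      fix F G :: "('x, 'a, 'h) game_elem"
      assume F: "F \<in> carrier game_alg" and G: "G \<in> carrier game_alg"
      show "\<tau> (F \<oplus>\<^bsub>game_alg\<^esub> G) = \<tau> F + \<tau> G"
        using \<zeta> bcl[OF F] bcl[OF G] by (simp add: \<tau>_def r form_add)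
      show "\<tau> (F \<otimes>\<^bsub>game_alg\<^esub> G) = \<tau> (G \<otimes>\<^bsub>game_alg\<^esub> F)"
        using \<zeta> tracialD(3)[OF S tracial[OF F] tracialD(2)[OF S tracial[OF G]]] by (simp add: \<tau>_def r)
    next
      fix F :: "('x, 'a, 'h) game_elem" and c assume F: "F \<in> carrier game_alg"
      show "\<tau> (c \<odot>\<^bsub>game_alg\<^esub> F) = c * \<tau> F"
        using \<zeta> bcl[OF F] by (simp add: \<tau>_def r form_smult)
      have "\<tau> (alg_star game_alg F \<otimes>\<^bsub>game_alg\<^esub> F) = hinner H (F (H, \<pi>) \<zeta>) (F (H, \<pi>) \<zeta>)"
        using \<zeta> bcl[OF F] by (simp add: \<tau>_def r hinner_star_right[OF b[OF F]])
      then show "\<tau> (alg_star game_alg F \<otimes>\<^bsub>game_alg\<^esub> F) \<in> \<real>\<^sub>\<ge>\<^sub>0"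
        using form_self[OF bcl[OF F]] by (simp only: nonneg_Reals_of_real_iff zero_le_power2)
    qed
    fix x y a b
    have "pull_hom \<eta> g (gen y b) (H, \<pi>) = (\<Oplus>\<^bsub>op_alg H\<^esub>a\<in>UNIV. (if g y a = b then 1 else 0) \<odot>\<^bsub>op_alg H\<^esub> P (\<eta> y) a)"
      by (simp add: r pull_rep pull_rep_apply gen_eq \<pi>_def)
    then have "pull_hom \<eta> g (gen y b) (H, \<pi>) \<zeta>
        = (\<Oplus>\<^bsub>op_alg H\<^esub>a\<in>UNIV. (if g y a = b then 1 else 0) \<odot>\<^bsub>op_alg H\<^esub> P (\<eta> y) a) \<zeta>" by (rule fun_cong)
    also have "\<dots> = (\<Oplus>\<^bsub>H\<^esub>a\<in>UNIV. ((if g y a = b then 1 else 0) \<odot>\<^bsub>op_alg H\<^esub> P (\<eta> y) a) \<zeta>)"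
      by (intro op_sum_apply bounded_op_smult pvmD(1)[OF P] \<zeta>) simp
    also have "\<dots> = Q y b \<zeta>" unfolding Q\<zeta> using \<zeta> by simp
    finally have "pull_hom \<eta> g (gen y b) (H, \<pi>) \<zeta> = Q y b \<zeta>" .
    then show "complex_of_real (p a b x y) = \<tau> (gen x a \<otimes>\<^bsub>game_alg\<^esub> pull_hom \<eta> g (gen y b))"
      using \<zeta> by (simp add: \<tau>_def r gen p_eq')
  qed
qed

section \<open>Completion of a semi-inner product space\<close>

context semi_inner_space
begin

text \<open>
  A vector \<open>v\<close> is identified with the antilinear functional \<open>u \<mapsto> s(u,v)\<close>. The completion consists of
  the functionals that are limits of such vectors in the operator norm. With this choice no
  quotient has to be formed: vectors of seminorm zero become the zero functional. The inner product
  of \<open>f\<close> and \<open>g\<close> is the limit of \<open>g(v\<^sub>n)\<close> along any sequence of vectors \<open>v\<^sub>n\<close> that approximates \<open>f\<close>; as it is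
  a limit of values of \<open>g\<close>, it is visibly linear in \<open>g\<close>.
\<close>

definition approximates :: "(nat \<Rightarrow> 'v) \<Rightarrow> ('v \<Rightarrow> complex) \<Rightarrow> bool" where
  "approximates x f \<longleftrightarrow> (\<forall>n. x n \<in> carrier V) \<and>
     (\<exists>e. e \<longlonglongrightarrow> 0 \<and> (\<forall>n. 0 \<le> e n \<and> (\<forall>u\<in>carrier V. cmod (f u - s u (x n)) \<le> e n * snorm u)))"

definition completion_carrier :: "('v \<Rightarrow> complex) set" where
  "completion_carrier = {f \<in> extensional (carrier V). \<exists>x. approximates x f}"

definition approx :: "('v \<Rightarrow> complex) \<Rightarrow> nat \<Rightarrow> 'v" where
  "approx f = (SOME x. approximates x f)"

definition completion :: "('v \<Rightarrow> complex) hilbert" where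
  "completion = \<lparr>
     carrier = completion_carrier,
     mult = (\<lambda>f g. f),
     one = (\<lambda>u\<in>carrier V. 0),
     zero = (\<lambda>u\<in>carrier V. 0),
     add = (\<lambda>f g. \<lambda>u\<in>carrier V. f u + g u),
     smult = (\<lambda>c f. \<lambda>u\<in>carrier V. c * f u),
     hinner = (\<lambda>f g. lim (\<lambda>n. g (approx f n)))\<rparr>"

lemma completion_ops:
  "\<zero>\<^bsub>completion\<^esub> = (\<lambda>u\<in>carrier V. 0)"
  "f \<oplus>\<^bsub>completion\<^esub> g = (\<lambda>u\<in>carrier V. f u + g u)"
  "c \<odot>\<^bsub>completion\<^esub> f = (\<lambda>u\<in>carrier V. c * f u)"
  by (simp_all add: completion_def)

lemma carrier_completion [simp]: "carrier completion = completion_carrier"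
  by (simp add: completion_def)

lemma completion_apply [simp]:
  assumes "u \<in> carrier V"
  shows "\<zero>\<^bsub>completion\<^esub> u = 0" "(f \<oplus>\<^bsub>completion\<^esub> g) u = f u + g u" "(c \<odot>\<^bsub>completion\<^esub> f) u = c * f u"
  using assms by (simp_all add: completion_ops)

lemma approximates_approx: "f \<in> completion_carrier \<Longrightarrow> approximates (approx f) f"
  using someI_ex[of "\<lambda>x. approximates x f"] by (simp add: approx_def completion_carrier_def)

lemma approximates_closed: "approximates x f \<Longrightarrow> x n \<in> carrier V"
  by (simp add: approximates_def)

lemma approx_closed [simp]: "f \<in> completion_carrier \<Longrightarrow> approx f n \<in> carrier V"
  using approximates_approx approximates_closed by blast

lemma approximatesE:
  "approximates x f \<Longrightarrow> \<exists>e. e \<longlonglongrightarrow> 0 \<and> (\<forall>n. 0 \<le> e n) \<and>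
    (\<forall>n. \<forall>u\<in>carrier V. cmod (f u - s u (x n)) \<le> e n * snorm u)"
  unfolding approximates_def by blast

lemma approximatesI:
  assumes "\<And>n. x n \<in> carrier V" "e \<longlonglongrightarrow> 0" "\<And>n. 0 \<le> e n"
    "\<And>n u. u \<in> carrier V \<Longrightarrow> cmod (f u - s u (x n)) \<le> e n * snorm u"
  shows "approximates x f"
  using assms unfolding approximates_def by blast

lemma approximates_tendsto:
  assumes x: "approximates x f" and u: "u \<in> carrier V"
  shows "(\<lambda>n. s u (x n)) \<longlonglongrightarrow> f u"
proof -
  obtain e where e: "e \<longlonglongrightarrow> 0" "\<And>n. 0 \<le> e n"
      "\<And>n u. u \<in> carrier V \<Longrightarrow> cmod (f u - s u (x n)) \<le> e n * snorm u"
    using approximatesE[OF x] by blast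
  have "(\<lambda>n. s u (x n) - f u) \<longlonglongrightarrow> 0"
  proof (rule Lim_null_comparison)
    show "\<forall>\<^sub>F n in sequentially. norm (s u (x n) - f u) \<le> e n * snorm u"
      using e(3)[OF u] by (intro always_eventually allI) (simp add: norm_minus_commute)
    show "(\<lambda>n. e n * snorm u) \<longlonglongrightarrow> 0" using tendsto_mult_left_zero[OF e(1)] by simp
  qed
  then show ?thesis by (simp add: LIM_zero_iff)
qed

lemma completion_bounded:
  assumes f: "f \<in> completion_carrier"
  shows "\<exists>K\<ge>0. \<forall>u\<in>carrier V. cmod (f u) \<le> K * snorm u"
proof -
  obtain e where e: "e \<longlonglongrightarrow> 0" "\<And>n. 0 \<le> e n"
      "\<And>n u. u \<in> carrier V \<Longrightarrow> cmod (f u - s u (approx f n)) \<le> e n * snorm u"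
    using approximatesE[OF approximates_approx[OF f]] by blast
  let ?v = "approx f 0"
  have v: "?v \<in> carrier V" using f by simp
  have "cmod (f u) \<le> (e 0 + snorm ?v) * snorm u" if u: "u \<in> carrier V" for u
  proof -
    have "cmod (f u) \<le> cmod (f u - s u ?v) + cmod (s u ?v)"
      using norm_triangle_ineq[of "f u - s u ?v" "s u ?v"] by simp
    then show ?thesis using e(3)[OF u, of 0] cauchy_schwarz[OF u v] by (simp add: algebra_simps)
  qed
  then show ?thesis using e(2)[of 0] snorm_nonneg[OF v] by (intro exI[of _ "e 0 + snorm ?v"]) simp
qed

lemma completion_add:
  assumes f: "f \<in> completion_carrier" and u: "u \<in> carrier V" "v \<in> carrier V"
  shows "f (u \<oplus> v) = f u + f v"
proof -
  note lim = approximates_tendsto[OF approximates_approx[OF f]]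
  have "(\<lambda>n. s (u \<oplus> v) (approx f n)) \<longlonglongrightarrow> f u + f v"
    using tendsto_add[OF lim[OF u(1)] lim[OF u(2)]] u f by (simp add: form_simps)
  moreover have "(\<lambda>n. s (u \<oplus> v) (approx f n)) \<longlonglongrightarrow> f (u \<oplus> v)" using lim u by simp
  ultimately show ?thesis using LIMSEQ_unique by blast
qed

lemma completion_scale:
  assumes f: "f \<in> completion_carrier" and u: "u \<in> carrier V"
  shows "f (c \<odot> u) = cnj c * f u"
proof -
  note lim = approximates_tendsto[OF approximates_approx[OF f]]
  have "(\<lambda>n. s (c \<odot> u) (approx f n)) \<longlonglongrightarrow> cnj c * f u"
    using tendsto_mult[OF tendsto_const lim[OF u], of "cnj c"] u f by (simp add: form_simps)
  moreover have "(\<lambda>n. s (c \<odot> u) (approx f n)) \<longlonglongrightarrow> f (c \<odot> u)" using lim u by simp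
  ultimately show ?thesis using LIMSEQ_unique by blast
qed

lemma completion_diff:
  assumes f: "f \<in> completion_carrier" and u: "u \<in> carrier V" "v \<in> carrier V"
  shows "f (u \<ominus> v) = f u - f v"
  using completion_add[OF f u(1), of "(-1) \<odot> v"] completion_scale[OF f u(2), of "-1"] u
  by (simp add: M.minus_eq scale_minus_one)

text \<open>
  \<open>v - w\<close> has inner product at most \<open>(a + b) \<parallel>u\<parallel>\<close> with every \<open>u\<close>, in particular with itself.
\<close>

lemma approximants_close:
  assumes v: "v \<in> carrier V" "w \<in> carrier V"
    and a: "\<And>u. u \<in> carrier V \<Longrightarrow> cmod (f u - s u v) \<le> a * snorm u"
    and b: "\<And>u. u \<in> carrier V \<Longrightarrow> cmod (f u - s u w) \<le> b * snorm u"
    and ab: "0 \<le> a" "0 \<le> b"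
  shows "snorm (v \<ominus> w) \<le> a + b"
proof (cases "snorm (v \<ominus> w) = 0")
  case False
  let ?d = "v \<ominus> w"
  have d: "?d \<in> carrier V" using v by simp
  then have pos: "0 < snorm ?d" using False snorm_nonneg[OF d] by linarith
  have "(snorm ?d)\<^sup>2 \<le> cmod (s ?d ?d)" using snorm_sq[OF d] complex_Re_le_cmod by simp
  also have "s ?d ?d = (f ?d - s ?d w) - (f ?d - s ?d v)" using form_diff[OF d v] by simp
  also have "cmod \<dots> \<le> b * snorm ?d + a * snorm ?d"
    using norm_triangle_ineq4[of "f ?d - s ?d w" "f ?d - s ?d v"] a[OF d] b[OF d] by linarith
  finally have "snorm ?d * snorm ?d \<le> (a + b) * snorm ?d" by (simp add: power2_eq_square algebra_simps)
  then show ?thesis using pos by (rule mult_right_le_imp_le)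
qed (use ab in simp)

text \<open>
  \<open>g\<close> is bounded and two sequences that approximate \<open>f\<close> come arbitrarily close to each other, so the
  limit exists along the chosen sequence and is the same along every other one.
\<close>

lemma tendsto_hinner_completion:
  assumes x: "approximates x f" and f: "f \<in> completion_carrier" and g: "g \<in> completion_carrier"
  shows "(\<lambda>n. g (x n)) \<longlonglongrightarrow> hinner completion f g"
proof -
  obtain K where K: "0 \<le> K" "\<And>u. u \<in> carrier V \<Longrightarrow> cmod (g u) \<le> K * snorm u"
    using completion_bounded[OF g] by blast
  let ?y = "approx f"
  obtain d where d: "d \<longlonglongrightarrow> 0" "\<And>n. 0 \<le> d n"
      "\<And>n u. u \<in> carrier V \<Longrightarrow> cmod (f u - s u (?y n)) \<le> d n * snorm u"
    using approximatesE[OF approximates_approx[OF f]] by blast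
  obtain e where e: "e \<longlonglongrightarrow> 0" "\<And>n. 0 \<le> e n"
      "\<And>n u. u \<in> carrier V \<Longrightarrow> cmod (f u - s u (x n)) \<le> e n * snorm u"
    using approximatesE[OF x] by blast
  have x_mem: "x n \<in> carrier V" for n by (rule approximates_closed[OF x])
  have y_mem: "?y n \<in> carrier V" for n using f by simp
  have diff: "cmod (g v - g w) \<le> K * (a + b)"
    if "v \<in> carrier V" "w \<in> carrier V" "\<And>u. u \<in> carrier V \<Longrightarrow> cmod (f u - s u v) \<le> a * snorm u"
      "\<And>u. u \<in> carrier V \<Longrightarrow> cmod (f u - s u w) \<le> b * snorm u" "0 \<le> a" "0 \<le> b" for v w a b
  proof -
    have "cmod (g v - g w) \<le> K * snorm (v \<ominus> w)"
      using K(2)[of "v \<ominus> w"] completion_diff[OF g that(1,2)] that(1,2) by simp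
    also have "\<dots> \<le> K * (a + b)" using approximants_close[OF that] K(1) by (rule mult_left_mono)
    finally show ?thesis .
  qed
  have "Cauchy (\<lambda>n. g (?y n))"
  proof (rule metric_CauchyI)
    fix \<epsilon> :: real assume \<epsilon>: "\<epsilon> > 0"
    define \<delta> where "\<delta> = \<epsilon> / (2 * (K + 1))"
    have \<delta>: "\<delta> > 0" using \<epsilon> K(1) by (simp add: \<delta>_def)
    obtain N where N: "\<And>n. n \<ge> N \<Longrightarrow> d n < \<delta>"
      using order_tendstoD(2)[OF d(1) \<delta>] by (auto simp: eventually_sequentially)
    have "dist (g (?y m)) (g (?y n)) < \<epsilon>" if "m \<ge> N" "n \<ge> N" for m n
    proof -
      have "dist (g (?y m)) (g (?y n)) \<le> K * (d m + d n)"
        unfolding dist_norm using d y_mem by (intro diff) auto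
      also have "\<dots> \<le> K * (2 * \<delta>)" using N[OF that(1)] N[OF that(2)] K(1) by (intro mult_left_mono) auto
      also have "\<dots> < (K + 1) * (2 * \<delta>)" using \<delta> by simp
      also have "\<dots> = \<epsilon>" using K(1) by (simp add: \<delta>_def field_simps)
      finally show ?thesis .
    qed
    then show "\<exists>N. \<forall>m\<ge>N. \<forall>n\<ge>N. dist (g (?y m)) (g (?y n)) < \<epsilon>" by blast
  qed
  then have lim: "(\<lambda>n. g (?y n)) \<longlonglongrightarrow> hinner completion f g"
    unfolding completion_def by (simp add: Cauchy_convergent_iff convergent_LIMSEQ_iff)
  have "(\<lambda>n. g (x n) - g (?y n)) \<longlonglongrightarrow> 0"
  proof (rule Lim_null_comparison)
    show "\<forall>\<^sub>F n in sequentially. norm (g (x n) - g (?y n)) \<le> K * (e n + d n)"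
      using d e x_mem y_mem by (intro always_eventually allI diff) auto
    show "(\<lambda>n. K * (e n + d n)) \<longlonglongrightarrow> 0"
      using tendsto_mult_right_zero[OF tendsto_add_zero[OF e(1) d(1)]] by simp
  qed
  from tendsto_add[OF this lim] show ?thesis by simp
qed

lemma approximates_bounded:
  assumes x: "approximates x f" and K: "0 \<le> K" "\<And>u. u \<in> carrier V \<Longrightarrow> cmod (f u) \<le> K * snorm u"
  shows "\<exists>e. e \<longlonglongrightarrow> 0 \<and> (\<forall>n. 0 \<le> e n) \<and> (\<forall>n. snorm (x n) \<le> K + e n)"
proof -
  obtain e where e: "e \<longlonglongrightarrow> 0" "\<And>n. 0 \<le> e n"
      "\<And>n u. u \<in> carrier V \<Longrightarrow> cmod (f u - s u (x n)) \<le> e n * snorm u"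
    using approximatesE[OF x] by blast
  have "snorm (x n) \<le> K + e n" for n
  proof -
    have "snorm (\<zero> \<ominus> x n) \<le> K + e n"
      using approximates_closed[OF x] K e
      by (intro approximants_close[of \<zero> "x n" f K "e n"]) (auto simp: form_zero)
    then show ?thesis using approximates_closed[OF x] by (simp add: M.minus_eq snorm_minus)
  qed
  then show ?thesis using e by blast
qed

text \<open>
  The symmetric description of the inner product, from which hermitian symmetry and positivity are
  inherited.
\<close>

lemma tendsto_form_completion:
  assumes f: "f \<in> completion_carrier" and g: "g \<in> completion_carrier"
  shows "(\<lambda>n. s (approx f n) (approx g n)) \<longlonglongrightarrow> hinner completion f g"
proof -
  let ?x = "approx f" and ?y = "approx g"
  obtain K where K: "0 \<le> K" "\<And>u. u \<in> carrier V \<Longrightarrow> cmod (f u) \<le> K * snorm u"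
    using completion_bounded[OF f] by blast
  obtain e where e: "e \<longlonglongrightarrow> 0" "\<And>n. 0 \<le> e n" "\<And>n. snorm (?x n) \<le> K + e n"
    using approximates_bounded[OF approximates_approx[OF f] K] by blast
  obtain d where d: "d \<longlonglongrightarrow> 0" "\<And>n. 0 \<le> d n"
      "\<And>n u. u \<in> carrier V \<Longrightarrow> cmod (g u - s u (?y n)) \<le> d n * snorm u"
    using approximatesE[OF approximates_approx[OF g]] by blast
  have "(\<lambda>n. s (?x n) (?y n) - g (?x n)) \<longlonglongrightarrow> 0"
  proof (rule Lim_null_comparison)
    show "\<forall>\<^sub>F n in sequentially. norm (s (?x n) (?y n) - g (?x n)) \<le> d n * (K + e n)"
    proof (intro always_eventually allI)
      fix n
      have "norm (s (?x n) (?y n) - g (?x n)) \<le> d n * snorm (?x n)"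
        using d(3)[of "?x n" n] f by (simp add: norm_minus_commute)
      then show "norm (s (?x n) (?y n) - g (?x n)) \<le> d n * (K + e n)"
        using mult_left_mono[OF e(3) d(2)] order_trans by blast
    qed
    show "(\<lambda>n. d n * (K + e n)) \<longlonglongrightarrow> 0"
      using tendsto_mult[OF d(1) tendsto_add[OF tendsto_const e(1), of K]] by simp
  qed
  from tendsto_add[OF this tendsto_hinner_completion[OF approximates_approx[OF f] f g]]
  show ?thesis by simp
qed

lemma completion_carrier_add:
  assumes f: "f \<in> completion_carrier" and g: "g \<in> completion_carrier"
  shows "f \<oplus>\<^bsub>completion\<^esub> g \<in> completion_carrier"
proof -
  obtain d where d: "d \<longlonglongrightarrow> 0" "\<And>n. 0 \<le> d n"
      "\<And>n u. u \<in> carrier V \<Longrightarrow> cmod (f u - s u (approx f n)) \<le> d n * snorm u"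
    using approximatesE[OF approximates_approx[OF f]] by blast
  obtain e where e: "e \<longlonglongrightarrow> 0" "\<And>n. 0 \<le> e n"
      "\<And>n u. u \<in> carrier V \<Longrightarrow> cmod (g u - s u (approx g n)) \<le> e n * snorm u"
    using approximatesE[OF approximates_approx[OF g]] by blast
  have "approximates (\<lambda>n. approx f n \<oplus> approx g n) (\<lambda>u\<in>carrier V. f u + g u)"
  proof (rule approximatesI[where e = "\<lambda>n. d n + e n"])
    fix n u assume u: "u \<in> carrier V"
    have "(f u + g u) - s u (approx f n \<oplus> approx g n) = (f u - s u (approx f n)) + (g u - s u (approx g n))"
      using u f g by (simp add: form_add)
    then have "cmod ((f u + g u) - s u (approx f n \<oplus> approx g n))
        = cmod ((f u - s u (approx f n)) + (g u - s u (approx g n)))" by (rule arg_cong)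
    also have "\<dots> \<le> cmod (f u - s u (approx f n)) + cmod (g u - s u (approx g n))"
      by (rule norm_triangle_ineq)
    also have "\<dots> \<le> (d n + e n) * snorm u"
      unfolding distrib_right using d(3) e(3) u by (intro add_mono) auto
    finally have "cmod ((f u + g u) - s u (approx f n \<oplus> approx g n)) \<le> (d n + e n) * snorm u" .
    then show "cmod ((\<lambda>u\<in>carrier V. f u + g u) u - s u (approx f n \<oplus> approx g n)) \<le> (d n + e n) * snorm u"
      using u by simp
  qed (use d e f g tendsto_add_zero in auto)
  then show ?thesis by (auto simp: completion_carrier_def completion_ops)
qed

lemma completion_carrier_scale:
  assumes f: "f \<in> completion_carrier"
  shows "c \<odot>\<^bsub>completion\<^esub> f \<in> completion_carrier"
proof -
  obtain d where d: "d \<longlonglongrightarrow> 0" "\<And>n. 0 \<le> d n"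
      "\<And>n u. u \<in> carrier V \<Longrightarrow> cmod (f u - s u (approx f n)) \<le> d n * snorm u"
    using approximatesE[OF approximates_approx[OF f]] by blast
  have "approximates (\<lambda>n. c \<odot> approx f n) (\<lambda>u\<in>carrier V. c * f u)"
  proof (rule approximatesI[where e = "\<lambda>n. cmod c * d n"])
    fix n u assume u: "u \<in> carrier V"
    have "c * f u - s u (c \<odot> approx f n) = c * (f u - s u (approx f n))"
      using u f by (simp add: form_simps right_diff_distrib)
    then have "cmod (c * f u - s u (c \<odot> approx f n)) \<le> cmod c * d n * snorm u"
      using mult_left_mono[OF d(3)[OF u, of n] norm_ge_zero[of c]] by (simp add: norm_mult mult.assoc)
    then show "cmod ((\<lambda>u\<in>carrier V. c * f u) u - s u (c \<odot> approx f n)) \<le> cmod c * d n * snorm u"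
      using u by simp
  qed (use d f tendsto_mult_right_zero in auto)
  then show ?thesis by (auto simp: completion_carrier_def completion_ops)
qed

lemma embed_approximates:
  assumes v: "v \<in> carrier V"
  shows "approximates (\<lambda>_. v) (\<lambda>u\<in>carrier V. s u v)"
  by (rule approximatesI[where e = "\<lambda>_. 0"]) (use v in auto)

lemma embed_closed: "v \<in> carrier V \<Longrightarrow> (\<lambda>u\<in>carrier V. s u v) \<in> completion_carrier"
  using embed_approximates by (auto simp: completion_carrier_def)

lemma hinner_embed:
  assumes v: "v \<in> carrier V" and g: "g \<in> completion_carrier"
  shows "hinner completion (\<lambda>u\<in>carrier V. s u v) g = g v"
  using LIMSEQ_unique[OF tendsto_hinner_completion[OF embed_approximates[OF v] embed_closed[OF v] g] tendsto_const] .

lemma completion_carrier_zero: "\<zero>\<^bsub>completion\<^esub> \<in> completion_carrier"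
  using completion_carrier_scale[OF embed_closed[OF M.zero_closed], of 0]
  by (simp add: completion_ops cong: restrict_cong)

lemma completion_ext:
  "\<lbrakk>f \<in> completion_carrier; g \<in> completion_carrier; \<And>u. u \<in> carrier V \<Longrightarrow> f u = g u\<rbrakk> \<Longrightarrow> f = g"
  by (rule extensionalityI[of _ "carrier V"]) (auto simp: completion_carrier_def)

lemma semi_inner_completion: "semi_inner_space completion (hinner completion)"
proof -
  note closed = completion_carrier_add completion_carrier_scale completion_carrier_zero
  have inv: "\<exists>g\<in>completion_carrier. g \<oplus>\<^bsub>completion\<^esub> f = \<zero>\<^bsub>completion\<^esub>"
    if f: "f \<in> completion_carrier" for f
    using completion_carrier_scale[OF f, of "-1"]
    by (rule bexI[rotated]) (rule completion_ext, auto simp: closed f)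
  have ab: "abelian_group completion"
    by (rule abelian_groupI) (auto intro!: inv completion_ext simp: closed)
  have "Module.module complex_field completion"
    by (rule Module.moduleI[OF cring_complex_field ab])
      (auto intro!: completion_ext simp: closed algebra_simps)
  moreover have "semi_inner_space_axioms completion (hinner completion)"
  proof
    fix f g h assume "f \<in> carrier completion" "g \<in> carrier completion" "h \<in> carrier completion"
    then have fgh: "f \<in> completion_carrier" "g \<in> completion_carrier" "h \<in> completion_carrier" by simp_all
    note lim = tendsto_hinner_completion[OF approximates_approx[OF fgh(1)] fgh(1)]
    show "hinner completion f (g \<oplus>\<^bsub>completion\<^esub> h) = hinner completion f g + hinner completion f h"
      using tendsto_add[OF lim[OF fgh(2)] lim[OF fgh(3)]] lim[OF completion_carrier_add[OF fgh(2,3)]] fgh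
      by (intro LIMSEQ_unique) simp_all
  next
    fix f g c assume "f \<in> carrier completion" "g \<in> carrier completion"
    then have fg: "f \<in> completion_carrier" "g \<in> completion_carrier" by simp_all
    note lim = tendsto_hinner_completion[OF approximates_approx[OF fg(1)] fg(1)]
    show "hinner completion f (c \<odot>\<^bsub>completion\<^esub> g) = c * hinner completion f g"
      using tendsto_mult[OF tendsto_const lim[OF fg(2)], of c] lim[OF completion_carrier_scale[OF fg(2), of c]] fg
      by (intro LIMSEQ_unique) simp_all
  next
    fix f g assume "f \<in> carrier completion" "g \<in> carrier completion"
    then have fg: "f \<in> completion_carrier" "g \<in> completion_carrier" by simp_all
    have "(\<lambda>n. s (approx g n) (approx f n)) = (\<lambda>n. cnj (s (approx f n) (approx g n)))"
      using fg by (intro ext form_cnj) simp_all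
    then show "hinner completion g f = cnj (hinner completion f g)"
      using tendsto_form_completion[OF fg(2,1)] tendsto_cnj[OF tendsto_form_completion[OF fg]]
      by (intro LIMSEQ_unique) simp_all
  next
    fix f assume "f \<in> carrier completion"
    then have f: "f \<in> completion_carrier" by simp
    show "0 \<le> Re (hinner completion f f)"
      by (rule tendsto_lowerbound[OF tendsto_Re[OF tendsto_form_completion[OF f f]]])
        (use f form_pos in auto)
  qed
  ultimately show ?thesis by (rule semi_inner_space.intro)
qed

interpretation compl: semi_inner_space completion "hinner completion"
  by (rule semi_inner_completion)

lemma tendsto_snorm_completion:
  assumes f: "f \<in> completion_carrier"
  shows "(\<lambda>n. snorm (approx f n)) \<longlonglongrightarrow> compl.snorm f"
  unfolding snorm_def compl.snorm_def
  by (intro tendsto_real_sqrt tendsto_Re tendsto_form_completion f)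

lemma completion_le_norm:
  assumes f: "f \<in> completion_carrier" and u: "u \<in> carrier V"
  shows "cmod (f u) \<le> compl.snorm f * snorm u"
proof (rule tendsto_le[OF sequentially_bot])
  show "(\<lambda>n. cmod (s u (approx f n))) \<longlonglongrightarrow> cmod (f u)"
    by (intro tendsto_norm approximates_tendsto approximates_approx f u)
  show "(\<lambda>n. snorm (approx f n) * snorm u) \<longlonglongrightarrow> compl.snorm f * snorm u"
    by (intro tendsto_mult tendsto_const tendsto_snorm_completion f)
  show "\<forall>\<^sub>F n in sequentially. cmod (s u (approx f n)) \<le> snorm (approx f n) * snorm u"
    using cauchy_schwarz[OF u, of "approx f n" for n] f by (simp add: mult.commute)
qed

lemma completion_norm_le:
  assumes f: "f \<in> completion_carrier" and K: "0 \<le> K" "\<And>u. u \<in> carrier V \<Longrightarrow> cmod (f u) \<le> K * snorm u"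
  shows "compl.snorm f \<le> K"
proof -
  obtain e where e: "e \<longlonglongrightarrow> 0" "\<And>n. 0 \<le> e n" "\<And>n. snorm (approx f n) \<le> K + e n"
    using approximates_bounded[OF approximates_approx[OF f] K] by blast
  have "(\<lambda>n. K + e n) \<longlonglongrightarrow> K" using tendsto_add[OF tendsto_const e(1), of K] by simp
  from tendsto_le[OF sequentially_bot this tendsto_snorm_completion[OF f]] show ?thesis
    using e(3) by simp
qed

lemma completion_minus:
  assumes "f \<in> completion_carrier" "g \<in> completion_carrier" "u \<in> carrier V"
  shows "(f \<ominus>\<^bsub>completion\<^esub> g) u = f u - g u"
  using assms compl.scale_minus_one[of g] by (simp add: a_minus_def flip: compl.scale_minus_one)

text \<open>
  The norm of \<open>f\<close> is its least bound as a functional (\<open>completion_le_norm\<close>, \<open>completion_norm_le\<close>). Hence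
  a Cauchy sequence converges uniformly relative to \<open>\<parallel>u\<parallel>\<close>, and its limit is again approximable: take
  an approximant of a late member of the sequence, with half of the error for each step.
\<close>

theorem hilbert_space_completion: "hilbert_space completion"
proof (intro hilbert_space.intro hilbert_space_axioms.intro)
  show "Module.module complex_field completion" by (rule compl.module_axioms)
next
  fix f assume f: "f \<in> carrier completion" "f \<noteq> \<zero>\<^bsub>completion\<^esub>"
  have "compl.snorm f \<noteq> 0"
  proof
    assume "compl.snorm f = 0"
    then have "f u = 0" if "u \<in> carrier V" for u using completion_le_norm[of f u] f that by simp
    then have "f = \<zero>\<^bsub>completion\<^esub>" using f completion_carrier_zero by (intro completion_ext) auto
    then show False using f by simp
  qed
  then show "0 < Re (hinner completion f f)"
    using compl.form_pos[OF f(1)] unfolding compl.snorm_def by auto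
next
  fix F :: "nat \<Rightarrow> 'v \<Rightarrow> complex"
  assume "\<forall>n. F n \<in> carrier completion"
    and "\<forall>\<epsilon>>0. \<exists>N. \<forall>m\<ge>N. \<forall>n\<ge>N. hnorm completion (F m \<ominus>\<^bsub>completion\<^esub> F n) < \<epsilon>"
  then have F: "\<And>n. F n \<in> completion_carrier"
    and cau: "\<And>\<epsilon>. \<epsilon> > 0 \<Longrightarrow> \<exists>N. \<forall>m\<ge>N. \<forall>n\<ge>N. compl.snorm (F m \<ominus>\<^bsub>completion\<^esub> F n) < \<epsilon>"
    by (simp_all add: hnorm_def compl.snorm_def)
  have diff_le: "cmod (F m u - F n u) \<le> compl.snorm (F m \<ominus>\<^bsub>completion\<^esub> F n) * snorm u"
    if u: "u \<in> carrier V" for m n u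
    using completion_le_norm[of "F m \<ominus>\<^bsub>completion\<^esub> F n" u] compl.M.minus_closed[of "F m" "F n"] F u
    by (simp add: completion_minus)
  have "convergent (\<lambda>n. F n u)" if u: "u \<in> carrier V" for u
  proof (rule Cauchy_convergent, rule metric_CauchyI)
    fix \<epsilon> :: real assume \<epsilon>: "\<epsilon> > 0"
    then obtain N where N: "\<And>m n. m \<ge> N \<Longrightarrow> n \<ge> N \<Longrightarrow> compl.snorm (F m \<ominus>\<^bsub>completion\<^esub> F n) < \<epsilon> / (snorm u + 1)"
      using cau[of "\<epsilon> / (snorm u + 1)"] snorm_nonneg[OF u] by (auto simp: divide_simps add_nonneg_pos)
    have pos: "0 < snorm u + 1" using snorm_nonneg[OF u] by linarith
    have "dist (F m u) (F n u) < \<epsilon>" if "m \<ge> N" "n \<ge> N" for m n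
    proof -
      have "dist (F m u) (F n u) \<le> \<epsilon> / (snorm u + 1) * snorm u"
        unfolding dist_norm using diff_le[OF u] mult_right_mono[OF less_imp_le[OF N[OF that]] snorm_nonneg[OF u]]
          order_trans by blast
      also have "\<dots> < \<epsilon> / (snorm u + 1) * (snorm u + 1)" using pos \<epsilon> by (intro mult_strict_left_mono) auto
      also have "\<dots> = \<epsilon>" using pos by simp
      finally show ?thesis .
    qed
    then show "\<exists>N. \<forall>m\<ge>N. \<forall>n\<ge>N. dist (F m u) (F n u) < \<epsilon>" by blast
  qed
  then obtain f0 where f0: "\<And>u. u \<in> carrier V \<Longrightarrow> (\<lambda>n. F n u) \<longlonglongrightarrow> f0 u"
    unfolding convergent_def by metis
  define f where "f = (\<lambda>u\<in>carrier V. f0 u)"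
  have lim: "(\<lambda>n. F n u) \<longlonglongrightarrow> f u" if "u \<in> carrier V" for u using f0 that by (simp add: f_def)
  have unif: "\<exists>N. \<forall>m\<ge>N. \<forall>u\<in>carrier V. cmod (F m u - f u) \<le> \<epsilon> * snorm u" if \<epsilon>: "\<epsilon> > 0" for \<epsilon>
  proof -
    obtain N where N: "\<And>m n. m \<ge> N \<Longrightarrow> n \<ge> N \<Longrightarrow> compl.snorm (F m \<ominus>\<^bsub>completion\<^esub> F n) < \<epsilon>"
      using cau[OF \<epsilon>] by blast
    have "cmod (F m u - f u) \<le> \<epsilon> * snorm u" if m: "m \<ge> N" and u: "u \<in> carrier V" for m u
    proof (rule tendsto_upperbound)
      show "(\<lambda>n. cmod (F m u - F n u)) \<longlonglongrightarrow> cmod (F m u - f u)"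
        by (intro tendsto_intros lim u)
      show "\<forall>\<^sub>F n in sequentially. cmod (F m u - F n u) \<le> \<epsilon> * snorm u"
        unfolding eventually_sequentially
        using diff_le[OF u] mult_right_mono[OF less_imp_le[OF N[OF m]] snorm_nonneg[OF u]] order_trans by blast
    qed simp
    then show ?thesis by blast
  qed
  have "\<exists>v\<in>carrier V. \<forall>u\<in>carrier V. cmod (f u - s u v) \<le> 1 / Suc n * snorm u" for n
  proof -
    define \<epsilon> :: real where "\<epsilon> = 1 / Suc n / 2"
    have \<epsilon>: "\<epsilon> > 0" by (simp add: \<epsilon>_def)
    obtain m where m: "\<And>u. u \<in> carrier V \<Longrightarrow> cmod (F m u - f u) \<le> \<epsilon> * snorm u"
      using unif[OF \<epsilon>] by blast
    obtain e where e: "e \<longlonglongrightarrow> 0" "\<And>n. 0 \<le> e n"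
        "\<And>n u. u \<in> carrier V \<Longrightarrow> cmod (F m u - s u (approx (F m) n)) \<le> e n * snorm u"
      using approximatesE[OF approximates_approx[OF F]] by blast
    obtain k where k: "e k < \<epsilon>"
      using order_tendstoD(2)[OF e(1) \<epsilon>] by (auto simp: eventually_sequentially)
    show ?thesis
    proof (intro bexI[of _ "approx (F m) k"] ballI)
      fix u assume u: "u \<in> carrier V"
      have "cmod (f u - s u (approx (F m) k)) \<le> cmod (F m u - f u) + cmod (F m u - s u (approx (F m) k))"
        using norm_triangle_ineq[of "f u - F m u" "F m u - s u (approx (F m) k)"]
        by (simp add: norm_minus_commute)
      also have "\<dots> \<le> \<epsilon> * snorm u + \<epsilon> * snorm u"
        using m[OF u] e(3)[OF u, of k] mult_right_mono[OF less_imp_le[OF k] snorm_nonneg[OF u]] by linarith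
      also have "\<dots> = (2 * \<epsilon>) * snorm u" by simp
      also have "2 * \<epsilon> = 1 / Suc n" unfolding \<epsilon>_def by (rule field_sum_of_halves[of "1 / Suc n", folded mult_2])
      finally show "cmod (f u - s u (approx (F m) k)) \<le> 1 / Suc n * snorm u" .
    qed (use F in simp)
  qed
  then obtain x where x: "\<And>n. x n \<in> carrier V"
      "\<And>n u. u \<in> carrier V \<Longrightarrow> cmod (f u - s u (x n)) \<le> 1 / Suc n * snorm u" by metis
  have "approximates x f"
    using x LIMSEQ_Suc[OF lim_1_over_n] by (intro approximatesI[where e = "\<lambda>n. 1 / Suc n"]) auto
  then have f: "f \<in> completion_carrier" unfolding completion_carrier_def by (auto simp: f_def)
  have "(\<lambda>n. compl.snorm (F n \<ominus>\<^bsub>completion\<^esub> f)) \<longlonglongrightarrow> 0"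
  proof (rule LIMSEQ_I)
    fix \<epsilon> :: real assume \<epsilon>: "0 < \<epsilon>"
    obtain N where N: "\<And>m u. m \<ge> N \<Longrightarrow> u \<in> carrier V \<Longrightarrow> cmod (F m u - f u) \<le> \<epsilon> / 2 * snorm u"
      using unif[of "\<epsilon> / 2"] \<epsilon> by auto
    have "norm (compl.snorm (F n \<ominus>\<^bsub>completion\<^esub> f) - 0) < \<epsilon>" if "n \<ge> N" for n
    proof -
      have mem: "F n \<ominus>\<^bsub>completion\<^esub> f \<in> completion_carrier"
        using compl.M.minus_closed[of "F n" f] F f by simp
      have "compl.snorm (F n \<ominus>\<^bsub>completion\<^esub> f) \<le> \<epsilon> / 2"
        using \<epsilon> N[OF that] F f by (intro completion_norm_le mem) (auto simp: completion_minus)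
      moreover have "0 \<le> compl.snorm (F n \<ominus>\<^bsub>completion\<^esub> f)" using mem by simp
      ultimately show ?thesis using \<epsilon> by simp
    qed
    then show "\<exists>N. \<forall>n\<ge>N. norm (compl.snorm (F n \<ominus>\<^bsub>completion\<^esub> f) - 0) < \<epsilon>" by blast
  qed
  then show "\<exists>l\<in>carrier completion. (\<lambda>n. hnorm completion (F n \<ominus>\<^bsub>completion\<^esub> l)) \<longlonglongrightarrow> 0"
    using f by (auto simp: hnorm_def compl.snorm_def)
qed (auto intro: compl.form_add compl.form_smult compl.form_cnj)

text \<open>
  For a symmetric operator \<open>A\<close> on vectors, \<open>s(A u, v) = s(u, A v)\<close>, so that composing functionals with
  \<open>A\<close> extends the action of \<open>A\<close> on vectors to the completion.
\<close>

definition lift_op :: "('v \<Rightarrow> 'v) \<Rightarrow> ('v \<Rightarrow> complex) \<Rightarrow> 'v \<Rightarrow> complex" where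
  "lift_op A = (\<lambda>f\<in>completion_carrier. \<lambda>u\<in>carrier V. f (A u))"

context
  fixes A
  assumes A: "\<And>u. u \<in> carrier V \<Longrightarrow> A u \<in> carrier V"
    and sym: "\<And>u v. \<lbrakk>u \<in> carrier V; v \<in> carrier V\<rbrakk> \<Longrightarrow> s (A u) v = s u (A v)"
    and contr: "\<And>u. u \<in> carrier V \<Longrightarrow> snorm (A u) \<le> snorm u"
begin

lemma lift_op_approximates:
  assumes x: "approximates x f"
  shows "approximates (\<lambda>n. A (x n)) (\<lambda>u\<in>carrier V. f (A u))"
proof -
  obtain e where e: "e \<longlonglongrightarrow> 0" "\<And>n. 0 \<le> e n"
      "\<And>n u. u \<in> carrier V \<Longrightarrow> cmod (f u - s u (x n)) \<le> e n * snorm u"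
    using approximatesE[OF x] by blast
  show ?thesis
  proof (rule approximatesI[OF _ e(1,2)])
    fix n u assume u: "u \<in> carrier V"
    have "cmod (f (A u) - s (A u) (x n)) \<le> e n * snorm (A u)" using e(3) A u by blast
    also have "\<dots> \<le> e n * snorm u" using contr[OF u] e(2) by (rule mult_left_mono)
    finally show "cmod ((\<lambda>u\<in>carrier V. f (A u)) u - s u (A (x n))) \<le> e n * snorm u"
      using u sym[OF u approximates_closed[OF x]] by simp
  qed (use A approximates_closed[OF x] in blast)
qed

lemma lift_op_closed: "f \<in> completion_carrier \<Longrightarrow> lift_op A f \<in> completion_carrier"
  using lift_op_approximates[OF approximates_approx] by (auto simp: lift_op_def completion_carrier_def)

lemma lift_op_bounded: "bounded_op completion (lift_op A)"
proof -
  interpret compl: hilbert_space completion by (rule hilbert_space_completion)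
  show ?thesis
  proof (rule compl.bounded_opI[where K = 1])
    fix f assume "f \<in> carrier completion"
    then have f: "f \<in> completion_carrier" by simp
    have "compl.snorm (lift_op A f) \<le> compl.snorm f"
    proof (rule completion_norm_le)
      fix u assume u: "u \<in> carrier V"
      show "cmod (lift_op A f u) \<le> compl.snorm f * snorm u"
        using order_trans[OF completion_le_norm[OF f A[OF u]] mult_left_mono[OF contr[OF u]]] f u
        by (simp add: lift_op_def)
    qed (use f lift_op_closed[OF f] compl.snorm_nonneg[of f] in auto)
    then show "compl.snorm (lift_op A f) \<le> 1 * compl.snorm f" by (simp only: mult_1_left)
    show "lift_op A f \<in> carrier completion" using lift_op_closed[OF f] by (simp only: carrier_completion)
  next
    fix f c assume "f \<in> carrier completion"
    then have f: "f \<in> completion_carrier" by simp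
    show "lift_op A (c \<odot>\<^bsub>completion\<^esub> f) = c \<odot>\<^bsub>completion\<^esub> lift_op A f"
    proof (rule completion_ext)
      fix u assume u: "u \<in> carrier V"
      then show "lift_op A (c \<odot>\<^bsub>completion\<^esub> f) u = (c \<odot>\<^bsub>completion\<^esub> lift_op A f) u"
        using f A[OF u] completion_carrier_scale[OF f, of c] by (simp add: lift_op_def)
    qed (intro lift_op_closed completion_carrier_scale f)+
  next
    fix f g assume "f \<in> carrier completion" "g \<in> carrier completion"
    then have fg: "f \<in> completion_carrier" "g \<in> completion_carrier" by simp_all
    show "lift_op A (f \<oplus>\<^bsub>completion\<^esub> g) = lift_op A f \<oplus>\<^bsub>completion\<^esub> lift_op A g"
    proof (rule completion_ext)
      fix u assume u: "u \<in> carrier V"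
      then show "lift_op A (f \<oplus>\<^bsub>completion\<^esub> g) u = (lift_op A f \<oplus>\<^bsub>completion\<^esub> lift_op A g) u"
        using fg A[OF u] completion_carrier_add[OF fg] by (simp add: lift_op_def)
    qed (intro lift_op_closed completion_carrier_add fg)+
  qed (simp add: lift_op_def)
qed

lemma lift_op_symmetric:
  assumes f: "f \<in> completion_carrier" and g: "g \<in> completion_carrier"
  shows "hinner completion (lift_op A f) g = hinner completion f (lift_op A g)"
proof (rule LIMSEQ_unique)
  have "approximates (\<lambda>n. A (approx f n)) (lift_op A f)"
    using lift_op_approximates[OF approximates_approx[OF f]] f by (simp add: lift_op_def)
  from tendsto_hinner_completion[OF this lift_op_closed[OF f] g]
  show "(\<lambda>n. g (A (approx f n))) \<longlonglongrightarrow> hinner completion (lift_op A f) g" .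
  show "(\<lambda>n. g (A (approx f n))) \<longlonglongrightarrow> hinner completion f (lift_op A g)"
    using tendsto_hinner_completion[OF approximates_approx[OF f] f lift_op_closed[OF g]] f g
    by (simp add: lift_op_def)
qed

end

end

section \<open>Change of universe\<close>

text \<open>
  The structure of \<open>H\<close> carried to another type along a map that is injective on the carrier. The
  components \<open>mult\<close> and \<open>one\<close> are placeholders of the record of modules.
\<close>

definition transport :: "('k \<Rightarrow> 'h) \<Rightarrow> 'k hilbert \<Rightarrow> 'h hilbert" where
  "transport j H = (let i = inv_into (carrier H) j in \<lparr>
     carrier = j ` carrier H,
     mult = (\<lambda>x y. x),
     one = j \<zero>\<^bsub>H\<^esub>,
     zero = j \<zero>\<^bsub>H\<^esub>,
     add = (\<lambda>x y. j (i x \<oplus>\<^bsub>H\<^esub> i y)),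
     smult = (\<lambda>c x. j (c \<odot>\<^bsub>H\<^esub> i x)),
     hinner = (\<lambda>x y. hinner H (i x) (i y))\<rparr>)"

definition transport_op :: "('k \<Rightarrow> 'h) \<Rightarrow> 'k hilbert \<Rightarrow> ('k \<Rightarrow> 'k) \<Rightarrow> 'h \<Rightarrow> 'h" where
  "transport_op j H T = (\<lambda>x\<in>j ` carrier H. j (T (inv_into (carrier H) j x)))"

context hilbert_space
begin

context
  fixes j :: "'h \<Rightarrow> 'k"
  assumes inj: "inj_on j (carrier H)"
begin

lemma transport_simps [simp]:
  "carrier (transport j H) = j ` carrier H" "\<zero>\<^bsub>transport j H\<^esub> = j \<zero>"
  "\<lbrakk>u \<in> carrier H; v \<in> carrier H\<rbrakk> \<Longrightarrow> j u \<oplus>\<^bsub>transport j H\<^esub> j v = j (u \<oplus> v)"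
  "u \<in> carrier H \<Longrightarrow> c \<odot>\<^bsub>transport j H\<^esub> j u = j (c \<odot> u)"
  "\<lbrakk>u \<in> carrier H; v \<in> carrier H\<rbrakk> \<Longrightarrow> hinner (transport j H) (j u) (j v) = hinner H u v"
  "u \<in> carrier H \<Longrightarrow> transport_op j H T (j u) = j (T u)"
  using inj by (simp_all add: transport_def transport_op_def Let_def)

lemma semi_inner_transport: "semi_inner_space (transport j H) (hinner (transport j H))"
proof -
  have "abelian_group (transport j H)"
  proof (rule abelian_groupI)
    fix x assume "x \<in> carrier (transport j H)"
    then obtain v where "v \<in> carrier H" "x = j v" by auto
    then show "\<exists>y\<in>carrier (transport j H). y \<oplus>\<^bsub>transport j H\<^esub> x = \<zero>\<^bsub>transport j H\<^esub>"
      by (intro bexI[of _ "j (\<ominus> v)"]) (auto simp: M.l_neg)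
  qed (auto simp: M.a_ac)
  then have "Module.module complex_field (transport j H)"
    by (intro Module.moduleI cring_complex_field) (auto simp: scale_add_left scale_add_right scale_scale)
  then show ?thesis
    by (intro semi_inner_space.intro semi_inner_space_axioms.intro)
      (auto simp: form_add form_smult form_pos intro: form_cnj)
qed

lemma transport_minus:
  assumes "u \<in> carrier H" "v \<in> carrier H"
  shows "j u \<ominus>\<^bsub>transport j H\<^esub> j v = j (u \<ominus> v)"
proof -
  interpret t: semi_inner_space "transport j H" "hinner (transport j H)" by (rule semi_inner_transport)
  have "\<ominus>\<^bsub>transport j H\<^esub> j v = j (\<ominus> v)"
    using assms t.scale_minus_one[of "j v"] by (simp add: scale_minus_one)
  then show ?thesis using assms by (simp add: a_minus_def)
qed

lemma transport_norm: "u \<in> carrier H \<Longrightarrow> hnorm (transport j H) (j u) = snorm u"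
  by (simp add: hnorm_def snorm_def)

lemma hilbert_space_transport: "hilbert_space (transport j H)"
proof -
  interpret t: semi_inner_space "transport j H" "hinner (transport j H)" by (rule semi_inner_transport)
  show ?thesis
  proof (intro hilbert_space.intro t.module_axioms hilbert_space_axioms.intro)
    fix x assume "x \<in> carrier (transport j H)" "x \<noteq> \<zero>\<^bsub>transport j H\<^esub>"
    then show "0 < Re (hinner (transport j H) x x)" by (auto intro!: hinner_pos)
  next
    fix S :: "nat \<Rightarrow> 'k"
    assume S: "\<forall>n. S n \<in> carrier (transport j H)"
      and cau: "\<forall>\<epsilon>>0. \<exists>N. \<forall>m\<ge>N. \<forall>n\<ge>N. hnorm (transport j H) (S m \<ominus>\<^bsub>transport j H\<^esub> S n) < \<epsilon>"
    obtain r where r: "\<And>n. r n \<in> carrier H" "\<And>n. S n = j (r n)"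
    proof -
      have "\<forall>n. \<exists>r\<in>carrier H. S n = j r" using S by auto
      then show thesis using that by metis
    qed
    have "\<forall>\<epsilon>>0. \<exists>N. \<forall>m\<ge>N. \<forall>n\<ge>N. hnorm H (r m \<ominus> r n) < \<epsilon>"
      using cau r(1) by (simp add: r(2) transport_minus transport_norm)
    then obtain l where "l \<in> carrier H" "(\<lambda>n. hnorm H (r n \<ominus> l)) \<longlonglongrightarrow> 0"
      using complete[of r] r(1) by blast
    then show "\<exists>l\<in>carrier (transport j H). (\<lambda>n. hnorm (transport j H) (S n \<ominus>\<^bsub>transport j H\<^esub> l)) \<longlonglongrightarrow> 0"
      using r(1) by (intro bexI[of _ "j l"]) (auto simp: r(2) transport_minus transport_norm)
  qed (auto intro: t.form_add t.form_smult t.form_cnj)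
qed

lemma bounded_op_transport:
  assumes T: "bounded_op H T"
  shows "bounded_op (transport j H) (transport_op j H T)"
proof -
  interpret t: hilbert_space "transport j H" by (rule hilbert_space_transport)
  obtain K where K: "0 \<le> K" "\<And>v. v \<in> carrier H \<Longrightarrow> snorm (T v) \<le> K * snorm v"
    using bounded_op_bound[OF T] by blast
  note cl = bounded_op_closed[OF T]
  show ?thesis
  proof (rule t.bounded_opI[where K = K])
    fix x assume "x \<in> carrier (transport j H)"
    then obtain v where v: "v \<in> carrier H" "x = j v" by auto
    show "t.snorm (transport_op j H T x) \<le> K * t.snorm x"
      using K(2)[OF v(1)] transport_norm[OF v(1)] transport_norm[OF cl[OF v(1)]] v by simp
    show "transport_op j H T x \<in> carrier (transport j H)" using v cl by simp
    show "transport_op j H T (c \<odot>\<^bsub>transport j H\<^esub> x) = c \<odot>\<^bsub>transport j H\<^esub> transport_op j H T x" for c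
      using v cl by (simp add: bounded_op_scale[OF T])
    fix y assume "y \<in> carrier (transport j H)"
    then obtain w where w: "w \<in> carrier H" "y = j w" by auto
    show "transport_op j H T (x \<oplus>\<^bsub>transport j H\<^esub> y) = transport_op j H T x \<oplus>\<^bsub>transport j H\<^esub> transport_op j H T y"
      using v w cl by (simp add: bounded_op_add[OF T])
  next
    show "transport_op j H T \<in> extensional (carrier (transport j H))"
      unfolding transport_op_def transport_simps(1) by (rule restrict_extensional)
  qed
qed

lemma pvm_transport:
  fixes P :: "'a::finite \<Rightarrow> 'h \<Rightarrow> 'h"
  assumes P: "pvm H P"
  shows "pvm (transport j H) (\<lambda>a. transport_op j H (P a))"
proof -
  interpret t: hilbert_space "transport j H" by (rule hilbert_space_transport)
  note R = pvmD[OF P]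
  note cl = bounded_op_closed[OF R(1)]
  have "(\<Oplus>\<^bsub>transport j H\<^esub>a\<in>UNIV. j (P a v)) = j v" if v: "v \<in> carrier H" for v
  proof -
    have "j (\<Oplus>a\<in>UNIV. P a v) = (\<Oplus>\<^bsub>transport j H\<^esub>a\<in>UNIV. j (P a v))"
      using cl[OF v] by (intro additive_finsum M.abelian_monoid_axioms t.M.abelian_monoid_axioms) auto
    then show ?thesis using R(4)[OF v] by simp
  qed
  then show ?thesis
    unfolding t.pvm_iff by (auto simp: cl bounded_op_transport R(1,2,3))
qed

end

end

text \<open>
  A strategy on a Hilbert space over any type is realised in the universe \<open>'h\<close> once the carrier fits
  into it.
\<close>

lemma C_qc_change_universe:
  fixes H :: "'k hilbert"
  assumes H: "hilbert_space H" and small: "carrier H \<lesssim> (UNIV :: 'h set)"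
    and \<zeta>: "\<zeta> \<in> carrier H" "hnorm H \<zeta> = 1" and P: "\<And>x. pvm H (P x)" and Q: "\<And>y. pvm H (Q y)"
    and comm: "\<And>x y a b v. v \<in> carrier H \<Longrightarrow> P x a (Q y b v) = Q y b (P x a v)"
    and p: "\<And>x y a b. complex_of_real (p a b x y) = hinner H \<zeta> (P x a (Q y b \<zeta>))"
  shows "p \<in> C_qc TYPE('h)"
proof -
  interpret hilbert_space H by fact
  obtain j :: "'k \<Rightarrow> 'h" where inj: "inj_on j (carrier H)" using small unfolding lepoll_def by blast
  let ?t = "transport_op j H"
  have b: "bounded_op H (P x a)" "bounded_op H (Q y b)" for x y a b
    using P Q by (simp_all add: pvm_def)
  note cl = bounded_op_closed[OF b(1)] bounded_op_closed[OF b(2)]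
  show ?thesis
    unfolding C_qc_def
  proof (intro CollectI exI[of _ "transport j H"] exI[of _ "j \<zeta>"] exI[of _ "\<lambda>x a. ?t (P x a)"]
      exI[of _ "\<lambda>y b. ?t (Q y b)"] conjI allI)
    show "?t (P x a) \<otimes>\<^bsub>op_alg (transport j H)\<^esub> ?t (Q y b) = ?t (Q y b) \<otimes>\<^bsub>op_alg (transport j H)\<^esub> ?t (P x a)" for x y a b
      using inj by (intro extensionalityI[OF op_alg_extensional(1) op_alg_extensional(1)]) (auto simp: cl comm)
    show "hilbert_space (transport j H)" by (rule hilbert_space_transport[OF inj])
    show "j \<zeta> \<in> carrier (transport j H)" using inj \<zeta>(1) by simp
    show "hnorm (transport j H) (j \<zeta>) = 1" using transport_norm[OF inj \<zeta>(1)] \<zeta>(2) by simp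
    show "pvm (transport j H) (\<lambda>a. ?t (P x a))" for x by (rule pvm_transport[OF inj P])
    show "pvm (transport j H) (\<lambda>b. ?t (Q y b))" for y by (rule pvm_transport[OF inj Q])
    show "complex_of_real (p a b x y)
        = hinner (transport j H) (j \<zeta>) ((?t (P x a) \<otimes>\<^bsub>op_alg (transport j H)\<^esub> ?t (Q y b)) (j \<zeta>))" for x y a b
      using inj \<zeta>(1) cl by (simp add: p)
  qed
qed

section \<open>The Gelfand-Naimark-Segal construction for a trace\<close>

text \<open>
  A sequence of complex numbers is encoded by the rational cuts of the real and imaginary parts of
  its terms, which form a subset of a countable set.
\<close>

lemma lepoll_sequences: "(UNIV :: (nat \<Rightarrow> complex) set) \<lesssim> (UNIV :: real set)"
proof -
  define cut where "cut f = {to_nat (n, k, q) | (n :: nat) (k :: bool) (q :: rat).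
      of_rat q < (if k then Re (f n) else Im (f n))}" for f :: "nat \<Rightarrow> complex"
  have cut_iff: "to_nat (n, k, q) \<in> cut f \<longleftrightarrow> of_rat q < (if k then Re (f n) else Im (f n))" for n k q f
    by (auto simp: cut_def)
  have eq: "r = t" if "\<And>q. of_rat q < r \<longleftrightarrow> of_rat q < t" for r t :: real
    using that of_rat_dense[of r t] of_rat_dense[of t r]
    by (meson less_asym linorder_neqE_linordered_idom)
  have "inj cut"
  proof (rule injI, rule ext)
    fix f g :: "nat \<Rightarrow> complex" and n assume "cut f = cut g"
    then have *: "of_rat q < (if k then Re (f n) else Im (f n)) \<longleftrightarrow> of_rat q < (if k then Re (g n) else Im (g n))" for k q
      using cut_iff by metis
    show "f n = g n"
      using eq[OF *[of _ True, simplified]] eq[OF *[of _ False, simplified]] by (simp add: complex_eq_iff)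
  qed
  then have "(UNIV :: (nat \<Rightarrow> complex) set) \<lesssim> (UNIV :: nat set set)" unfolding lepoll_def by blast
  also have "\<dots> \<lesssim> (UNIV :: real set)" using nat_sets_eqpoll_reals by (rule eqpoll_imp_lepoll)
  finally show ?thesis .
qed

lemma lepoll_countable_functions:
  fixes F :: "('v \<Rightarrow> complex) set" and D :: "'v set"
  assumes D: "countable D" and determined: "\<And>f g. \<lbrakk>f \<in> F; g \<in> F; \<And>d. d \<in> D \<Longrightarrow> f d = g d\<rbrakk> \<Longrightarrow> f = g"
  shows "F \<lesssim> (UNIV :: real set)"
proof -
  have "inj_on (\<lambda>f n. f (from_nat_into D n)) F"
  proof (rule inj_onI)
    fix f g assume fg: "f \<in> F" "g \<in> F" and eq: "(\<lambda>n. f (from_nat_into D n)) = (\<lambda>n. g (from_nat_into D n))"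
    have "f d = g d" if "d \<in> D" for d
      using fun_cong[OF eq, of "to_nat_on D d"] D that by simp
    then show "f = g" by (rule determined[OF fg])
  qed
  then have "F \<lesssim> (UNIV :: (nat \<Rightarrow> complex) set)" unfolding lepoll_def by blast
  then show ?thesis using lepoll_sequences by (rule lepoll_trans)
qed

text \<open>
  The sum condition is evaluated at a vector \<open>u\<close>, where it becomes additivity of \<open>f\<close> on \<open>u = \<Sum>\<^sub>a A\<^sub>a u\<close>.
\<close>

lemma (in semi_inner_space) pvm_lift:
  fixes A :: "'a::finite \<Rightarrow> 'v \<Rightarrow> 'v"
  assumes A: "\<And>a u. u \<in> carrier V \<Longrightarrow> A a u \<in> carrier V"
    and sym: "\<And>a u v. \<lbrakk>u \<in> carrier V; v \<in> carrier V\<rbrakk> \<Longrightarrow> s (A a u) v = s u (A a v)"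
    and idem: "\<And>a u. u \<in> carrier V \<Longrightarrow> A a (A a u) = A a u"
    and sum: "\<And>u. u \<in> carrier V \<Longrightarrow> (\<Oplus>a\<in>UNIV. A a u) = u"
  shows "pvm completion (\<lambda>a. lift_op (A a))"
proof -
  interpret compl: hilbert_space completion by (rule hilbert_space_completion)
  have contr: "snorm (A a u) \<le> snorm u" if "u \<in> carrier V" for a u
    by (rule symmetric_idempotent_contractive) (use A sym idem that in auto)
  have closed: "lift_op (A a) f \<in> completion_carrier" if "f \<in> completion_carrier" for a f
    by (rule lift_op_closed) (use A sym contr that in auto)
  have "(\<Oplus>\<^bsub>completion\<^esub>a\<in>UNIV. lift_op (A a) f) = f" if f: "f \<in> completion_carrier" for f
  proof (rule completion_ext)
    show "(\<Oplus>\<^bsub>completion\<^esub>a\<in>UNIV. lift_op (A a) f) \<in> completion_carrier"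
      using compl.M.finsum_closed[of "\<lambda>a. lift_op (A a) f" UNIV] closed[OF f] by simp
    fix u assume u: "u \<in> carrier V"
    have f0: "f \<zero> = 0" using completion_scale[OF f M.zero_closed, of 0] smult_l_null[OF M.zero_closed] by simp
    have "(\<Oplus>\<^bsub>completion\<^esub>a\<in>UNIV. lift_op (A a) f) u = (\<Sum>a\<in>UNIV. lift_op (A a) f u)"
      using u closed[OF f]
      by (intro additive_sum[where \<phi> = "\<lambda>f. f u"] compl.M.abelian_monoid_axioms) auto
    also have "\<dots> = (\<Sum>a\<in>UNIV. f (A a u))" using f u by (simp add: lift_op_def)
    also have "\<dots> = f (\<Oplus>a\<in>UNIV. A a u)"
      using A[OF u] f0 completion_add[OF f]
      by (intro additive_sum[symmetric] M.abelian_monoid_axioms) auto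
    finally show "(\<Oplus>\<^bsub>completion\<^esub>a\<in>UNIV. lift_op (A a) f) u = f u" using sum[OF u] by simp
  qed fact
  moreover have "lift_op (A a) (lift_op (A a) f) = lift_op (A a) f" if f: "f \<in> completion_carrier" for a f
  proof (rule completion_ext)
    fix u assume u: "u \<in> carrier V"
    then show "lift_op (A a) (lift_op (A a) f) u = lift_op (A a) f u"
      using f closed[OF f, of a] A[OF u] by (simp add: lift_op_def idem)
  qed (intro closed f)+
  ultimately show ?thesis
    unfolding compl.pvm_iff
    using lift_op_bounded[of "A a" for a] lift_op_symmetric[of "A a" for a] A sym contr by auto
qed

text \<open>
  Polarisation: \<open>\<tau>((u + c v)\<^sup>* (u + c v))\<close> is real for \<open>c = 1\<close> and for \<open>c = \<i>\<close>, which gives the imaginary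
  and the real part of the claim.
\<close>

lemma positive_hermitian:
  assumes M: "star_algebra M" and \<tau>: "trace M \<tau>" and u: "u \<in> carrier M" and v: "v \<in> carrier M"
  shows "\<tau> (alg_star M v \<otimes>\<^bsub>M\<^esub> u) = cnj (\<tau> (alg_star M u \<otimes>\<^bsub>M\<^esub> v))"
proof -
  interpret star_algebra M by (rule M)
  have add: "\<And>z w. \<lbrakk>z \<in> carrier M; w \<in> carrier M\<rbrakk> \<Longrightarrow> \<tau> (z \<oplus>\<^bsub>M\<^esub> w) = \<tau> z + \<tau> w"
    and scale: "\<And>c z. z \<in> carrier M \<Longrightarrow> \<tau> (c \<odot>\<^bsub>M\<^esub> z) = c * \<tau> z"
    and pos: "\<And>z. z \<in> carrier M \<Longrightarrow> Im (\<tau> (alg_star M z \<otimes>\<^bsub>M\<^esub> z)) = 0"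
    using \<tau> by (auto simp: trace_def complex_nonneg_Reals_iff)
  have Im_sum: "Im (c * \<tau> (alg_star M u \<otimes>\<^bsub>M\<^esub> v) + cnj c * \<tau> (alg_star M v \<otimes>\<^bsub>M\<^esub> u)) = 0" for c
  proof -
    have "\<tau> (alg_star M (u \<oplus>\<^bsub>M\<^esub> c \<odot>\<^bsub>M\<^esub> v) \<otimes>\<^bsub>M\<^esub> (u \<oplus>\<^bsub>M\<^esub> c \<odot>\<^bsub>M\<^esub> v))
      = \<tau> (alg_star M u \<otimes>\<^bsub>M\<^esub> u) + (c * \<tau> (alg_star M u \<otimes>\<^bsub>M\<^esub> v) + cnj c * \<tau> (alg_star M v \<otimes>\<^bsub>M\<^esub> u))
        + of_real ((cmod c)\<^sup>2) * \<tau> (alg_star M v \<otimes>\<^bsub>M\<^esub> v)"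
      using u v unfolding complex_norm_square
      by (simp add: star_add star_scale l_distr r_distr scale_mult_left scale_mult_right add scale
          scale_scale algebra_simps)
    from arg_cong[OF this, of Im] show ?thesis
      using pos[of "u \<oplus>\<^bsub>M\<^esub> c \<odot>\<^bsub>M\<^esub> v"] pos[OF u] pos[OF v] u v by simp
  qed
  show ?thesis using Im_sum[of 1] Im_sum[of \<i>] by (simp add: complex_eq_iff)
qed

primrec word :: "('x::finite \<times> 'a::finite) list \<Rightarrow> ('x, 'a, 'h) game_elem" where
  "word [] = \<one>\<^bsub>game_alg\<^esub>"
| "word (s # w) = gen (fst s) (snd s) \<otimes>\<^bsub>game_alg\<^esub> word w"

text \<open>
  The linear span of the words in the generators. It is stable under multiplication by generators
  from both sides, and a functional on it is determined by its values on the countably many words.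
\<close>

inductive_set word_span :: "('x::finite, 'a::finite, 'h) game_elem set" where
  word: "word w \<in> word_span"
| add: "\<lbrakk>u \<in> word_span; v \<in> word_span\<rbrakk> \<Longrightarrow> u \<oplus>\<^bsub>game_alg\<^esub> v \<in> word_span"
| scale: "u \<in> word_span \<Longrightarrow> c \<odot>\<^bsub>game_alg\<^esub> u \<in> word_span"

context
  \<comment> \<open>The algebra laws are stated for the operations of the free product itself; unfolding these to the
  operations of the surrounding product would hide them.\<close>
  notes game_alg_ops [simp del]
begin

lemma word_closed: "word w \<in> carrier game_alg"
  by (induction w) auto

lemma word_span_closed: "u \<in> word_span \<Longrightarrow> u \<in> carrier game_alg"
  by (induction rule: word_span.induct) (auto simp: word_closed)

lemma word_append_gen: "word w \<otimes>\<^bsub>game_alg\<^esub> gen x a = word (w @ [(x, a)])"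
  by (induction w) (auto simp: word_closed game.m_assoc)

lemma word_span_left: "u \<in> word_span \<Longrightarrow> gen x a \<otimes>\<^bsub>game_alg\<^esub> u \<in> word_span"
proof (induction rule: word_span.induct)
  case (word w)
  show ?case using word_span.word[of "(x, a) # w"] by simp
qed (simp_all add: game.r_distr game.scale_mult_right word_span_closed word_span.add word_span.scale)

lemma word_span_right_gen: "u \<in> word_span \<Longrightarrow> u \<otimes>\<^bsub>game_alg\<^esub> gen x a \<in> word_span"
proof (induction rule: word_span.induct)
  case (word w)
  show ?case unfolding word_append_gen by (rule word_span.word)
qed (simp_all add: game.l_distr game.scale_mult_left word_span_closed word_span.add word_span.scale)

lemma word_span_zero: "\<zero>\<^bsub>game_alg\<^esub> \<in> word_span"
  using word_span.scale[OF word_span.word, of 0 "[]"] by (simp add: game.scale_zero)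

text \<open>
  The hypothesis \<open>\<rho>(\<S>\<^bsub>Y,B\<^esub>) \<subseteq> \<S>\<^bsub>X,A\<^esub>\<close> enters through this lemma: right multiplication by \<open>\<rho>(f\<^bsub>y,b\<^esub>)\<close> does not
  lead out of the span of the words.
\<close>

lemma word_span_right:
  assumes u: "u \<in> word_span" and w: "w \<in> gen_span"
  shows "u \<otimes>\<^bsub>game_alg\<^esub> w \<in> word_span"
proof -
  let ?B = "{w \<in> carrier game_alg. u \<otimes>\<^bsub>game_alg\<^esub> w \<in> word_span}"
  have "gen_span \<subseteq> ?B"
    unfolding gen_span_def using word_span_closed[OF u]
    by (intro game.linear_span_least)
      (auto simp: game.r_distr game.scale_mult_right word_span_zero word_span.add word_span.scale
        word_span_right_gen[OF u])
  then show ?thesis using w by blast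
qed

lemma module_word_span: "Module.module complex_field (game_alg\<lparr>carrier := word_span\<rparr>)"
proof (rule Module.moduleI[OF cring_complex_field])
  show "abelian_group (game_alg\<lparr>carrier := word_span\<rparr>)"
  proof (rule abelian_groupI)
    fix u assume "u \<in> carrier (game_alg\<lparr>carrier := word_span\<rparr>)"
    then have u: "u \<in> word_span" by simp
    show "\<exists>v\<in>carrier (game_alg\<lparr>carrier := word_span\<rparr>).
        v \<oplus>\<^bsub>game_alg\<lparr>carrier := word_span\<rparr>\<^esub> u = \<zero>\<^bsub>game_alg\<lparr>carrier := word_span\<rparr>\<^esub>"
      using word_span_closed[OF u] word_span.scale[OF u, of "-1"]
      by (intro bexI[of _ "(-1) \<odot>\<^bsub>game_alg\<^esub> u"]) (simp_all add: game.scale_minus_one game.l_neg)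
  qed (auto simp: word_span_closed word_span_zero game.a_ac intro: word_span.add)
qed (auto simp: word_span_closed game.scale_add_left game.scale_add_right game.scale_scale intro: word_span.scale)

context
  fixes \<tau> :: "('x::finite, 'a::finite, 'h) game_elem \<Rightarrow> complex"
  assumes \<tau>: "trace game_alg \<tau>"
begin

abbreviation gns_form where "gns_form u v \<equiv> \<tau> (alg_star game_alg u \<otimes>\<^bsub>game_alg\<^esub> v)"

lemma traceD:
  "\<lbrakk>z \<in> carrier game_alg; w \<in> carrier game_alg\<rbrakk> \<Longrightarrow> \<tau> (z \<oplus>\<^bsub>game_alg\<^esub> w) = \<tau> z + \<tau> w"
  "z \<in> carrier game_alg \<Longrightarrow> \<tau> (c \<odot>\<^bsub>game_alg\<^esub> z) = c * \<tau> z"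
  "z \<in> carrier game_alg \<Longrightarrow> \<tau> (alg_star game_alg z \<otimes>\<^bsub>game_alg\<^esub> z) \<in> \<real>\<^sub>\<ge>\<^sub>0"
  "\<lbrakk>z \<in> carrier game_alg; w \<in> carrier game_alg\<rbrakk> \<Longrightarrow> \<tau> (z \<otimes>\<^bsub>game_alg\<^esub> w) = \<tau> (w \<otimes>\<^bsub>game_alg\<^esub> z)"
  using \<tau> by (auto simp: trace_def)

lemma trace_finsum:
  assumes "finite A" "\<And>i. i \<in> A \<Longrightarrow> f i \<in> carrier game_alg"
  shows "\<tau> (\<Oplus>\<^bsub>game_alg\<^esub>i\<in>A. f i) = (\<Sum>i\<in>A. \<tau> (f i))"
proof (rule additive_sum[OF game.abelian_monoid_axioms _ traceD(1) assms])
  show "\<tau> \<zero>\<^bsub>game_alg\<^esub> = 0"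
    using traceD(2)[OF game.zero_closed, of 0] by (simp add: game.scale_zero)
qed

lemma semi_inner_gns: "semi_inner_space (game_alg\<lparr>carrier := word_span\<rparr>) gns_form"
proof (intro semi_inner_space.intro module_word_span semi_inner_space_axioms.intro)
  fix u v :: "('x, 'a, 'h) game_elem"
  assume "u \<in> carrier (game_alg\<lparr>carrier := word_span\<rparr>)" "v \<in> carrier (game_alg\<lparr>carrier := word_span\<rparr>)"
  then show "gns_form v u = cnj (gns_form u v)"
    by (intro positive_hermitian[OF game.star_algebra_axioms \<tau>]) (auto intro: word_span_closed)
qed (use traceD in \<open>auto simp: word_span_closed game.r_distr game.scale_mult_right complex_nonneg_Reals_iff\<close>)

end

text \<open>
  \<open>P\<close> and \<open>Q\<close> below are left multiplication by \<open>e\<^bsub>x,a\<^esub>\<close> and right multiplication by \<open>\<rho>(f\<^bsub>y,b\<^esub>)\<close>. They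
  commute by associativity and are symmetric idempotents, in the case of \<open>Q\<close> because \<open>\<tau>\<close> is a
  trace. Their lifts to the completion are projection-valued measures, and the vector of the unit
  yields \<open>\<tau>((e\<^bsub>x,a\<^esub> \<rho>(f\<^bsub>y,b\<^esub>))\<^sup>*) = \<tau>(\<rho>(f\<^bsub>y,b\<^esub>) e\<^bsub>x,a\<^esub>) = \<tau>(e\<^bsub>x,a\<^esub> \<rho>(f\<^bsub>y,b\<^esub>))\<close>.
\<close>

theorem correlation_of_trace:
  fixes p :: "('x::finite, 'y::finite, 'a::finite, 'b::finite) correlation"
    and \<tau> :: "('x, 'a, 'h) game_elem \<Rightarrow> complex"
    and \<rho> :: "('y, 'b, 'h) game_elem \<Rightarrow> ('x, 'a, 'h) game_elem"
  assumes universe: "(UNIV :: real set) \<lesssim> (UNIV :: 'h set)"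
    and \<tau>: "trace game_alg \<tau>" and \<rho>: "unital_star_hom game_alg game_alg \<rho>"
    and span: "\<rho> ` gen_span \<subseteq> gen_span"
    and p: "\<And>x y a b. complex_of_real (p a b x y) = \<tau> (gen x a \<otimes>\<^bsub>game_alg\<^esub> \<rho> (gen y b))"
    and total: "\<And>x y. (\<Sum>a\<in>UNIV. \<Sum>b\<in>UNIV. p a b x y) = 1"
  shows "p \<in> C_qc TYPE('h)"
proof -
  let ?A = "game_alg :: ('x, 'a, 'h) game_elem star_alg"
  let ?V = "?A\<lparr>carrier := word_span\<rparr>"
  interpret V: semi_inner_space ?V "gns_form \<tau>" by (rule semi_inner_gns[OF \<tau>])
  interpret H: hilbert_space V.completion by (rule V.hilbert_space_completion)
  define q where "q y b = \<rho> (gen y b)" for y b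
  note hom = unital_star_homD[OF \<rho>]
  have q: "q y b \<in> carrier ?A" "q y b \<in> gen_span" "q y b \<otimes>\<^bsub>?A\<^esub> q y b = q y b" "alg_star ?A (q y b) = q y b" for y b
    using hom(1)[OF gen_mem] span gen_span_subspace(5)[of y b] hom(4)[OF gen_mem gen_mem, of y b y b]
      hom(6)[OF gen_mem, of y b]
    by (auto simp: q_def gen_idem gen_star)
  have q_sum: "(\<Oplus>\<^bsub>?A\<^esub>b\<in>UNIV. q y b) = \<one>\<^bsub>?A\<^esub>" for y
    using unital_star_hom_finsum[OF game.star_algebra_axioms game.star_algebra_axioms \<rho>, of UNIV "gen y"]
    by (simp add: q_def gen_sum hom(2))
  have V_sum: "(\<Oplus>\<^bsub>?V\<^esub>i\<in>A. f i) = (\<Oplus>\<^bsub>?A\<^esub>i\<in>A. f i)"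
    if "finite A" "\<And>i. i \<in> A \<Longrightarrow> f i \<in> word_span" for A and f :: "'i \<Rightarrow> ('x, 'a, 'h) game_elem"
    using that by (intro additive_finsum[where \<phi> = "\<lambda>u. u"] V.M.abelian_monoid_axioms game.abelian_monoid_axioms)
      (auto simp: word_span_closed)
  define P where "P x a u = gen x a \<otimes>\<^bsub>?A\<^esub> u" for x a u
  define Q where "Q y b u = u \<otimes>\<^bsub>?A\<^esub> q y b" for y b u
  have P_mem: "P x a u \<in> word_span" and Q_mem: "Q y b u \<in> word_span" if "u \<in> word_span" for x a y b u
    using that by (auto simp: P_def Q_def word_span_left word_span_right q)
  have pvm_P: "pvm V.completion (\<lambda>a. V.lift_op (P x a))" for x
  proof (rule V.pvm_lift)
    fix a u assume "u \<in> carrier ?V"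
    then have u: "u \<in> word_span" and uA: "u \<in> carrier ?A" by (auto simp: word_span_closed)
    show "P x a u \<in> carrier ?V" using u P_mem by simp
    show "P x a (P x a u) = P x a u" using uA by (simp add: P_def gen_idem flip: game.m_assoc)
    show "(\<Oplus>\<^bsub>?V\<^esub>a\<in>UNIV. P x a u) = u"
    proof -
      have "(\<Oplus>\<^bsub>?V\<^esub>a\<in>UNIV. P x a u) = (\<Oplus>\<^bsub>?A\<^esub>a\<in>UNIV. gen x a \<otimes>\<^bsub>?A\<^esub> u)"
        using V_sum[of UNIV "\<lambda>a. P x a u"] P_mem[OF u] by (simp add: P_def)
      also have "\<dots> = (\<Oplus>\<^bsub>?A\<^esub>a\<in>UNIV. gen x a) \<otimes>\<^bsub>?A\<^esub> u"
        using uA by (intro game.finsum_ldistr[symmetric]) auto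
      finally show ?thesis using uA by (simp add: gen_sum)
    qed
    fix v assume "v \<in> carrier ?V"
    then have vA: "v \<in> carrier ?A" by (auto simp: word_span_closed)
    show "gns_form \<tau> (P x a u) v = gns_form \<tau> u (P x a v)"
      using uA vA by (simp add: P_def game.star_mult gen_star game.m_assoc)
  qed
  have pvm_Q: "pvm V.completion (\<lambda>b. V.lift_op (Q y b))" for y
  proof (rule V.pvm_lift)
    fix b u assume "u \<in> carrier ?V"
    then have u: "u \<in> word_span" and uA: "u \<in> carrier ?A" by (auto simp: word_span_closed)
    show "Q y b u \<in> carrier ?V" using u Q_mem by simp
    show "Q y b (Q y b u) = Q y b u" using uA by (simp add: Q_def q game.m_assoc)
    show "(\<Oplus>\<^bsub>?V\<^esub>b\<in>UNIV. Q y b u) = u"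
    proof -
      have "(\<Oplus>\<^bsub>?V\<^esub>b\<in>UNIV. Q y b u) = (\<Oplus>\<^bsub>?A\<^esub>b\<in>UNIV. u \<otimes>\<^bsub>?A\<^esub> q y b)"
        using V_sum[of UNIV "\<lambda>b. Q y b u"] Q_mem[OF u] by (simp add: Q_def)
      also have "\<dots> = u \<otimes>\<^bsub>?A\<^esub> (\<Oplus>\<^bsub>?A\<^esub>b\<in>UNIV. q y b)"
        using uA q by (intro game.finsum_rdistr[symmetric]) auto
      finally show ?thesis using uA by (simp add: q_sum)
    qed
    fix v assume "v \<in> carrier ?V"
    then have vA: "v \<in> carrier ?A" by (auto simp: word_span_closed)
    have "gns_form \<tau> (Q y b u) v = \<tau> (q y b \<otimes>\<^bsub>?A\<^esub> (alg_star ?A u \<otimes>\<^bsub>?A\<^esub> v))"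
      using uA vA by (simp add: Q_def game.star_mult q game.m_assoc)
    also have "\<dots> = \<tau> ((alg_star ?A u \<otimes>\<^bsub>?A\<^esub> v) \<otimes>\<^bsub>?A\<^esub> q y b)"
      using uA vA q by (intro traceD(4)[OF \<tau>]) auto
    also have "\<dots> = gns_form \<tau> u (Q y b v)"
      using uA vA q by (simp add: Q_def game.m_assoc)
    finally show "gns_form \<tau> (Q y b u) v = gns_form \<tau> u (Q y b v)" .
  qed
  \<comment> \<open>The probabilities of one question pair add up to one, which normalises the trace.\<close>
  have \<tau>_one: "\<tau> \<one>\<^bsub>?A\<^esub> = 1"
  proof -
    fix x :: 'x and y :: 'y
    have "(\<Sum>b\<in>UNIV. complex_of_real (p a b x y)) = \<tau> (gen x a)" for a
    proof -
      have "(\<Sum>b\<in>UNIV. complex_of_real (p a b x y)) = \<tau> (\<Oplus>\<^bsub>?A\<^esub>b\<in>UNIV. gen x a \<otimes>\<^bsub>?A\<^esub> q y b)"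
        unfolding p by (subst trace_finsum[OF \<tau>]) (auto simp: q q_def[symmetric])
      also have "(\<Oplus>\<^bsub>?A\<^esub>b\<in>UNIV. gen x a \<otimes>\<^bsub>?A\<^esub> q y b) = gen x a \<otimes>\<^bsub>?A\<^esub> (\<Oplus>\<^bsub>?A\<^esub>b\<in>UNIV. q y b)"
        using q by (intro game.finsum_rdistr[symmetric]) auto
      finally show ?thesis by (simp add: q_sum)
    qed
    then have "(\<Sum>a\<in>UNIV. \<Sum>b\<in>UNIV. complex_of_real (p a b x y)) = \<tau> (\<Oplus>\<^bsub>?A\<^esub>a\<in>UNIV. gen x a)"
      by (subst trace_finsum[OF \<tau>]) auto
    then show ?thesis using total[of x y] by (simp add: gen_sum flip: of_real_sum)
  qed
  define \<zeta> where "\<zeta> = (\<lambda>u\<in>word_span. gns_form \<tau> u \<one>\<^bsub>?A\<^esub>)"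
  have one: "\<one>\<^bsub>?A\<^esub> \<in> word_span" using word_span.word[of "[]"] by simp
  have \<zeta>: "\<zeta> \<in> V.completion_carrier" using V.embed_closed[of "\<one>\<^bsub>?A\<^esub>"] one by (simp add: \<zeta>_def)
  have \<zeta>_inner: "hinner V.completion \<zeta> f = f \<one>\<^bsub>?A\<^esub>" if "f \<in> V.completion_carrier" for f
    using V.hinner_embed[of "\<one>\<^bsub>?A\<^esub>" f] one that by (simp add: \<zeta>_def)
  note lift_closed = bounded_op_closed[OF H.pvmD(1)[OF pvm_P]] bounded_op_closed[OF H.pvmD(1)[OF pvm_Q]]
  have small: "V.completion_carrier \<lesssim> (UNIV :: real set)"
  proof (rule lepoll_countable_functions)
    show "countable (range word :: ('x, 'a, 'h) game_elem set)"
      using countable_lists[of "UNIV :: ('x \<times> 'a) set"] by (simp add: countable_finite)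
    fix f g assume f: "f \<in> V.completion_carrier" and g: "g \<in> V.completion_carrier"
      and eq: "\<And>d. d \<in> range word \<Longrightarrow> f d = g d"
    show "f = g"
    proof (rule V.completion_ext[OF f g])
      fix u assume "u \<in> carrier ?V"
      then have "u \<in> word_span" by simp
      then show "f u = g u"
        by (induction rule: word_span.induct)
          (use eq V.completion_add[OF f] V.completion_add[OF g] V.completion_scale[OF f] V.completion_scale[OF g] in auto)
    qed
  qed
  show ?thesis
  proof (rule C_qc_change_universe[where H = V.completion and \<zeta> = \<zeta>, OF H.hilbert_space_axioms _ _ _ pvm_P pvm_Q])
    show "carrier V.completion \<lesssim> (UNIV :: 'h set)" using lepoll_trans[OF small universe] by simp
    show "\<zeta> \<in> carrier V.completion" using \<zeta> by simp
    show "hnorm V.completion \<zeta> = 1"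
      using \<zeta> one \<zeta>_inner[OF \<zeta>] \<tau>_one by (simp add: hnorm_def \<zeta>_def)
  next
    fix x y a b f assume "f \<in> carrier V.completion"
    then have f: "f \<in> V.completion_carrier" by simp
    show "V.lift_op (P x a) (V.lift_op (Q y b) f) = V.lift_op (Q y b) (V.lift_op (P x a) f)"
    proof (rule V.completion_ext)
      fix u assume "u \<in> carrier ?V"
      then have u: "u \<in> word_span" by simp
      then show "V.lift_op (P x a) (V.lift_op (Q y b) f) u = V.lift_op (Q y b) (V.lift_op (P x a) f) u"
        using f lift_closed(1)[of f] lift_closed(2)[of f] P_mem[OF u] Q_mem[OF u] word_span_closed[OF u]
        by (simp add: V.lift_op_def) (simp add: P_def Q_def game.m_assoc q)
    qed (use f lift_closed in auto)
  next
    fix x y a b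
    have Q\<zeta>: "V.lift_op (Q y b) \<zeta> \<in> V.completion_carrier" using lift_closed(2)[of \<zeta>] \<zeta> by simp
    then have "V.lift_op (P x a) (V.lift_op (Q y b) \<zeta>) \<in> V.completion_carrier"
      using lift_closed(1)[of "V.lift_op (Q y b) \<zeta>"] by simp
    then have "hinner V.completion \<zeta> (V.lift_op (P x a) (V.lift_op (Q y b) \<zeta>))
        = V.lift_op (P x a) (V.lift_op (Q y b) \<zeta>) \<one>\<^bsub>?A\<^esub>" by (rule \<zeta>_inner)
    also have "\<dots> = V.lift_op (Q y b) \<zeta> (P x a \<one>\<^bsub>?A\<^esub>)" using Q\<zeta> one by (simp add: V.lift_op_def[of "P x a"])
    also have "\<dots> = \<zeta> (Q y b (P x a \<one>\<^bsub>?A\<^esub>))" using \<zeta> P_mem[OF one] by (simp add: V.lift_op_def)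
    also have "\<dots> = \<tau> (q y b \<otimes>\<^bsub>?A\<^esub> gen x a)"
      using one P_mem Q_mem by (simp add: \<zeta>_def) (simp add: P_def Q_def game.star_mult q gen_star)
    also have "\<dots> = \<tau> (gen x a \<otimes>\<^bsub>?A\<^esub> q y b)" using q by (intro traceD(4)[OF \<tau>]) auto
    finally show "complex_of_real (p a b x y) = hinner V.completion \<zeta> (V.lift_op (P x a) (V.lift_op (Q y b) \<zeta>))"
      by (simp add: p q_def)
  qed
qed

end

theorem theorem6p3:
  fixes lam :: "('x::finite, 'y::finite, 'a::finite, 'b::finite) rule"
    and p :: "('x, 'y, 'a, 'b) correlation"
  assumes universe: "(UNIV :: real set) \<lesssim> (UNIV :: 'h set)"
    and mirror: "mirror_game lam"
    and p: "p \<in> perfect lam C_ns"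
  shows "p \<in> perfect lam (C_qc TYPE('h)) \<longleftrightarrow>
    (\<exists>(\<tau> :: ('x, 'a, 'h) game_elem \<Rightarrow> complex)
      (\<rho> :: ('y, 'b, 'h) game_elem \<Rightarrow> ('x, 'a, 'h) game_elem).
       trace game_alg \<tau> \<and>
       unital_star_hom game_alg game_alg \<rho> \<and>
       \<rho> ` gen_span \<subseteq> gen_span \<and>
       (\<forall>x y a b. complex_of_real (p a b x y) = \<tau> (gen x a \<otimes>\<^bsub>game_alg\<^esub> \<rho> (gen y b))))"
  (is "?lhs \<longleftrightarrow> ?rhs")
proof
  show "?lhs \<Longrightarrow> ?rhs" by (rule trace_of_correlation[OF mirror])
  assume ?rhs
  then obtain \<tau> :: "('x, 'a, 'h) game_elem \<Rightarrow> complex"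
      and \<rho> :: "('y, 'b, 'h) game_elem \<Rightarrow> ('x, 'a, 'h) game_elem"
    where *: "trace game_alg \<tau>" "unital_star_hom game_alg game_alg \<rho>" "\<rho> ` gen_span \<subseteq> gen_span"
      "\<And>x y a b. complex_of_real (p a b x y) = \<tau> (gen x a \<otimes>\<^bsub>game_alg\<^esub> \<rho> (gen y b))" by blast
  have "p \<in> C_qc TYPE('h)"
    using p by (intro correlation_of_trace[OF universe *]) (auto simp: perfect_def C_ns_def)
  then show ?lhs using p by (simp add: perfect_def)
qed

end
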